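(* Let $(M^2,g)$ be an oriented Riemannian $2$-manifold, let $\delta>0$, and let $\gamma:(-\delta,\delta)\to M^2$ be a $C^\infty$ curve such that $t=0$ is a $3/2$-cusp. Let $s_g(t)=\int_0^t|\dot\gamma(u)|\,du$ be the arclength parameter and $\kappa_g$ the geodesic curvature (for $t\ne0$ near $0$). Then $\tau=\operatorname{sgn}(t)\sqrt{|s_g|}$ can be taken to be a coordinate of $\gamma$ at $t=0$ (the half-arclength parameter), and $\sqrt{|s_g|}\,\kappa_g$ is a $C^\infty$-function of $t$ (and of $\tau$) at $t=0$. Moreover, $$\lim_{t\to0}\sqrt{|s_g|}\,\kappa_g=\frac{\mu_g}{2\sqrt2},$$ where $\mu_g$ is the cuspidal curvature of $\gamma$ at $t=0$. Conversely, for any $C^\infty$-function $f(\tau)$ (defined near $\tau=0$) with $f(0)\ne0$, there exists a curve $\gamma(\tau)$ in $(M^2,g)$ with a $3/2$-cusp at $\tau=0$ such that $\sqrt{|s_g|}\,\kappa_g=f(\tau)$ and $\tau$ is the half-arclength parameter of $\gamma$.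
   Context: Let $\nabla$ be the Levi-Civita connection and $\Omega_g$ the unit area element of the oriented Riemannian manifold $(M^2,g)$ (so $\Omega_g(\mathbf e_1,\mathbf e_2)=1$ for positively oriented orthonormal frames), and write $[v,w]=\Omega_g(v,w)$ for $v,w\in T_pM^2$. Along a curve $\gamma(t)$, put $\ddot\gamma=\nabla_t\dot\gamma$, $\gamma^{(3)}=\nabla_t\ddot\gamma$, and $|\dot\gamma|=\sqrt{g(\dot\gamma,\dot\gamma)}$. A $C^\infty$ curve $\gamma$ in $M^2$ has a $3/2$-cusp at $t=0$ if after a suitable coordinate change of the parameter and a suitable local coordinate system of $M^2$ at $\gamma(0)$ it becomes $t\mapsto(t^2,t^3)$; equivalently, $\dot\gamma(0)=0$ and $[\ddot\gamma(0),\gamma^{(3)}(0)]\ne0$. The geodesic curvature is $\kappa_g=[\dot\gamma,\ddot\gamma]/|\dot\gamma|^3$, and the cuspidal curvature at a $3/2$-cusp $t=0$ is $\mu_g=[\ddot\gamma(0),\gamma^{(3)}(0)]/|\ddot\gamma(0)|^{5/2}$. Smoothness at $t=0$ concerns germs at $t=0$, functions being extended across $t=0$. *)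

theory Defs
  imports "HOL-Analysis.Analysis"
begin

section \<open>Smooth maps on open sets\<close>

text \<open>In finite dimension, continuity of all directional derivatives of a differentiable map is
  continuity of its derivative. The predicates below are used for open \<open>S\<close> only.\<close>

primrec Ck_on :: "nat \<Rightarrow> 'a::euclidean_space set \<Rightarrow> ('a \<Rightarrow> 'b::real_normed_vector) \<Rightarrow> bool" where
  "Ck_on 0 S f \<longleftrightarrow> continuous_on S f"
| "Ck_on (Suc n) S f \<longleftrightarrow>
     (\<forall>x\<in>S. f differentiable (at x)) \<and> (\<forall>v. Ck_on n S (\<lambda>x. frechet_derivative f (at x) v))"

definition smooth_on :: "'a::euclidean_space set \<Rightarrow> ('a \<Rightarrow> 'b::real_normed_vector) \<Rightarrow> bool" where
  "smooth_on S f \<longleftrightarrow> (\<forall>n. Ck_on n S f)"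

text \<open>\<open>h\<close> can be used as a coordinate of the line at \<open>0\<close>: it is a diffeomorphism from a
  neighbourhood of \<open>0\<close> onto an open set.\<close>

definition smooth_coordinate_at_0 :: "(real \<Rightarrow> real) \<Rightarrow> bool" where
  "smooth_coordinate_at_0 h \<longleftrightarrow>
     (\<exists>\<epsilon>>0. let I = {-\<epsilon><..<\<epsilon>} in
        inj_on h I \<and> open (h ` I) \<and> smooth_on I h \<and> smooth_on (h ` I) (inv_into I h))"

text \<open>The germ at \<open>0\<close> of \<open>h\<close>, which need not be meaningful at \<open>0\<close> itself, is a smooth function of
  the parameter \<open>\<tau>\<close> (where \<open>\<tau>\<close> tends to \<open>0\<close> at \<open>0\<close>).\<close>

definition smooth_function_at_0_of :: "(real \<Rightarrow> real) \<Rightarrow> (real \<Rightarrow> real) \<Rightarrow> bool" where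
  "smooth_function_at_0_of \<tau> h \<longleftrightarrow>
     (\<exists>\<epsilon>>0. \<exists>F. smooth_on {-\<epsilon><..<\<epsilon>} F \<and> (\<forall>\<^sub>F t in at 0. h t = F (\<tau> t)))"


section \<open>Oriented surfaces\<close>

type_synonym 'p chart = "'p set \<times> ('p \<Rightarrow> real^2)"

abbreviation chart_dom :: "'p chart \<Rightarrow> 'p set" where "chart_dom \<equiv> fst"
abbreviation coords :: "'p chart \<Rightarrow> 'p \<Rightarrow> real^2" where "coords \<equiv> snd"

definition chart_inv :: "'p chart \<Rightarrow> real^2 \<Rightarrow> 'p" where
  "chart_inv c = inv_into (chart_dom c) (coords c)"

definition transition :: "'p chart \<Rightarrow> 'p chart \<Rightarrow> real^2 \<Rightarrow> real^2" where
  "transition c d = coords d \<circ> chart_inv c"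

text \<open>An oriented surface is given by its topology and an atlas of positively oriented charts,
  which need not be maximal.\<close>

definition oriented_surface :: "'p topology \<Rightarrow> 'p chart set \<Rightarrow> bool" where
  "oriented_surface M A \<longleftrightarrow>
     Hausdorff_space M \<and> second_countable M \<and> topspace M \<noteq> {} \<and>
     (\<Union>c\<in>A. chart_dom c) = topspace M \<and>
     (\<forall>c\<in>A. openin M (chart_dom c) \<and> open (coords c ` chart_dom c) \<and>
        homeomorphic_map (subtopology M (chart_dom c)) (top_of_set (coords c ` chart_dom c))
          (coords c)) \<and>
     (\<forall>c\<in>A. \<forall>d\<in>A.
        smooth_on (coords c ` (chart_dom c \<inter> chart_dom d)) (transition c d) \<and>
        (\<forall>x\<in>coords c ` (chart_dom c \<inter> chart_dom d).
           det (matrix (frechet_derivative (transition c d) (at x))) > 0))"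

text \<open>A tangent vector at \<open>p\<close> is the family of its components in all charts around \<open>p\<close>, which
  transform by the derivatives of the transition maps. Components in other charts are \<open>0\<close>.\<close>

type_synonym 'p tvec = "'p chart \<Rightarrow> real^2"

definition tangent_space :: "'p chart set \<Rightarrow> 'p \<Rightarrow> 'p tvec set" where
  "tangent_space A p =
     {v. (\<forall>c. \<not> (c \<in> A \<and> p \<in> chart_dom c) \<longrightarrow> v c = 0) \<and>
         (\<forall>c\<in>A. \<forall>d\<in>A. p \<in> chart_dom c \<inter> chart_dom d \<longrightarrow>
            v d = frechet_derivative (transition c d) (at (coords c p)) (v c))}"

text \<open>The tangent vector at \<open>p\<close> with components \<open>u\<close> in the chart \<open>c\<close>.\<close>

definition tvec_of :: "'p chart set \<Rightarrow> 'p chart \<Rightarrow> 'p \<Rightarrow> real^2 \<Rightarrow> 'p tvec" where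
  "tvec_of A c p u = (\<lambda>d. if d \<in> A \<and> p \<in> chart_dom d
     then frechet_derivative (transition c d) (at (coords c p)) u else 0)"


section \<open>Riemannian metrics\<close>

type_synonym 'p metric = "'p \<Rightarrow> 'p tvec \<Rightarrow> 'p tvec \<Rightarrow> real"

definition metric_matrix :: "'p chart set \<Rightarrow> 'p metric \<Rightarrow> 'p chart \<Rightarrow> real^2 \<Rightarrow> real^2^2" where
  "metric_matrix A g c x = (\<chi> i j. let p = chart_inv c x in
     g p (tvec_of A c p (axis i 1)) (tvec_of A c p (axis j 1)))"

definition riemannian_metric :: "'p topology \<Rightarrow> 'p chart set \<Rightarrow> 'p metric \<Rightarrow> bool" where
  "riemannian_metric M A g \<longleftrightarrow>
     (\<forall>p\<in>topspace M.
        (\<forall>u\<in>tangent_space A p. \<forall>v\<in>tangent_space A p. g p u v = g p v u) \<and>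
        (\<forall>u\<in>tangent_space A p. \<forall>v\<in>tangent_space A p. \<forall>w\<in>tangent_space A p. \<forall>a b.
           g p (\<lambda>c. a *\<^sub>R u c + b *\<^sub>R v c) w = a * g p u w + b * g p v w) \<and>
        (\<forall>v\<in>tangent_space A p. v \<noteq> (\<lambda>c. 0) \<longrightarrow> g p v v > 0)) \<and>
     (\<forall>c\<in>A. \<forall>i j. smooth_on (coords c ` chart_dom c) (\<lambda>x. metric_matrix A g c x $ i $ j))"

definition oriented_riemannian_surface ::
    "'p topology \<Rightarrow> 'p chart set \<Rightarrow> 'p metric \<Rightarrow> bool" where
  "oriented_riemannian_surface M A g \<longleftrightarrow> oriented_surface M A \<and> riemannian_metric M A g"

definition tnorm :: "'p metric \<Rightarrow> 'p \<Rightarrow> 'p tvec \<Rightarrow> real" where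
  "tnorm g p v = sqrt (g p v v)"

definition positive_orthonormal_frame ::
    "'p chart set \<Rightarrow> 'p metric \<Rightarrow> 'p \<Rightarrow> 'p tvec \<times> 'p tvec \<Rightarrow> bool" where
  "positive_orthonormal_frame A g p = (\<lambda>(e1, e2).
     e1 \<in> tangent_space A p \<and> e2 \<in> tangent_space A p \<and>
     g p e1 e1 = 1 \<and> g p e2 e2 = 1 \<and> g p e1 e2 = 0 \<and>
     (\<forall>c\<in>A. p \<in> chart_dom c \<longrightarrow> e1 c $ 1 * e2 c $ 2 - e1 c $ 2 * e2 c $ 1 > 0))"

text \<open>The alternating bilinear form with value \<open>1\<close> on positively oriented orthonormal frames; it
  does not depend on the frame chosen.\<close>

definition area_element :: "'p chart set \<Rightarrow> 'p metric \<Rightarrow> 'p \<Rightarrow> 'p tvec \<Rightarrow> 'p tvec \<Rightarrow> real" where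
  "area_element A g p v w =
     (let (e1, e2) = (SOME e. positive_orthonormal_frame A g p e)
      in g p v e1 * g p w e2 - g p v e2 * g p w e1)"

definition partial_deriv :: "2 \<Rightarrow> (real^2 \<Rightarrow> real) \<Rightarrow> real^2 \<Rightarrow> real" where
  "partial_deriv i h x = frechet_derivative h (at x) (axis i 1)"

text \<open>The Christoffel symbols (upper index \<open>k\<close>) of the Levi-Civita connection in the chart \<open>c\<close>.\<close>

definition christoffel ::
    "'p chart set \<Rightarrow> 'p metric \<Rightarrow> 'p chart \<Rightarrow> real^2 \<Rightarrow> 2 \<Rightarrow> 2 \<Rightarrow> 2 \<Rightarrow> real" where
  "christoffel A g c x k i j =
     1 / 2 * (\<Sum>l\<in>UNIV. matrix_inv (metric_matrix A g c x) $ k $ l *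
       (partial_deriv i (\<lambda>y. metric_matrix A g c y $ j $ l) x
        + partial_deriv j (\<lambda>y. metric_matrix A g c y $ i $ l) x
        - partial_deriv l (\<lambda>y. metric_matrix A g c y $ i $ j) x))"


section \<open>Curves\<close>

definition smooth_curve :: "'p topology \<Rightarrow> 'p chart set \<Rightarrow> real set \<Rightarrow> (real \<Rightarrow> 'p) \<Rightarrow> bool" where
  "smooth_curve M A I \<gamma> \<longleftrightarrow>
     continuous_map (top_of_set I) M \<gamma> \<and>
     (\<forall>c\<in>A. smooth_on {t\<in>I. \<gamma> t \<in> chart_dom c} (coords c \<circ> \<gamma>))"

definition velocity :: "'p chart set \<Rightarrow> (real \<Rightarrow> 'p) \<Rightarrow> real \<Rightarrow> 'p tvec" where
  "velocity A \<gamma> t = (\<lambda>c. if c \<in> A \<and> \<gamma> t \<in> chart_dom c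
     then vector_derivative (coords c \<circ> \<gamma>) (at t) else 0)"

text \<open>The Levi-Civita covariant derivative of a vector field \<open>X\<close> along \<open>\<gamma>\<close>.\<close>

definition covariant_deriv ::
    "'p chart set \<Rightarrow> 'p metric \<Rightarrow> (real \<Rightarrow> 'p) \<Rightarrow> (real \<Rightarrow> 'p tvec) \<Rightarrow> real \<Rightarrow> 'p tvec" where
  "covariant_deriv A g \<gamma> X t = (\<lambda>c. if c \<in> A \<and> \<gamma> t \<in> chart_dom c
     then vector_derivative (\<lambda>s. X s c) (at t)
        + (\<chi> k. \<Sum>i\<in>UNIV. \<Sum>j\<in>UNIV.
             christoffel A g c (coords c (\<gamma> t)) k i j * velocity A \<gamma> t c $ i * X t c $ j)
     else 0)"

definition acceleration :: "'p chart set \<Rightarrow> 'p metric \<Rightarrow> (real \<Rightarrow> 'p) \<Rightarrow> real \<Rightarrow> 'p tvec" where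
  "acceleration A g \<gamma> = covariant_deriv A g \<gamma> (velocity A \<gamma>)"

definition third_deriv :: "'p chart set \<Rightarrow> 'p metric \<Rightarrow> (real \<Rightarrow> 'p) \<Rightarrow> real \<Rightarrow> 'p tvec" where
  "third_deriv A g \<gamma> = covariant_deriv A g \<gamma> (acceleration A g \<gamma>)"

text \<open>A 3/2-cusp at parameter \<open>0\<close>, in terms of the covariant derivatives of the curve. The vanishing
  of the velocity and the nonvanishing of the area spanned by the next two derivatives do not depend
  on the metric; they hold iff the curve is \<open>t \<mapsto> (t\<^sup>2, t\<^sup>3)\<close> for a suitable parameter and suitable
  local coordinates.\<close>

definition cusp_at_0 :: "'p chart set \<Rightarrow> 'p metric \<Rightarrow> (real \<Rightarrow> 'p) \<Rightarrow> bool" where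
  "cusp_at_0 A g \<gamma> \<longleftrightarrow>
     velocity A \<gamma> 0 = (\<lambda>c. 0) \<and>
     area_element A g (\<gamma> 0) (acceleration A g \<gamma> 0) (third_deriv A g \<gamma> 0) \<noteq> 0"

definition arclength :: "'p chart set \<Rightarrow> 'p metric \<Rightarrow> (real \<Rightarrow> 'p) \<Rightarrow> real \<Rightarrow> real" where
  "arclength A g \<gamma> t = (LBINT u=ereal 0..ereal t. tnorm g (\<gamma> u) (velocity A \<gamma> u))"

definition half_arclength :: "'p chart set \<Rightarrow> 'p metric \<Rightarrow> (real \<Rightarrow> 'p) \<Rightarrow> real \<Rightarrow> real" where
  "half_arclength A g \<gamma> t = sgn t * sqrt \<bar>arclength A g \<gamma> t\<bar>"

definition geodesic_curvature :: "'p chart set \<Rightarrow> 'p metric \<Rightarrow> (real \<Rightarrow> 'p) \<Rightarrow> real \<Rightarrow> real" where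
  "geodesic_curvature A g \<gamma> t =
     area_element A g (\<gamma> t) (velocity A \<gamma> t) (acceleration A g \<gamma> t)
       / tnorm g (\<gamma> t) (velocity A \<gamma> t) ^ 3"

definition cuspidal_curvature :: "'p chart set \<Rightarrow> 'p metric \<Rightarrow> (real \<Rightarrow> 'p) \<Rightarrow> real" where
  "cuspidal_curvature A g \<gamma> =
     area_element A g (\<gamma> 0) (acceleration A g \<gamma> 0) (third_deriv A g \<gamma> 0)
       / tnorm g (\<gamma> 0) (acceleration A g \<gamma> 0) powr (5/2)"

end

theory Submission
  imports Defs
begin

text \<open>In a chart, a smooth curve with vanishing velocity at \<open>0\<close> has velocity \<open>t c(t)\<close> with a
smooth \<open>c\<close> (\<open>smooth_on_divide_variable\<close>), and its acceleration is \<open>c(t) + t b(t)\<close> with a smooth \<open>b\<close>,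
the third derivative at \<open>0\<close> being \<open>2 b(0)\<close> (\<open>cusp_factorization\<close>). The cusp condition therefore says
that \<open>c(0)\<close> and \<open>b(0)\<close> are linearly independent. In particular \<open>q = \<bar>c\<bar>\<close> is smooth and positive near
\<open>0\<close>, and every nonsmooth quantity is a power of \<open>\<bar>t\<bar>\<close> times a smooth one: the speed is \<open>\<bar>t\<bar> q(t)\<close>,
the arclength is \<open>t \<bar>t\<bar> h(t)\<close> with \<open>h(t)\<close> the integral of \<open>s q(t s)\<close> over \<open>s\<close> from \<open>0\<close> to \<open>1\<close>, and the
geodesic curvature is \<open>[c, b] / (\<bar>t\<bar> q\<^sup>3)\<close> because \<open>[t c, c + t b] = t\<^sup>2 [c, b]\<close>. Hence the
half-arclength is \<open>t\<close> times \<open>sqrt h\<close>, a coordinate, and in \<open>sqrt \<bar>s\<bar> \<kappa> = sqrt h [c, b] / q\<^sup>3\<close> the factors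
\<open>\<bar>t\<bar>\<close> have cancelled. At \<open>t = 0\<close>, where \<open>h = q / 2\<close>, this is the cuspidal curvature divided by
\<open>2 sqrt 2\<close> (\<open>cusp_local_form\<close>, \<open>curvature_at_cusp\<close>).

For the converse, \<open>\<tau>\<close> is the half-arclength exactly when the velocity is \<open>2 \<tau> e\<close> with a unit field
\<open>e\<close>. With \<open>J\<close> the rotation by a positive right angle, the curvature condition becomes \<open>\<nabla>e = 2 f J e\<close>.
In a chart these are ordinary differential equations for \<open>(x, e)\<close> with smooth right-hand side, also
at \<open>\<tau> = 0\<close>, so they have a smooth solution (\<open>integral_curve_exists\<close>); \<open>e\<close> stays of length \<open>1\<close> because the
connection is metric and \<open>J e\<close> is orthogonal to \<open>e\<close> (\<open>prescribed_rotation_curve\<close>). At \<open>\<tau> = 0\<close> the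
second and third derivatives of the curve are \<open>2 e\<close> and \<open>8 f J e\<close>, so it has a cusp as \<open>f 0\<close> is not \<open>0\<close>.

Both arguments are carried out in a single chart. This is legitimate once the area element has been
computed in a chart (\<open>area_element_in_chart\<close>) and covariant derivatives along a curve are known to be
tangent vectors, that is, to transform by the derivatives of the transition maps
(\<open>smooth_field_covariant_deriv\<close>). The latter is the transformation law of the Christoffel symbols
(\<open>christoffel_change_of_coordinates\<close>), which rests on the symmetry of second derivatives.\<close>

section \<open>Smooth maps on open sets\<close>

lemma Ck_on_has_derivative:
  "Ck_on (Suc n) S f \<Longrightarrow> x \<in> S \<Longrightarrow> (f has_derivative frechet_derivative f (at x)) (at x)"
  by (simp add: frechet_derivative_works)

lemma Ck_on_cong:
  assumes "open S" "\<And>x. x \<in> S \<Longrightarrow> f x = g x" "Ck_on n S f"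
  shows "Ck_on n S g"
  using assms(2,3)
proof (induction n arbitrary: f g)
  case 0
  then show ?case using continuous_on_cong[of S S f g] by simp
next
  case (Suc n)
  have d: "(g has_derivative frechet_derivative f (at x)) (at x)" if "x \<in> S" for x
    using has_derivative_transform_within_open[OF Ck_on_has_derivative[OF Suc.prems(2) that] assms(1) that]
      Suc.prems(1) by blast
  have e: "frechet_derivative g (at x) = frechet_derivative f (at x)" if "x \<in> S" for x
    using frechet_derivative_at[OF d[OF that]] by simp
  show ?case
    unfolding Ck_on.simps
  proof (intro conjI ballI allI)
    show "g differentiable (at x)" if "x \<in> S" for x
      using d[OF that] by (auto simp: differentiable_def)
    show "Ck_on n S (\<lambda>x. frechet_derivative g (at x) v)" for v
    proof (rule Suc.IH)
      show "Ck_on n S (\<lambda>x. frechet_derivative f (at x) v)"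
        using Suc.prems(2) by simp
    qed (simp add: e)
  qed
qed

text \<open>The recursive clause of \<^const>\<open>Ck_on\<close> speaks of the chosen derivative \<^const>\<open>frechet_derivative\<close>; this
rule accepts any derivative that can be exhibited.\<close>

lemma Ck_on_SucI:
  assumes "open S" "\<And>x. x \<in> S \<Longrightarrow> (f has_derivative D x) (at x)"
    and "\<And>v. Ck_on n S (\<lambda>x. D x v)"
  shows "Ck_on (Suc n) S f"
  unfolding Ck_on.simps
proof (intro conjI ballI allI)
  show "f differentiable (at x)" if "x \<in> S" for x
    using assms(2)[OF that] by (auto simp: differentiable_def)
  show "Ck_on n S (\<lambda>x. frechet_derivative f (at x) v)" for v
  proof (rule Ck_on_cong[OF assms(1) _ assms(3)[of v]])
    show "D x v = frechet_derivative f (at x) v" if "x \<in> S" for x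
      using frechet_derivative_at[OF assms(2)[OF that]] by simp
  qed
qed

lemma Ck_on_SucD: "Ck_on (Suc n) S f \<Longrightarrow> Ck_on n S f"
proof (induction n arbitrary: f)
  case 0
  then show ?case
    by (auto intro!: continuous_at_imp_continuous_on differentiable_imp_continuous_within)
next
  case (Suc n)
  then show ?case by (metis Ck_on.simps(2))
qed

lemma Ck_on_subset: "Ck_on n S f \<Longrightarrow> T \<subseteq> S \<Longrightarrow> Ck_on n T f"
proof (induction n arbitrary: f)
  case 0
  then show ?case by (auto intro: continuous_on_subset)
next
  case (Suc n)
  then show ?case by (simp add: subset_iff)
qed

lemma Ck_on_const: "Ck_on n S (\<lambda>x. c)"
  by (induction n arbitrary: c) auto

lemma Ck_on_linear:
  assumes "bounded_linear L" "open S" "Ck_on n S f"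
  shows "Ck_on n S (\<lambda>x. L (f x))"
  using assms(3)
proof (induction n arbitrary: f)
  case 0
  then show ?case using assms(1) by (simp add: bounded_linear.continuous_on)
next
  case (Suc n)
  show ?case
  proof (rule Ck_on_SucI[OF assms(2)])
    show "((\<lambda>x. L (f x)) has_derivative (\<lambda>v. L (frechet_derivative f (at x) v))) (at x)"
      if "x \<in> S" for x
      using that Suc.prems by (intro bounded_linear.has_derivative[OF assms(1)] Ck_on_has_derivative)
    show "Ck_on n S (\<lambda>x. L (frechet_derivative f (at x) v))" for v
      using Suc.prems by (intro Suc.IH) auto
  qed
qed

lemma Ck_on_ident: "open S \<Longrightarrow> Ck_on n S (\<lambda>x. x)"
proof (cases n)
  case (Suc m)
  assume "open S"
  then have "Ck_on (Suc m) S (\<lambda>x. x)"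
    by (rule Ck_on_SucI[where D="\<lambda>x v. v"]) (rule has_derivative_ident Ck_on_const)+
  then show ?thesis using Suc by simp
qed simp

lemma Ck_on_add:
  assumes "open S" "Ck_on n S f" "Ck_on n S g"
  shows "Ck_on n S (\<lambda>x. f x + g x)"
  using assms(2,3)
proof (induction n arbitrary: f g)
  case 0
  then show ?case by (simp add: continuous_on_add)
next
  case (Suc n)
  show ?case
  proof (rule Ck_on_SucI[OF assms(1)])
    show "((\<lambda>x. f x + g x) has_derivative
        (\<lambda>v. frechet_derivative f (at x) v + frechet_derivative g (at x) v)) (at x)" if "x \<in> S" for x
      using that Suc.prems by (intro has_derivative_add Ck_on_has_derivative)
    show "Ck_on n S (\<lambda>x. frechet_derivative f (at x) v + frechet_derivative g (at x) v)" for v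
      using Suc.prems by (intro Suc.IH) auto
  qed
qed

lemma Ck_on_bilinear:
  assumes "bounded_bilinear B" "open S" "Ck_on n S f" "Ck_on n S g"
  shows "Ck_on n S (\<lambda>x. B (f x) (g x))"
  using assms(3,4)
proof (induction n arbitrary: f g)
  case 0
  then show ?case using assms(1) by (simp add: bounded_bilinear.continuous_on)
next
  case (Suc n)
  show ?case
  proof (rule Ck_on_SucI[OF assms(2)])
    show "((\<lambda>x. B (f x) (g x)) has_derivative (\<lambda>v. B (f x) (frechet_derivative g (at x) v)
        + B (frechet_derivative f (at x) v) (g x))) (at x)" if "x \<in> S" for x
      using that by (intro bounded_bilinear.FDERIV[OF assms(1)] Ck_on_has_derivative[OF Suc.prems(1)]
          Ck_on_has_derivative[OF Suc.prems(2)])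
    show "Ck_on n S (\<lambda>x. B (f x) (frechet_derivative g (at x) v)
        + B (frechet_derivative f (at x) v) (g x))" for v
      using Suc.prems[THEN Ck_on_SucD] Suc.prems by (intro Ck_on_add assms(2) Suc.IH) auto
  qed
qed

lemma Ck_on_sum:
  assumes "open S" "\<And>i. i \<in> I \<Longrightarrow> Ck_on n S (f i)"
  shows "Ck_on n S (\<lambda>x. \<Sum>i\<in>I. f i x)"
  using assms(2)
proof (induction I rule: infinite_finite_induct)
  case (insert i I)
  then show ?case using Ck_on_add[OF assms(1), of n "f i"] by simp
qed (simp_all add: Ck_on_const)

text \<open>The chain rule presents the derivative of the composition in direction \<open>v\<close> as the derivative of \<open>G\<close> in
a direction that varies with the point. Expanding this direction in the standard basis leaves
derivatives of \<open>G\<close> in fixed directions, to which the induction hypothesis applies.\<close>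

lemma Ck_on_compose:
  fixes f :: "'a::euclidean_space \<Rightarrow> 'b::euclidean_space" and G :: "'b \<Rightarrow> 'c::real_normed_vector"
  assumes "open S" "open T" "f ` S \<subseteq> T" "Ck_on n T G" "Ck_on n S f"
  shows "Ck_on n S (\<lambda>x. G (f x))"
  using assms(4,5)
proof (induction n arbitrary: G)
  case 0
  then show ?case using assms(3) by (auto intro: continuous_on_compose2)
next
  case (Suc n)
  have lin: "linear (frechet_derivative G (at (f x)))" if "x \<in> S" for x
    using Ck_on_has_derivative[OF Suc.prems(1), of "f x"] that assms(3)
    by (auto intro: has_derivative_linear)
  show ?case
  proof (rule Ck_on_SucI[OF assms(1)])
    fix x assume x: "x \<in> S"
    have "(G \<circ> f has_derivative frechet_derivative G (at (f x)) \<circ> frechet_derivative f (at x)) (at x)"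
      using x assms(3) by (intro diff_chain_at Ck_on_has_derivative[OF Suc.prems(1)]
        Ck_on_has_derivative[OF Suc.prems(2)]) auto
    moreover have "frechet_derivative G (at (f x)) (frechet_derivative f (at x) v)
        = (\<Sum>b\<in>Basis. (frechet_derivative f (at x) v \<bullet> b) *\<^sub>R frechet_derivative G (at (f x)) b)" for v
      by (subst euclidean_representation[of "frechet_derivative f (at x) v", symmetric])
         (simp add: linear_sum[OF lin[OF x]] linear_scale[OF lin[OF x]])
    ultimately show "((\<lambda>x. G (f x)) has_derivative (\<lambda>v. \<Sum>b\<in>Basis.
        (frechet_derivative f (at x) v \<bullet> b) *\<^sub>R frechet_derivative G (at (f x)) b)) (at x)"
      by (simp add: o_def)
  next
    fix v
    show "Ck_on n S (\<lambda>x. \<Sum>b\<in>Basis.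
        (frechet_derivative f (at x) v \<bullet> b) *\<^sub>R frechet_derivative G (at (f x)) b)"
    proof (intro Ck_on_sum Ck_on_bilinear[OF bounded_bilinear_scaleR] assms(1))
      fix b :: 'b
      show "Ck_on n S (\<lambda>x. frechet_derivative f (at x) v \<bullet> b)"
        using Suc.prems(2)
        by (intro Ck_on_linear[OF bounded_linear_inner_left] assms(1)) auto
      show "Ck_on n S (\<lambda>x. frechet_derivative G (at (f x)) b)"
        using Suc.prems Ck_on_SucD[OF Suc.prems(2)] by (intro Suc.IH) auto
    qed
  qed
qed

lemma smooth_on_cong:
  "open S \<Longrightarrow> (\<And>x. x \<in> S \<Longrightarrow> f x = g x) \<Longrightarrow> smooth_on S f \<Longrightarrow> smooth_on S g"
  unfolding smooth_on_def using Ck_on_cong by blast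

lemma smooth_on_subset: "smooth_on S f \<Longrightarrow> T \<subseteq> S \<Longrightarrow> smooth_on T f"
  unfolding smooth_on_def using Ck_on_subset by blast

lemma smooth_on_has_derivative:
  "smooth_on S f \<Longrightarrow> x \<in> S \<Longrightarrow> (f has_derivative frechet_derivative f (at x)) (at x)"
  unfolding smooth_on_def using Ck_on_has_derivative by blast

lemma smooth_on_frechet_derivative:
  "smooth_on S f \<Longrightarrow> smooth_on S (\<lambda>x. frechet_derivative f (at x) v)"
  unfolding smooth_on_def by (metis Ck_on.simps(2))

lemma smooth_on_continuous_on: "smooth_on S f \<Longrightarrow> continuous_on S f"
  unfolding smooth_on_def by (metis Ck_on.simps(1))

lemma smooth_on_const: "smooth_on S (\<lambda>x. c)"
  by (simp add: smooth_on_def Ck_on_const)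

lemma smooth_on_ident: "open S \<Longrightarrow> smooth_on S (\<lambda>x. x)"
  by (simp add: smooth_on_def Ck_on_ident)

lemma smooth_on_linear:
  "bounded_linear L \<Longrightarrow> open S \<Longrightarrow> smooth_on S f \<Longrightarrow> smooth_on S (\<lambda>x. L (f x))"
  unfolding smooth_on_def using Ck_on_linear by blast

lemma smooth_on_bilinear:
  "bounded_bilinear B \<Longrightarrow> open S \<Longrightarrow> smooth_on S f \<Longrightarrow> smooth_on S g \<Longrightarrow>
    smooth_on S (\<lambda>x. B (f x) (g x))"
  unfolding smooth_on_def using Ck_on_bilinear by blast

lemma smooth_on_add:
  "open S \<Longrightarrow> smooth_on S f \<Longrightarrow> smooth_on S g \<Longrightarrow> smooth_on S (\<lambda>x. f x + g x)"
  unfolding smooth_on_def using Ck_on_add by blast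

lemmas smooth_on_minus = smooth_on_linear[OF bounded_linear_minus[OF bounded_linear_ident]]
lemmas smooth_on_vec_nth = smooth_on_linear[OF bounded_linear_vec_nth]
lemmas smooth_on_fst = smooth_on_linear[OF bounded_linear_fst]
lemmas smooth_on_snd = smooth_on_linear[OF bounded_linear_snd]
lemmas smooth_on_scaleR = smooth_on_bilinear[OF bounded_bilinear_scaleR]
lemmas smooth_on_mult =
  smooth_on_bilinear[OF bounded_bilinear_mult[where 'a=real]]

lemma smooth_on_diff:
  "open S \<Longrightarrow> smooth_on S f \<Longrightarrow> smooth_on S g \<Longrightarrow> smooth_on S (\<lambda>x. f x - g x)"
  using smooth_on_add[of S f "\<lambda>x. - g x"] smooth_on_minus[of S g] by simp

lemma smooth_on_sum:
  "open S \<Longrightarrow> (\<And>i. i \<in> I \<Longrightarrow> smooth_on S (f i)) \<Longrightarrow> smooth_on S (\<lambda>x. \<Sum>i\<in>I. f i x)"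
  by (simp add: smooth_on_def Ck_on_sum)

lemma smooth_on_power:
  fixes f :: "'a::euclidean_space \<Rightarrow> real"
  shows "open S \<Longrightarrow> smooth_on S f \<Longrightarrow> smooth_on S (\<lambda>x. f x ^ n)"
  by (induction n) (simp_all add: smooth_on_const smooth_on_mult)

lemma smooth_on_compose:
  fixes f :: "'a::euclidean_space \<Rightarrow> 'b::euclidean_space" and G :: "'b \<Rightarrow> 'c::real_normed_vector"
  shows "open S \<Longrightarrow> open T \<Longrightarrow> f ` S \<subseteq> T \<Longrightarrow> smooth_on T G \<Longrightarrow> smooth_on S f \<Longrightarrow>
    smooth_on S (\<lambda>x. G (f x))"
  unfolding smooth_on_def using Ck_on_compose[of S T f _ G] by blast

lemma smooth_on_pair:
  assumes "open S" "smooth_on S f" "smooth_on S g"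
  shows "smooth_on S (\<lambda>x. (f x, g x))"
proof -
  have 1: "bounded_linear (\<lambda>a::'b. (a, 0::'c))" and 2: "bounded_linear (\<lambda>b::'c. (0::'b, b))"
    by (intro bounded_linear_Pair bounded_linear_ident bounded_linear_zero)+
  show ?thesis
    using smooth_on_add[OF assms(1) smooth_on_linear[OF 1 assms(1,2)] smooth_on_linear[OF 2 assms(1,3)]]
    by simp
qed

lemma smooth_on_vec_lambda:
  fixes f :: "'n::finite \<Rightarrow> 'a::euclidean_space \<Rightarrow> real"
  assumes "open S" "\<And>i. smooth_on S (f i)"
  shows "smooth_on S (\<lambda>x. \<chi> i. f i x)"
proof -
  have "smooth_on S (\<lambda>x. \<Sum>i\<in>UNIV. f i x *\<^sub>R axis i (1::real))"
    by (intro smooth_on_sum smooth_on_scaleR smooth_on_const assms)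
  moreover have "(\<Sum>i\<in>UNIV. f i x *\<^sub>R axis i (1::real)) = (\<chi> i. f i x)" for x
    using basis_expansion[of "\<chi> i. f i x"] by (simp add: scalar_mult_eq_scaleR)
  ultimately show ?thesis by simp
qed

lemma Ck_on_SucI_real:
  fixes f :: "real \<Rightarrow> 'b::real_normed_vector"
  assumes "open S" "\<And>t. t \<in> S \<Longrightarrow> (f has_vector_derivative f' t) (at t)" "Ck_on n S f'"
  shows "Ck_on (Suc n) S f"
  by (rule Ck_on_SucI[OF assms(1), where D="\<lambda>t v. v *\<^sub>R f' t"])
     (use assms(2) in \<open>auto simp: has_vector_derivative_def intro: Ck_on_linear[OF bounded_linear_scaleR_right assms(1,3)]\<close>)

text \<open>For a function of one real variable the derivative is a function of the same kind, so that smoothness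
can be proved by bootstrapping from a differential equation.\<close>

lemma smooth_on_real_iff_derivative:
  fixes f :: "real \<Rightarrow> 'b::real_normed_vector"
  assumes "open S" "\<And>t. t \<in> S \<Longrightarrow> (f has_vector_derivative f' t) (at t)"
  shows "smooth_on S f \<longleftrightarrow> smooth_on S f'"
proof
  assume f: "smooth_on S f"
  have "frechet_derivative f (at t) 1 = f' t" if "t \<in> S" for t
    using assms(2)[OF that] frechet_derivative_at unfolding has_vector_derivative_def
    by (metis scaleR_one)
  then show "smooth_on S f'"
    using smooth_on_cong[OF assms(1) _ smooth_on_frechet_derivative[OF f, of 1]] by blast
next
  assume "smooth_on S f'"
  then show "smooth_on S f"
    unfolding smooth_on_def using Ck_on_SucI_real[OF assms] Ck_on_SucD by blast
qed

lemma smooth_on_has_vector_derivative: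
  fixes f :: "real \<Rightarrow> 'b::real_normed_vector"
  shows "smooth_on S f \<Longrightarrow> t \<in> S \<Longrightarrow> (f has_vector_derivative vector_derivative f (at t)) (at t)"
  using smooth_on_has_derivative[of S f t] vector_derivative_works differentiable_def by blast

lemma smooth_on_vector_derivative:
  fixes f :: "real \<Rightarrow> 'b::real_normed_vector"
  assumes "open S" "smooth_on S f"
  shows "smooth_on S (\<lambda>t. vector_derivative f (at t))"
  using smooth_on_real_iff_derivative[OF assms(1) smooth_on_has_vector_derivative[OF assms(2)]] assms
  by simp

text \<open>The derivative of the reciprocal is a polynomial in the reciprocal.\<close>

lemma smooth_on_inverse_real: "smooth_on (- {0}) (inverse :: real \<Rightarrow> real)"
  unfolding smooth_on_def
proof
  fix n
  have o: "open (- {0::real})" by auto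
  show "Ck_on n (- {0}) (inverse :: real \<Rightarrow> real)"
  proof (induction n)
    case (Suc n)
    show ?case
    proof (rule Ck_on_SucI_real[OF o])
      show "((inverse :: real \<Rightarrow> real) has_vector_derivative - (inverse t * inverse t)) (at t)"
        if "t \<in> - {0}" for t
        using that DERIV_inverse[of t UNIV]
        by (simp add: has_real_derivative_iff_has_vector_derivative power2_eq_square)
      show "Ck_on n (- {0}) (\<lambda>t. - (inverse t * inverse t :: real))"
        by (intro Ck_on_linear[OF bounded_linear_minus[OF bounded_linear_ident]] o
            Ck_on_bilinear[OF bounded_bilinear_mult] Suc.IH)
    qed
  qed (auto intro!: continuous_intros)
qed

lemma smooth_on_inverse:
  fixes f :: "'a::euclidean_space \<Rightarrow> real"
  shows "open S \<Longrightarrow> smooth_on S f \<Longrightarrow> (\<And>x. x \<in> S \<Longrightarrow> f x \<noteq> 0) \<Longrightarrow> smooth_on S (\<lambda>x. inverse (f x))"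
  by (rule smooth_on_compose[OF _ _ _ smooth_on_inverse_real]) auto

lemma smooth_on_divide:
  fixes f g :: "'a::euclidean_space \<Rightarrow> real"
  shows "open S \<Longrightarrow> smooth_on S f \<Longrightarrow> smooth_on S g \<Longrightarrow> (\<And>x. x \<in> S \<Longrightarrow> g x \<noteq> 0) \<Longrightarrow>
    smooth_on S (\<lambda>x. f x / g x)"
  unfolding divide_inverse by (intro smooth_on_mult smooth_on_inverse)

lemma smooth_on_sqrt_real: "smooth_on {0<..} sqrt"
  unfolding smooth_on_def
proof
  fix n
  have o: "open {0::real<..}" by auto
  show "Ck_on n {0<..} sqrt"
  proof (induction n)
    case (Suc n)
    show ?case
    proof (rule Ck_on_SucI_real[OF o])
      show "(sqrt has_vector_derivative inverse (sqrt t) / 2) (at t)" if "t \<in> {0<..}" for t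
        using that DERIV_real_sqrt[of t] by (simp add: has_real_derivative_iff_has_vector_derivative)
      show "Ck_on n {0<..} (\<lambda>t. inverse (sqrt t) / 2)"
        using smooth_on_inverse_real
        by (intro Ck_on_linear[OF bounded_linear_divide] o Ck_on_compose[OF o _ _ _ Suc.IH, of "- {0}"])
          (auto simp: smooth_on_def)
    qed
  qed (auto intro!: continuous_intros)
qed

lemma smooth_on_sqrt:
  fixes f :: "'a::euclidean_space \<Rightarrow> real"
  shows "open S \<Longrightarrow> smooth_on S f \<Longrightarrow> (\<And>x. x \<in> S \<Longrightarrow> 0 < f x) \<Longrightarrow> smooth_on S (\<lambda>x. sqrt (f x))"
  by (rule smooth_on_compose[OF _ _ _ smooth_on_sqrt_real]) auto

section \<open>Symmetry of second derivatives\<close>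

abbreviation dir_deriv :: "('a::euclidean_space \<Rightarrow> 'b::real_normed_vector) \<Rightarrow> 'a \<Rightarrow> 'a \<Rightarrow> 'b" where
  "dir_deriv f x v \<equiv> frechet_derivative f (at x) v"

lemma has_real_derivative_along_line:
  fixes f :: "'a::euclidean_space \<Rightarrow> real"
  assumes "smooth_on S f" "a + s *\<^sub>R u \<in> S"
  shows "((\<lambda>s. f (a + s *\<^sub>R u)) has_real_derivative dir_deriv f (a + s *\<^sub>R u) u) (at s)"
proof -
  have d: "(f has_derivative frechet_derivative f (at (a + s *\<^sub>R u))) (at (a + s *\<^sub>R u))"
    using smooth_on_has_derivative[OF assms] .
  have "((\<lambda>s. a + s *\<^sub>R u) has_vector_derivative u) (at s)"
    by (auto intro!: derivative_eq_intros simp: has_vector_derivative_def)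
  then have "((\<lambda>s. f (a + s *\<^sub>R u)) has_vector_derivative dir_deriv f (a + s *\<^sub>R u) u) (at s)"
    using has_derivative_compose[of "\<lambda>s. a + s *\<^sub>R u" "\<lambda>h. h *\<^sub>R u" s UNIV f, OF _ d]
      linear_scale[OF has_derivative_linear[OF d]]
    by (simp add: has_vector_derivative_def)
  then show ?thesis
    by (simp add: has_real_derivative_iff_has_vector_derivative)
qed

text \<open>The second difference over a parallelogram with sides \<open>h u\<close> and \<open>h v\<close>, divided by \<open>h\<^sup>2\<close>, is a value of
the second derivative in the directions \<open>u, v\<close>. The difference is symmetric in \<open>u\<close> and \<open>v\<close>, although the
mean value theorem is applied first in direction \<open>u\<close> and then in direction \<open>v\<close>.\<close>

lemma second_difference_mean_value:
  fixes f :: "'a::euclidean_space \<Rightarrow> real"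
  assumes "smooth_on S f" "0 < h"
    and sub: "\<And>s t. 0 \<le> s \<Longrightarrow> s \<le> h \<Longrightarrow> 0 \<le> t \<Longrightarrow> t \<le> h \<Longrightarrow> x + s *\<^sub>R u + t *\<^sub>R v \<in> S"
  shows "\<exists>s t. 0 \<le> s \<and> s \<le> h \<and> 0 \<le> t \<and> t \<le> h \<and>
    f (x + h *\<^sub>R u + h *\<^sub>R v) - f (x + h *\<^sub>R u) - f (x + h *\<^sub>R v) + f x
      = h * h * dir_deriv (\<lambda>y. dir_deriv f y u) (x + s *\<^sub>R u + t *\<^sub>R v) v"
proof -
  have 1: "((\<lambda>s. f (x + h *\<^sub>R v + s *\<^sub>R u) - f (x + s *\<^sub>R u)) has_real_derivative
      (dir_deriv f (x + h *\<^sub>R v + s *\<^sub>R u) u - dir_deriv f (x + s *\<^sub>R u) u)) (at s)" if "0 \<le> s" "s \<le> h" for s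
    using that sub[of s h] sub[of s 0] assms(2)
    by (intro DERIV_diff has_real_derivative_along_line[OF assms(1)]) (simp_all add: algebra_simps)
  obtain s where s: "0 < s" "s < h" and
    s1: "(f (x + h *\<^sub>R v + h *\<^sub>R u) - f (x + h *\<^sub>R u)) - (f (x + h *\<^sub>R v + 0 *\<^sub>R u) - f (x + 0 *\<^sub>R u))
        = (h - 0) * (dir_deriv f (x + h *\<^sub>R v + s *\<^sub>R u) u - dir_deriv f (x + s *\<^sub>R u) u)"
    using MVT2[OF assms(2) 1] by blast
  have 2: "((\<lambda>t. dir_deriv f (x + s *\<^sub>R u + t *\<^sub>R v) u) has_real_derivative
      dir_deriv (\<lambda>y. dir_deriv f y u) (x + s *\<^sub>R u + t *\<^sub>R v) v) (at t)" if "0 \<le> t" "t \<le> h" for t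
    using that sub[of s t] s
    by (intro has_real_derivative_along_line[OF smooth_on_frechet_derivative[OF assms(1)]]) simp
  obtain t where t: "0 < t" "t < h" and
    t1: "dir_deriv f (x + s *\<^sub>R u + h *\<^sub>R v) u - dir_deriv f (x + s *\<^sub>R u + 0 *\<^sub>R v) u
        = (h - 0) * dir_deriv (\<lambda>y. dir_deriv f y u) (x + s *\<^sub>R u + t *\<^sub>R v) v"
    using MVT2[OF assms(2) 2] by blast
  have "f (x + h *\<^sub>R u + h *\<^sub>R v) - f (x + h *\<^sub>R u) - f (x + h *\<^sub>R v) + f x
      = h * (dir_deriv f (x + s *\<^sub>R u + h *\<^sub>R v) u - dir_deriv f (x + s *\<^sub>R u) u)"
    using s1 by (simp add: add.commute add.left_commute algebra_simps)
  then show ?thesis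
    using s t t1 by (intro exI[of _ s] exI[of _ t]) simp
qed

text \<open>The same second difference is a value of both mixed derivatives, at two points near \<open>x\<close>; by continuity
the mixed derivatives cannot differ at \<open>x\<close>.\<close>

lemma second_derivative_symmetric_real:
  fixes f :: "'a::euclidean_space \<Rightarrow> real"
  assumes "open S" "smooth_on S f" "x \<in> S"
  shows "dir_deriv (\<lambda>y. dir_deriv f y u) x v = dir_deriv (\<lambda>y. dir_deriv f y v) x u"
proof (rule ccontr)
  let ?A = "dir_deriv (\<lambda>y. dir_deriv f y u)" and ?B = "dir_deriv (\<lambda>y. dir_deriv f y v)"
  assume ne: "?A x v \<noteq> ?B x u"
  define e where "e = \<bar>?A x v - ?B x u\<bar> / 2"
  have e: "e > 0" using ne by (simp add: e_def)
  have c: "continuous_on S (\<lambda>y. ?A y v)" "continuous_on S (\<lambda>y. ?B y u)"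
    by (intro smooth_on_continuous_on smooth_on_frechet_derivative assms(2))+
  obtain d1 where d1: "d1 > 0" "\<And>y. y \<in> S \<Longrightarrow> dist y x < d1 \<Longrightarrow> dist (?A y v) (?A x v) < e"
    using c(1) assms(3) e unfolding continuous_on_iff by meson
  obtain d2 where d2: "d2 > 0" "\<And>y. y \<in> S \<Longrightarrow> dist y x < d2 \<Longrightarrow> dist (?B y u) (?B x u) < e"
    using c(2) assms(3) e unfolding continuous_on_iff by meson
  obtain d3 where d3: "d3 > 0" "ball x d3 \<subseteq> S"
    using assms(1,3) openE by blast
  define d where "d = min d1 (min d2 d3)"
  have d: "d > 0" using d1 d2 d3 by (simp add: d_def)
  \<comment> \<open>the parallelogram with sides \<open>h u\<close> and \<open>h v\<close> lies in the ball of radius \<open>d\<close> around \<open>x\<close>\<close>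
  define h where "h = d / (2 * (norm u + norm v + 1))"
  have h: "h > 0" using d by (simp add: h_def add_nonneg_pos)
  have near: "dist (x + s *\<^sub>R u + t *\<^sub>R v) x < d" if "0 \<le> s" "s \<le> h" "0 \<le> t" "t \<le> h" for s t
  proof -
    have "dist (x + s *\<^sub>R u + t *\<^sub>R v) x \<le> s * norm u + t * norm v"
      using norm_triangle_ineq[of "s *\<^sub>R u" "t *\<^sub>R v"] that by (simp add: dist_norm add.assoc)
    also have "\<dots> \<le> h * norm u + h * norm v"
      using that by (intro add_mono mult_right_mono) auto
    also have "\<dots> < 2 * (h * (norm u + norm v + 1))"
      using h by (simp add: algebra_simps add_strict_increasing2 add_nonneg_pos)
    also have "\<dots> = d"
      unfolding h_def by (simp add: field_simps add_nonneg_eq_0_iff)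
    finally show ?thesis .
  qed
  have inS: "x + s *\<^sub>R u + t *\<^sub>R v \<in> S" if "0 \<le> s" "s \<le> h" "0 \<le> t" "t \<le> h" for s t
    using near[OF that] d3(2) unfolding d_def by (auto simp: dist_commute mem_ball subset_iff)
  obtain s t where st: "0 \<le> s" "s \<le> h" "0 \<le> t" "t \<le> h"
    "f (x + h *\<^sub>R u + h *\<^sub>R v) - f (x + h *\<^sub>R u) - f (x + h *\<^sub>R v) + f x
      = h * h * ?A (x + s *\<^sub>R u + t *\<^sub>R v) v"
    using second_difference_mean_value[OF assms(2) h inS] by blast
  have inS': "x + s *\<^sub>R v + t *\<^sub>R u \<in> S" if "0 \<le> s" "s \<le> h" "0 \<le> t" "t \<le> h" for s t
    using inS[of t s] that by (simp add: algebra_simps)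
  obtain t' s' where st': "0 \<le> s'" "s' \<le> h" "0 \<le> t'" "t' \<le> h"
    "f (x + h *\<^sub>R v + h *\<^sub>R u) - f (x + h *\<^sub>R v) - f (x + h *\<^sub>R u) + f x
      = h * h * ?B (x + t' *\<^sub>R v + s' *\<^sub>R u) u"
    using second_difference_mean_value[OF assms(2) h inS'] by blast
  have "h * h * ?A (x + s *\<^sub>R u + t *\<^sub>R v) v = h * h * ?B (x + s' *\<^sub>R u + t' *\<^sub>R v) u"
    using st(5) st'(5) by (simp add: algebra_simps)
  then have "?A (x + s *\<^sub>R u + t *\<^sub>R v) v = ?B (x + s' *\<^sub>R u + t' *\<^sub>R v) u"
    using h by simp
  moreover have "dist (?A (x + s *\<^sub>R u + t *\<^sub>R v) v) (?A x v) < e"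
    using near[OF st(1-4)] by (intro d1 inS st) (simp add: d_def)
  moreover have "dist (?B (x + s' *\<^sub>R u + t' *\<^sub>R v) u) (?B x u) < e"
    using near[OF st'(1-4)] by (intro d2 inS st') (simp add: d_def)
  ultimately have "\<bar>?A x v - ?B x u\<bar> < 2 * e"
    by (simp add: dist_real_def)
  then show False by (simp add: e_def)
qed

lemma frechet_derivative_bounded_linear:
  assumes "bounded_linear L" "f differentiable (at x)"
  shows "frechet_derivative (\<lambda>y. L (f y)) (at x) v = L (frechet_derivative f (at x) v)"
proof -
  have "((\<lambda>y. L (f y)) has_derivative (\<lambda>v. L (frechet_derivative f (at x) v))) (at x)"
    using assms(2) unfolding frechet_derivative_works
    by (rule bounded_linear.has_derivative[OF assms(1)])
  from frechet_derivative_at[OF this] show ?thesis by (simp add: fun_eq_iff)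
qed

lemma smooth_on_differentiable: "smooth_on S f \<Longrightarrow> x \<in> S \<Longrightarrow> f differentiable (at x)"
  using smooth_on_has_derivative differentiable_def by blast

lemma second_derivative_symmetric:
  fixes f :: "'a::euclidean_space \<Rightarrow> real^'n"
  assumes "open S" "smooth_on S f" "x \<in> S"
  shows "dir_deriv (\<lambda>y. dir_deriv f y u) x v = dir_deriv (\<lambda>y. dir_deriv f y v) x u"
proof -
  have c: "dir_deriv (\<lambda>y. dir_deriv f y u) x v $ i = dir_deriv (\<lambda>y. dir_deriv (\<lambda>y. f y $ i) y u) x v" for u v i
  proof -
    have "dir_deriv (\<lambda>y. dir_deriv f y u) x v $ i = dir_deriv (\<lambda>y. dir_deriv f y u $ i) x v"
      using frechet_derivative_bounded_linear[OF bounded_linear_vec_nth[of i]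
          smooth_on_differentiable[OF smooth_on_frechet_derivative[OF assms(2)] assms(3)]] by simp
    moreover have e: "dir_deriv f y u $ i = dir_deriv (\<lambda>y. f y $ i) y u" if "y \<in> S" for y
      using frechet_derivative_bounded_linear[OF bounded_linear_vec_nth[of i]
          smooth_on_differentiable[OF assms(2) that]] by simp
    have "smooth_on S (\<lambda>y. dir_deriv f y u $ i)"
      by (intro smooth_on_vec_nth assms(1) smooth_on_frechet_derivative assms(2))
    from smooth_on_has_derivative[OF this assms(3)]
    have "((\<lambda>y. dir_deriv (\<lambda>y. f y $ i) y u) has_derivative dir_deriv (\<lambda>y. dir_deriv f y u $ i) x) (at x)"
      by (rule has_derivative_transform_within_open[OF _ assms(1,3)]) (rule e)
    from frechet_derivative_at[OF this]
    have "dir_deriv (\<lambda>y. dir_deriv f y u $ i) x = dir_deriv (\<lambda>y. dir_deriv (\<lambda>y. f y $ i) y u) x" .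
    ultimately show ?thesis by simp
  qed
  show ?thesis
    unfolding vec_eq_iff c
    by (intro allI second_derivative_symmetric_real[OF assms(1) _ assms(3)] smooth_on_vec_nth assms)
qed

section \<open>Division of a smooth function by its variable\<close>

lemma smooth_on_interval_scale:
  fixes t s e :: real
  assumes "t \<in> {-e<..<e}" "0 \<le> s" "s \<le> 1"
  shows "t * s \<in> {-e<..<e}"
proof -
  have "\<bar>t * s\<bar> \<le> \<bar>t\<bar>" using assms by (simp add: abs_mult mult_left_le)
  then show ?thesis using assms(1) by auto
qed

text \<open>Differentiation under the integral sign reproduces an integral of the same form with \<open>k\<close> raised by one
and \<open>K\<close> replaced by its derivative; the weight \<open>s ^ k\<close> is what makes the induction close.\<close>

lemma Ck_on_parameter_integral:
  fixes K :: "real \<Rightarrow> 'b::banach"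
  assumes "smooth_on {-e<..<e} K"
  shows "Ck_on n {-e<..<e} (\<lambda>t. integral (cbox 0 1) (\<lambda>s. s ^ k *\<^sub>R K (t * s)))"
  using assms
proof (induction n arbitrary: k K)
  have cont: "continuous_on ({-e<..<e} \<times> cbox 0 1) (\<lambda>(t, s). s ^ k *\<^sub>R K (t * s))"
    if "smooth_on {-e<..<e} K" for K :: "real \<Rightarrow> 'b" and k
    unfolding split_beta using smooth_on_interval_scale
    by (intro continuous_intros continuous_on_compose2[OF smooth_on_continuous_on[OF that]]) auto
  {
    case 0
    then show ?case using integral_continuous_on_param[OF cont] by simp
  next
    case (Suc n)
    let ?K' = "\<lambda>t. vector_derivative K (at t)"
    have K': "smooth_on {-e<..<e} ?K'"
      using Suc.prems by (intro smooth_on_vector_derivative) auto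
    show ?case
    proof (rule Ck_on_SucI_real)
      fix t assume t: "t \<in> {-e<..<e}"
      have "((\<lambda>t. integral (cbox 0 1) (\<lambda>s. s ^ k *\<^sub>R K (t * s))) has_vector_derivative
         integral (cbox 0 1) (\<lambda>s. s ^ Suc k *\<^sub>R ?K' (t * s))) (at t within {-e<..<e})"
      proof (rule leibniz_rule_vector_derivative[OF _ _ cont[OF K'] t])
        fix t s :: real assume t: "t \<in> {-e<..<e}" and s: "s \<in> cbox 0 1"
        have "(K has_vector_derivative ?K' (t * s)) (at (t * s))"
          using smooth_on_has_vector_derivative[OF Suc.prems smooth_on_interval_scale[OF t]] s by simp
        then have "((K \<circ> (\<lambda>t. t * s)) has_vector_derivative s *\<^sub>R ?K' (t * s)) (at t)"
          by (intro vector_diff_chain_at) (auto intro!: derivative_eq_intros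
              simp flip: has_real_derivative_iff_has_vector_derivative)
        then have "((\<lambda>t. s ^ k *\<^sub>R K (t * s)) has_vector_derivative s ^ k *\<^sub>R (s *\<^sub>R ?K' (t * s))) (at t)"
          unfolding o_def
          by (rule bounded_linear.has_vector_derivative[OF bounded_linear_scaleR_right])
        then show "((\<lambda>t. s ^ k *\<^sub>R K (t * s)) has_vector_derivative s ^ Suc k *\<^sub>R ?K' (t * s))
            (at t within {-e<..<e})"
          by (simp add: has_vector_derivative_at_within mult.commute)
      next
        fix t assume t: "t \<in> {-e<..<e}"
        show "(\<lambda>s. s ^ k *\<^sub>R K (t * s)) integrable_on cbox 0 1"
          using smooth_on_interval_scale[OF t]
          by (intro integrable_continuous continuous_intros
              continuous_on_compose2[OF smooth_on_continuous_on[OF Suc.prems]]) auto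
      qed simp
      then show "((\<lambda>t. integral (cbox 0 1) (\<lambda>s. s ^ k *\<^sub>R K (t * s))) has_vector_derivative
         integral (cbox 0 1) (\<lambda>s. s ^ Suc k *\<^sub>R ?K' (t * s))) (at t)"
        using t at_within_open[of t "{-e<..<e}"] by simp
    qed (rule open_greaterThanLessThan Suc.IH[OF K'])+
  }
qed

text \<open>Hadamard's lemma: the quotient is the mean of the derivative of \<open>F\<close> over the segment from \<open>0\<close> to \<open>t\<close>.\<close>

lemma smooth_on_divide_variable:
  fixes F :: "real \<Rightarrow> 'b::banach"
  assumes "e > 0" "smooth_on {-e<..<e} F" "F 0 = 0"
  obtains H where "smooth_on {-e<..<e} H" "\<And>t. t \<in> {-e<..<e} \<Longrightarrow> F t = t *\<^sub>R H t"
proof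
  let ?F' = "\<lambda>t. vector_derivative F (at t)"
  let ?H = "\<lambda>t. integral (cbox 0 1) (\<lambda>s. s ^ 0 *\<^sub>R ?F' (t * s))"
  have F': "smooth_on {-e<..<e} ?F'"
    using assms by (intro smooth_on_vector_derivative) auto
  show "smooth_on {-e<..<e} ?H"
    unfolding smooth_on_def using Ck_on_parameter_integral[OF F', of _ 0] by blast
  fix t assume t: "t \<in> {-e<..<e}"
  have "((\<lambda>s. t *\<^sub>R ?F' (t * s)) has_integral F (t * 1) - F (t * 0)) {0..1}"
  proof (rule fundamental_theorem_of_calculus)
    fix s :: real assume s: "s \<in> {0..1}"
    have "(F has_vector_derivative ?F' (t * s)) (at (t * s))"
      using smooth_on_has_vector_derivative[OF assms(2) smooth_on_interval_scale[OF t]] s by simp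
    then have "((F \<circ> (\<lambda>s. t * s)) has_vector_derivative t *\<^sub>R ?F' (t * s)) (at s)"
      by (intro vector_diff_chain_at) (auto intro!: derivative_eq_intros
          simp flip: has_real_derivative_iff_has_vector_derivative)
    then show "((\<lambda>s. F (t * s)) has_vector_derivative t *\<^sub>R ?F' (t * s)) (at s within {0..1})"
      by (simp add: o_def has_vector_derivative_at_within)
  qed simp
  from integral_unique[OF this] show "F t = t *\<^sub>R ?H t"
    using assms(3) by simp
qed

section \<open>Smooth coordinates of the line\<close>

text \<open>The inverse \<open>g\<close> satisfies \<open>g' = 1 / h' \<circ> g\<close>, so each order of differentiability of \<open>g\<close> yields the next.\<close>

lemma smooth_inverse_real:
  fixes h :: "real \<Rightarrow> real"
  assumes "smooth_on {-e<..<e} h" "\<And>t. t \<in> {-e<..<e} \<Longrightarrow> vector_derivative h (at t) > 0"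
  shows "inj_on h {-e<..<e}" "open (h ` {-e<..<e})"
    "smooth_on (h ` {-e<..<e}) (inv_into {-e<..<e} h)"
proof -
  let ?I = "{-e<..<e}" and ?h' = "\<lambda>t. vector_derivative h (at t)"
  have d: "(h has_real_derivative ?h' t) (at t)" if "t \<in> ?I" for t
    using smooth_on_has_vector_derivative[OF assms(1) that]
    by (simp add: has_real_derivative_iff_has_vector_derivative)
  have mono: "h s < h t" if "s \<in> ?I" "t \<in> ?I" "s < t" for s t
  proof (rule DERIV_pos_imp_increasing[OF that(3)])
    fix x assume "s \<le> x" "x \<le> t"
    then have x: "x \<in> ?I" using that by auto
    show "\<exists>y. (h has_real_derivative y) (at x) \<and> 0 < y"
      using d[OF x] assms(2)[OF x] by blast
  qed
  show inj: "inj_on h ?I"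
    by (intro inj_onI) (metis less_irrefl mono not_less_iff_gr_or_eq)
  have cont: "continuous_on ?I h" using assms(1) by (rule smooth_on_continuous_on)
  show op: "open (h ` ?I)"
    by (rule invariance_of_domain[OF cont _ inj]) simp
  let ?g = "inv_into ?I h"
  have g: "?g y \<in> ?I" "h (?g y) = y" if "y \<in> h ` ?I" for y
    using that by (rule inv_into_into, rule f_inv_into_f)
  have dg: "(?g has_vector_derivative inverse (?h' (?g y))) (at y)" if y: "y \<in> h ` ?I" for y
  proof -
    have "(?g has_derivative (\<lambda>v. v * inverse (?h' (?g y)))) (at (h (?g y)))"
    proof (rule has_derivative_inverse_strong[OF _ g(1)[OF y] cont])
      show "(h has_derivative (\<lambda>v. ?h' (?g y) * v)) (at (?g y))"
        using d[OF g(1)[OF y]] by (simp add: has_field_derivative_def)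
      show "(\<lambda>v. ?h' (?g y) * v) \<circ> (\<lambda>v. v * inverse (?h' (?g y))) = id"
        using assms(2)[OF g(1)[OF y]] by (auto simp: fun_eq_iff)
    qed (auto intro: inv_into_f_f[OF inj])
    then show ?thesis using g(2)[OF y] by (simp add: has_vector_derivative_def)
  qed
  have h': "Ck_on n ?I (\<lambda>t. inverse (?h' t))" for n
  proof -
    have "smooth_on ?I (\<lambda>t. inverse (?h' t))"
      using assms(2) by (intro smooth_on_inverse smooth_on_vector_derivative assms(1)) (auto, force)
    then show ?thesis by (simp add: smooth_on_def)
  qed
  have "Ck_on n (h ` ?I) ?g" for n
  proof (induction n)
    case 0
    have "continuous_on (h ` ?I) ?g"
      by (intro continuous_at_imp_continuous_on ballI has_vector_derivative_continuous[OF dg])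
    then show ?case by simp
  next
    case (Suc n)
    show ?case
    proof (rule Ck_on_SucI_real[OF op dg])
      show "Ck_on n (h ` ?I) (\<lambda>y. inverse (?h' (?g y)))"
        using g by (intro Ck_on_compose[OF op _ _ h' Suc]) auto
    qed
  qed
  then show "smooth_on (h ` ?I) ?g" by (simp add: smooth_on_def)
qed

section \<open>Integral curves of smooth vector fields\<close>

lemma norm_diff_le_of_vector_derivative:
  fixes f :: "real \<Rightarrow> 'b::real_normed_vector"
  assumes "convex S" "\<And>t. t \<in> S \<Longrightarrow> (f has_vector_derivative f' t) (at t within S)"
    and "\<And>t. t \<in> S \<Longrightarrow> norm (f' t) \<le> B" "s \<in> S" "t \<in> S"
  shows "norm (f s - f t) \<le> B * \<bar>s - t\<bar>"
proof -
  have "norm (f s - f t) \<le> B * norm (s - t)"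
  proof (rule differentiable_bound[OF assms(1) _ _ assms(4,5)])
    show "(f has_derivative (\<lambda>v. v *\<^sub>R f' t)) (at t within S)" if "t \<in> S" for t
      using assms(2)[OF that] by (simp add: has_vector_derivative_def)
    show "onorm (\<lambda>v. v *\<^sub>R f' t) \<le> B" if "t \<in> S" for t
      using assms(3)[OF that] by (intro onorm_le) (simp add: mult.commute[of B] mult_left_mono)
  qed
  then show ?thesis by simp
qed

text \<open>The operator norm of the derivative is bounded by the sum of the norms of the partial derivatives,
and these are bounded on the compact ball.\<close>

lemma smooth_on_locally_lipschitz:
  fixes V :: "'a::euclidean_space \<Rightarrow> 'b::real_normed_vector"
  assumes "smooth_on W V" "cball z r \<subseteq> W"
  obtains L where "L > 0" "\<And>x y. x \<in> cball z r \<Longrightarrow> y \<in> cball z r \<Longrightarrow> norm (V x - V y) \<le> L * norm (x - y)"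
proof -
  have "\<exists>C. \<forall>x\<in>cball z r. norm (dir_deriv V x b) \<le> C" for b
  proof -
    have "continuous_on (cball z r) (\<lambda>x. dir_deriv V x b)"
      using smooth_on_continuous_on[OF smooth_on_frechet_derivative[OF assms(1)]] assms(2)
      by (rule continuous_on_subset)
    then have "bounded ((\<lambda>x. dir_deriv V x b) ` cball z r)"
      by (intro compact_imp_bounded compact_continuous_image) auto
    then show ?thesis by (auto simp: bounded_iff)
  qed
  then obtain C where C: "\<And>b x. x \<in> cball z r \<Longrightarrow> norm (dir_deriv V x b) \<le> C b" by metis
  define L where "L = (\<Sum>b\<in>(Basis :: 'a set). \<bar>C b\<bar>) + 1"
  have "onorm (frechet_derivative V (at x)) \<le> L" if x: "x \<in> cball z r" for x
  proof (rule onorm_le)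
    fix v :: 'a
    have lin: "linear (frechet_derivative V (at x))"
      using smooth_on_has_derivative[OF assms(1)] x assms(2) has_derivative_linear by blast
    have "dir_deriv V x v = (\<Sum>b\<in>Basis. (v \<bullet> b) *\<^sub>R dir_deriv V x b)"
      by (subst euclidean_representation[of v, symmetric])
         (simp add: linear_sum[OF lin] linear_scale[OF lin])
    also have "norm \<dots> \<le> (\<Sum>b\<in>Basis. \<bar>v \<bullet> b\<bar> * norm (dir_deriv V x b))"
      by (rule order_trans[OF norm_sum]) simp
    also have "\<dots> \<le> (\<Sum>b\<in>(Basis :: 'a set). norm v * \<bar>C b\<bar>)"
      using C[OF x] by (intro sum_mono mult_mono Basis_le_norm) (auto intro: order_trans[OF C[OF x]])
    also have "\<dots> \<le> L * norm v"
      by (simp add: L_def sum_distrib_left[symmetric] algebra_simps)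
    finally show "norm (dir_deriv V x v) \<le> L * norm v" .
  qed
  note onorm = this
  have "norm (V x - V y) \<le> L * norm (x - y)" if "x \<in> cball z r" "y \<in> cball z r" for x y
  proof (rule differentiable_bound[OF convex_cball _ _ that])
    show "(V has_derivative frechet_derivative V (at x)) (at x within cball z r)"
      if "x \<in> cball z r" for x
      using smooth_on_has_derivative[OF assms(1)] that assms(2) by (blast intro: has_derivative_at_withinI)
  qed (rule onorm)
  moreover have "L > 0" by (auto simp: L_def intro!: add_nonneg_pos sum_nonneg)
  ultimately show ?thesis by (rule that[rotated])
qed

text \<open>The existence part of the Picard--Lindeloef theorem. The integral operator acts on continuous curves with values in a
small ball around \<open>z0\<close>. So that the Banach space of bounded continuous functions on the whole line
can be used, time is clamped to the interval \<open>[-d, d]\<close>. The fixed point is smooth since the differential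
equation passes regularity from \<open>z\<close> to its derivative.\<close>

theorem integral_curve_exists:
  fixes V :: "'a::euclidean_space \<Rightarrow> 'a"
  assumes "open W" "smooth_on W V" "z0 \<in> W"
  obtains d z where "d > 0" "z 0 = z0" "smooth_on {-d<..<d} z"
    "\<And>t. t \<in> {-d<..<d} \<Longrightarrow> z t \<in> W"
    "\<And>t. t \<in> {-d<..<d} \<Longrightarrow> (z has_vector_derivative V (z t)) (at t)"
proof -
  obtain r where r: "r > 0" "cball z0 r \<subseteq> W"
    using assms(1,3) open_contains_cball by blast
  have contV: "continuous_on (cball z0 r) V"
    using smooth_on_continuous_on[OF assms(2)] r(2) by (rule continuous_on_subset)
  obtain L where L: "L > 0"
    "\<And>x y. x \<in> cball z0 r \<Longrightarrow> y \<in> cball z0 r \<Longrightarrow> norm (V x - V y) \<le> L * norm (x - y)"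
    using smooth_on_locally_lipschitz[OF assms(2) r(2)] by blast
  have "bounded (V ` cball z0 r)"
    using contV by (intro compact_imp_bounded compact_continuous_image) auto
  then obtain B where B: "B > 0" "\<And>x. x \<in> cball z0 r \<Longrightarrow> norm (V x) \<le> B"
    by (auto simp: bounded_pos)
  \<comment> \<open>the first bound keeps the curves in the ball of radius \<open>r\<close>, the second makes the operator a contraction\<close>
  define d where "d = min (r / B) (1 / (2 * L))"
  have d: "d > 0" using r L B by (simp add: d_def)
  have dB: "B * d \<le> r"
  proof -
    have "B * d \<le> B * (r / B)" using B by (intro mult_left_mono) (auto simp: d_def)
    then show ?thesis using B by simp
  qed
  have dL: "L * d \<le> 1 / 2"
  proof -
    have "L * d \<le> L * (1 / (2 * L))" using L by (intro mult_left_mono) (auto simp: d_def)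
    then show ?thesis using L by simp
  qed
  define S :: "(real \<Rightarrow>\<^sub>C 'a) set" where "S = PiC UNIV (\<lambda>_. cball z0 r)"
  have mem: "u \<in> S \<longleftrightarrow> (\<forall>t. u t \<in> cball z0 r)" for u
    by (auto simp: S_def mem_PiC_iff)
  define J where "J u t = integral {-d..t} (\<lambda>s. V (u s))" for u :: "real \<Rightarrow> 'a" and t
  define cl where "cl t = max (- d) (min d t)" for t :: real
  have cl: "cl t \<in> {-d..d}" for t using d by (auto simp: cl_def)
  have cont_cl: "continuous_on A cl" for A unfolding cl_def by (intro continuous_intros)
  have contVu: "continuous_on {-d..d} (\<lambda>s. V (apply_bcontfun u s))" if "u \<in> S" for u
    using that by (intro continuous_on_compose2[OF contV continuous_on_apply_bcontfun]) (auto simp: mem)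
  have dJ: "(J u has_vector_derivative V (u t)) (at t within {-d..d})"
    if "u \<in> S" "t \<in> {-d..d}" for u t
    using integral_has_vector_derivative[OF contVu[OF that(1)] that(2)]
    by (simp add: J_def[abs_def])
  define P where "P u t = z0 + (J (apply_bcontfun u) (cl t) - J (apply_bcontfun u) 0)" for u t
  have Pc: "continuous_on UNIV (P u)" if "u \<in> S" for u
  proof -
    have "continuous_on {-d..d} (J u)"
      using dJ[OF that] has_vector_derivative_continuous continuous_on_eq_continuous_within by blast
    then have "continuous_on UNIV (\<lambda>t. J u (cl t))"
      using cl by (intro continuous_on_compose2[OF _ cont_cl]) auto
    then show ?thesis unfolding P_def by (intro continuous_intros)
  qed
  have PB: "P u t \<in> cball z0 r" if "u \<in> S" for u t
  proof -
    have "norm (J u (cl t) - J u 0) \<le> B * \<bar>cl t - 0\<bar>"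
      using that d cl B(2) by (intro norm_diff_le_of_vector_derivative[OF _ dJ]) (auto simp: mem)
    also have "\<dots> \<le> B * d" using cl[of t] B by (intro mult_left_mono) auto
    finally show ?thesis using dB by (simp add: P_def dist_norm norm_minus_commute)
  qed
  define T where "T u = Bcontfun (P u)" for u
  have T: "apply_bcontfun (T u) = P u" if "u \<in> S" for u
  proof -
    have "norm (P u t) \<le> norm z0 + r" for t
      using PB[OF that, of t] norm_triangle_ineq2[of "P u t" z0] by (simp add: dist_norm norm_minus_commute)
    then have "P u \<in> bcontfun" by (intro bcontfun_normI[OF Pc[OF that]])
    then show ?thesis by (simp add: T_def Bcontfun_inverse)
  qed
  have "\<exists>!u\<in>S. T u = u"
  proof (rule Banach_fix[where c="1/2"])
    show "complete S" unfolding complete_eq_closed S_def by (intro closed_PiC) auto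
    have "const_bcontfun z0 \<in> S" using r by (simp add: mem)
    then show "S \<noteq> {}" by blast
    show "T ` S \<subseteq> S" using T PB by (auto simp: mem)
    fix u v assume uv: "u \<in> S" "v \<in> S"
    show "dist (T u) (T v) \<le> 1 / 2 * dist u v"
    proof (rule dist_bound)
      fix t
      let ?D = "\<lambda>t. J u t - J v t"
      have "norm (?D (cl t) - ?D 0) \<le> (L * dist u v) * \<bar>cl t - 0\<bar>"
      proof (rule norm_diff_le_of_vector_derivative)
        show "(?D has_vector_derivative (V (u s) - V (v s))) (at s within {-d..d})" if "s \<in> {-d..d}" for s
          by (intro has_vector_derivative_diff dJ uv that)
        show "norm (V (u s) - V (v s)) \<le> L * dist u v" for s
        proof -
          have "norm (V (u s) - V (v s)) \<le> L * norm (u s - v s)"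
            using uv by (intro L) (auto simp: mem)
          also have "\<dots> \<le> L * dist u v"
            using L(1) dist_bounded[of u s v] by (intro mult_left_mono) (auto simp: dist_norm)
          finally show ?thesis .
        qed
      qed (use cl d in auto)
      also have "\<dots> \<le> (L * dist u v) * d"
        using cl[of t] L by (intro mult_left_mono) auto
      also have "\<dots> = (L * d) * dist u v" by simp
      also have "\<dots> \<le> 1 / 2 * dist u v" by (intro mult_right_mono dL) simp
      finally show "dist (T u t) (T v t) \<le> 1 / 2 * dist u v"
        by (simp add: T uv P_def dist_norm algebra_simps)
    qed
  qed auto
  then obtain u where u: "u \<in> S" "T u = u" by blast
  have uP: "apply_bcontfun u = P u" using T[OF u(1)] u(2) by simp
  have du: "(apply_bcontfun u has_vector_derivative V (u t)) (at t)" if t: "t \<in> {-d<..<d}" for t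
  proof -
    have "(J u has_vector_derivative V (u t)) (at t within {-d<..<d})"
      using dJ[OF u(1), of t] t by (intro has_vector_derivative_within_subset[OF dJ[OF u(1)]]) auto
    then have "(J u has_vector_derivative V (u t)) (at t)"
      using t at_within_open[of t "{-d<..<d}"] by simp
    then have "((\<lambda>t. z0 + (J u t - J u 0)) has_vector_derivative V (u t)) (at t)"
      by (auto intro!: derivative_eq_intros)
    then show ?thesis
      by (rule has_vector_derivative_transform_within_open[of _ _ _ "{-d<..<d}"])
         (use t in \<open>auto simp: uP P_def cl_def\<close>)
  qed
  have inB: "u t \<in> cball z0 r" for t using u(1) by (auto simp: mem)
  have "Ck_on n {-d<..<d} (apply_bcontfun u)" for n
  proof (induction n)
    case 0
    then show ?case by simp
  next
    case (Suc n)
    show ?case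
    proof (rule Ck_on_SucI_real[OF _ du])
      have "Ck_on n W V" using assms(2) by (simp add: smooth_on_def)
      then show "Ck_on n {-d<..<d} (\<lambda>t. V (u t))"
        using inB r(2) by (intro Ck_on_compose[OF _ assms(1) _ _ Suc]) auto
    qed auto
  qed
  then have "smooth_on {-d<..<d} (apply_bcontfun u)" by (simp add: smooth_on_def)
  moreover have "u 0 = z0" using d by (simp add: uP P_def cl_def)
  ultimately show ?thesis using that[OF d _ _ _ du] inB r(2) by blast
qed

section \<open>A Riemannian metric on an open subset of the plane\<close>

lemma vec2_expansion: "v = v $ 1 *\<^sub>R axis 1 1 + v $ 2 *\<^sub>R axis 2 (1::real)" for v :: "real^2"
  by (simp add: vec_eq_iff forall_2 axis_def)

lemma linear_vec2:
  fixes f :: "real^2 \<Rightarrow> 'b::real_vector"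
  assumes "linear f"
  shows "f v = v $ 1 *\<^sub>R f (axis 1 1) + v $ 2 *\<^sub>R f (axis 2 1)"
  by (subst vec2_expansion[of v]) (simp add: linear_add[OF assms] linear_scale[OF assms])

definition cross2 :: "real^2 \<Rightarrow> real^2 \<Rightarrow> real" where
  "cross2 v w = v $ 1 * w $ 2 - v $ 2 * w $ 1"

text \<open>The metric is a family of bilinear forms \<open>G x\<close> on \<open>real^2\<close>, rather than a matrix, so that invariance
under a change of coordinates can be stated and proved without indices.\<close>

locale plane_metric =
  fixes U :: "(real^2) set" and G :: "real^2 \<Rightarrow> real^2 \<Rightarrow> real^2 \<Rightarrow> real"
  assumes open_U: "open U"
    and linear1: "x \<in> U \<Longrightarrow> linear (\<lambda>v. G x v w)"
    and symmetric: "x \<in> U \<Longrightarrow> G x v w = G x w v"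
    and positive: "x \<in> U \<Longrightarrow> v \<noteq> 0 \<Longrightarrow> G x v v > 0"
    and smooth: "smooth_on U (\<lambda>x. G x v w)"
begin

abbreviation "co i j x \<equiv> G x (axis i 1) (axis j 1)"

text \<open>The Gram determinant of the coordinate frame, that is, the square of the area density.\<close>

definition gram :: "real^2 \<Rightarrow> real" where
  "gram x = co 1 1 x * co 2 2 x - co 1 2 x * co 1 2 x"

definition metric_deriv :: "real^2 \<Rightarrow> real^2 \<Rightarrow> real^2 \<Rightarrow> real^2 \<Rightarrow> real" where
  "metric_deriv x u v w = dir_deriv (\<lambda>y. G y v w) x u"

text \<open>The Christoffel symbols of the first kind, as a trilinear form.\<close>

definition first_kind :: "real^2 \<Rightarrow> real^2 \<Rightarrow> real^2 \<Rightarrow> real^2 \<Rightarrow> real" where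
  "first_kind x u v w = (metric_deriv x u v w + metric_deriv x v u w - metric_deriv x w u v) / 2"

text \<open>The solution \<open>z\<close> of the linear system \<open>G x z w = first_kind x u v w\<close>, by Cramer's rule. The formula
without an inverse matrix makes the smooth dependence on \<open>x\<close> evident.\<close>

definition second_kind :: "real^2 \<Rightarrow> real^2 \<Rightarrow> real^2 \<Rightarrow> real^2" where
  "second_kind x u v = (\<chi> i.
     (if i = 1 then co 2 2 x * first_kind x u v (axis 1 1) - co 1 2 x * first_kind x u v (axis 2 1)
      else co 1 1 x * first_kind x u v (axis 2 1) - co 1 2 x * first_kind x u v (axis 1 1)) / gram x)"

lemma second_kind_nth:
  "second_kind x u v $ 1
    = (co 2 2 x * first_kind x u v (axis 1 1) - co 1 2 x * first_kind x u v (axis 2 1)) / gram x"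
  "second_kind x u v $ 2
    = (co 1 1 x * first_kind x u v (axis 2 1) - co 1 2 x * first_kind x u v (axis 1 1)) / gram x"
  by (simp_all add: second_kind_def)

lemma linear2: "x \<in> U \<Longrightarrow> linear (G x v)"
  using linear1[of x v] symmetric[of x v] by (simp add: ext[of "G x v" "\<lambda>w. G x w v"])

lemma expand:
  assumes "x \<in> U"
  shows "G x v w = co 1 1 x * (v $ 1 * w $ 1) + co 1 2 x * (v $ 1 * w $ 2 + v $ 2 * w $ 1)
    + co 2 2 x * (v $ 2 * w $ 2)"
  using linear_vec2[OF linear1[OF assms, of w], of v] linear_vec2[OF linear2[OF assms, of "axis 1 1"], of w]
    linear_vec2[OF linear2[OF assms, of "axis 2 1"], of w] symmetric[OF assms, of "axis 2 1" "axis 1 1"]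
  by (simp add: algebra_simps)

lemma co11_pos: "x \<in> U \<Longrightarrow> co 1 1 x > 0"
  by (rule positive) auto

text \<open>Evaluate the metric on the vector with coordinates \<open>(- g\<^sub>1\<^sub>2, g\<^sub>1\<^sub>1)\<close>, which is orthogonal to the first
coordinate vector.\<close>

lemma gram_pos:
  assumes "x \<in> U"
  shows "gram x > 0"
proof -
  define w :: "real^2" where "w = (\<chi> i. if i = 1 then - co 1 2 x else co 1 1 x)"
  have w: "w $ 1 = - co 1 2 x" "w $ 2 = co 1 1 x" by (simp_all add: w_def)
  have "w \<noteq> 0"
  proof
    assume "w = 0"
    then show False using co11_pos[OF assms] w(2) by simp
  qed
  from positive[OF assms this] have "0 < co 1 1 x * gram x"
    unfolding expand[OF assms, of w w] w gram_def by (simp add: algebra_simps)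
  then show ?thesis using co11_pos[OF assms] by (simp add: zero_less_mult_iff)
qed

lemma nondegenerate:
  assumes "x \<in> U" "\<And>w. G x v w = G x v' w"
  shows "v = v'"
proof (rule ccontr)
  assume "v \<noteq> v'"
  then have "G x (v - v') (v - v') > 0" by (intro positive assms) simp
  then show False using assms(2) by (simp add: linear_diff[OF linear1[OF assms(1)]])
qed

lemma positive_iff: "x \<in> U \<Longrightarrow> G x v v > 0 \<longleftrightarrow> v \<noteq> 0"
  using positive linear_0[OF linear1] by (metis less_irrefl)

lemma scale_both: "x \<in> U \<Longrightarrow> G x (a *\<^sub>R v) (b *\<^sub>R w) = a * b * G x v w"
  by (simp add: linear_scale[OF linear1] linear_scale[OF linear2])

lemma smooth_on_along:
  assumes "open S" "x ` S \<subseteq> U" "smooth_on S x" "smooth_on S v" "smooth_on S w"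
  shows "smooth_on S (\<lambda>t. G (x t) (v t) (w t))"
proof (rule smooth_on_cong[OF assms(1)])
  show "smooth_on S (\<lambda>t. co 1 1 (x t) * (v t $ 1 * w t $ 1) + co 1 2 (x t) * (v t $ 1 * w t $ 2 + v t $ 2 * w t $ 1)
    + co 2 2 (x t) * (v t $ 2 * w t $ 2))"
    by (intro smooth_on_add smooth_on_mult smooth_on_vec_nth assms
        smooth_on_compose[OF assms(1) open_U assms(2) smooth assms(3)])
qed (use assms(2) in \<open>auto simp: expand[symmetric]\<close>)

lemma has_derivative_G: "x \<in> U \<Longrightarrow> ((\<lambda>y. G y v w) has_derivative (\<lambda>u. metric_deriv x u v w)) (at x)"
  unfolding metric_deriv_def using smooth_on_has_derivative[OF smooth] by blast

lemma metric_deriv_linear1: "x \<in> U \<Longrightarrow> linear (\<lambda>u. metric_deriv x u v w)"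
  using has_derivative_G has_derivative_linear by blast

lemma metric_deriv_linear2:
  assumes "x \<in> U"
  shows "linear (\<lambda>v. metric_deriv x u v w)"
proof -
  have "metric_deriv x u (a *\<^sub>R v + b *\<^sub>R v') w = a * metric_deriv x u v w + b * metric_deriv x u v' w" for a b v v'
  proof -
    have "((\<lambda>y. a * G y v w + b * G y v' w) has_derivative (\<lambda>u. a * metric_deriv x u v w + b * metric_deriv x u v' w)) (at x)"
      by (intro has_derivative_add has_derivative_mult_right has_derivative_G assms)
    then have "((\<lambda>y. G y (a *\<^sub>R v + b *\<^sub>R v') w) has_derivative
        (\<lambda>u. a * metric_deriv x u v w + b * metric_deriv x u v' w)) (at x)"
      by (rule has_derivative_transform_within_open[OF _ open_U assms])
         (simp add: linear_add[OF linear1] linear_scale[OF linear1])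
    from frechet_derivative_at[OF this] show ?thesis unfolding metric_deriv_def by (rule fun_cong[OF sym])
  qed
  from this[of 1 _ 1] this[of _ _ 0] show ?thesis by (intro linearI) simp_all
qed

lemma metric_deriv_symmetric:
  assumes "x \<in> U"
  shows "metric_deriv x u v w = metric_deriv x u w v"
proof -
  have "((\<lambda>y. G y v w) has_derivative (\<lambda>u. metric_deriv x u w v)) (at x)"
    by (rule has_derivative_transform_within_open[OF has_derivative_G[OF assms] open_U assms])
       (rule symmetric)
  from frechet_derivative_at[OF this] show ?thesis unfolding metric_deriv_def by (rule fun_cong[OF sym])
qed

lemma metric_deriv_linear3: "x \<in> U \<Longrightarrow> linear (metric_deriv x u v)"
  using metric_deriv_linear2[of x u v] metric_deriv_symmetric[of x u v] by (simp add: ext[of "metric_deriv x u v" "\<lambda>w. metric_deriv x u w v"])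

lemmas metric_deriv_simps = linear_add[OF metric_deriv_linear1] linear_add[OF metric_deriv_linear2] linear_add[OF metric_deriv_linear3]
  linear_scale[OF metric_deriv_linear1] linear_scale[OF metric_deriv_linear2] linear_scale[OF metric_deriv_linear3]

lemma first_kind_linear:
  assumes "x \<in> U"
  shows "linear (\<lambda>u. first_kind x u v w)" "linear (\<lambda>v. first_kind x u v w)"
    "linear (first_kind x u v)"
  by (intro linearI; simp add: first_kind_def metric_deriv_simps assms algebra_simps add_divide_distrib
      diff_divide_distrib)+

lemma second_kind_lowered:
  assumes "x \<in> U"
  shows "G x (second_kind x u v) w = first_kind x u v w"
proof -
  have g: "gram x \<noteq> 0" using gram_pos[OF assms] by simp
  let ?k = "\<lambda>i. first_kind x u v (axis i 1)"
  have "gram x * G x (second_kind x u v) w = gram x * (w $ 1 * ?k 1 + w $ 2 * ?k 2)"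
    unfolding expand[OF assms, of "second_kind x u v"] second_kind_nth
    by (simp add: g field_simps) (simp add: gram_def algebra_simps)
  then show ?thesis
    using g linear_vec2[OF first_kind_linear(3)[OF assms], of u v w] by simp
qed

text \<open>This characterization by duality replaces computations with the Christoffel symbols in what follows.\<close>

lemma second_kind_unique:
  assumes "x \<in> U" "\<And>w. G x z w = first_kind x u v w"
  shows "z = second_kind x u v"
  using assms by (intro nondegenerate[OF assms(1)]) (simp add: second_kind_lowered)

lemma second_kind_linear:
  assumes "x \<in> U"
  shows "linear (\<lambda>u. second_kind x u v)" "linear (second_kind x u)"
proof -
  show "linear (\<lambda>u. second_kind x u v)"
    by (intro linearI; rule second_kind_unique[symmetric, OF assms];
        simp add: linear_add[OF linear1[OF assms]] linear_scale[OF linear1[OF assms]]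
          second_kind_lowered[OF assms] linear_add[OF first_kind_linear(1)[OF assms]]
          linear_scale[OF first_kind_linear(1)[OF assms]])
  show "linear (second_kind x u)"
    by (intro linearI; rule second_kind_unique[symmetric, OF assms];
        simp add: linear_add[OF linear1[OF assms]] linear_scale[OF linear1[OF assms]]
          second_kind_lowered[OF assms] linear_add[OF first_kind_linear(2)[OF assms]]
          linear_scale[OF first_kind_linear(2)[OF assms]])
qed

text \<open>The connection is metric: in the sum of the two Christoffel symbols of the first kind, the
derivatives of the metric in the directions \<open>v\<close> and \<open>w\<close> cancel.\<close>

lemma metric_compatible:
  assumes "x \<in> U"
  shows "metric_deriv x u v w = G x (second_kind x u v) w + G x v (second_kind x u w)"
  by (simp add: symmetric[OF assms, of v] second_kind_lowered[OF assms] first_kind_def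
      metric_deriv_symmetric[OF assms, of u w v] metric_deriv_symmetric[OF assms, of v w u] metric_deriv_symmetric[OF assms, of w v u] field_simps)

lemma smooth_on_gram: "smooth_on U gram"
  unfolding gram_def by (intro smooth_on_diff smooth_on_mult smooth open_U)

lemma smooth_on_gram_along:
  assumes "open S" "x ` S \<subseteq> U" "smooth_on S x"
  shows "smooth_on S (\<lambda>t. gram (x t))"
  by (rule smooth_on_compose[OF assms(1) open_U assms(2) smooth_on_gram assms(3)])

lemma smooth_on_first_kind: "smooth_on U (\<lambda>x. first_kind x u v w)"
  unfolding first_kind_def metric_deriv_def
  by (intro smooth_on_divide smooth_on_diff smooth_on_add smooth_on_frechet_derivative smooth open_U
      smooth_on_const) simp

lemma smooth_on_second_kind_along:
  assumes "open S" "x ` S \<subseteq> U" "smooth_on S x" "smooth_on S u" "smooth_on S v"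
  shows "smooth_on S (\<lambda>t. second_kind (x t) (u t) (v t))"
proof (rule smooth_on_cong[OF assms(1)])
  have *: "smooth_on U (\<lambda>x. second_kind x a b)" for a b
  proof -
    have "smooth_on U (\<lambda>x. (if i = 1
        then co 2 2 x * first_kind x a b (axis 1 1) - co 1 2 x * first_kind x a b (axis 2 1)
        else co 1 1 x * first_kind x a b (axis 2 1) - co 1 2 x * first_kind x a b (axis 1 1)) / gram x)"
      for i :: 2
      using gram_pos
      by (cases "i = 1"; simp; intro smooth_on_divide smooth_on_diff smooth_on_mult smooth
          smooth_on_first_kind smooth_on_gram open_U; force)
    then show ?thesis
      unfolding second_kind_def by (intro smooth_on_vec_lambda open_U)
  qed
  let ?s = "\<lambda>i j x. second_kind x (axis i 1) (axis j 1)"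
  show "smooth_on S (\<lambda>t. (u t $ 1 * v t $ 1) *\<^sub>R ?s 1 1 (x t) + (u t $ 1 * v t $ 2) *\<^sub>R ?s 1 2 (x t)
      + ((u t $ 2 * v t $ 1) *\<^sub>R ?s 2 1 (x t) + (u t $ 2 * v t $ 2) *\<^sub>R ?s 2 2 (x t)))"
    by (intro smooth_on_add smooth_on_scaleR smooth_on_mult smooth_on_vec_nth assms
        smooth_on_compose[OF assms(1) open_U assms(2) * assms(3)])
  fix t assume "t \<in> S"
  then have x: "x t \<in> U" using assms(2) by auto
  show "(u t $ 1 * v t $ 1) *\<^sub>R ?s 1 1 (x t) + (u t $ 1 * v t $ 2) *\<^sub>R ?s 1 2 (x t)
      + ((u t $ 2 * v t $ 1) *\<^sub>R ?s 2 1 (x t) + (u t $ 2 * v t $ 2) *\<^sub>R ?s 2 2 (x t))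
      = second_kind (x t) (u t) (v t)"
    using linear_vec2[OF second_kind_linear(1)[OF x, of "v t"], of "u t"]
      linear_vec2[OF second_kind_linear(2)[OF x, of "axis 1 1"], of "v t"]
      linear_vec2[OF second_kind_linear(2)[OF x, of "axis 2 1"], of "v t"]
    by (simp add: scaleR_add_right)
qed

text \<open>The term with \<^const>\<open>metric_deriv\<close> comes from the variation of the metric along the curve; the other two
are those of the product rule for a fixed scalar product.\<close>

lemma has_derivative_along:
  assumes x: "x t \<in> U" "(x has_vector_derivative x') (at t)"
    and v: "(v has_vector_derivative v') (at t)" and w: "(w has_vector_derivative w') (at t)"
  shows "((\<lambda>t. G (x t) (v t) (w t)) has_real_derivative
    metric_deriv (x t) x' (v t) (w t) + G (x t) v' (w t) + G (x t) (v t) w') (at t)"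
proof -
  have c: "((\<lambda>s. co i j (x s)) has_real_derivative metric_deriv (x t) x' (axis i 1) (axis j 1)) (at t)" for i j
    using has_derivative_compose[OF x(2)[unfolded has_vector_derivative_def] has_derivative_G[OF x(1)]]
    by (simp add: has_real_derivative_iff_has_vector_derivative has_vector_derivative_def
        linear_scale[OF metric_deriv_linear1[OF x(1)]])
  have n: "((\<lambda>s. f s $ i) has_real_derivative f' $ i) (at t)"
    if "(f has_vector_derivative f') (at t)" for f :: "real \<Rightarrow> real^2" and f' i
    using bounded_linear.has_vector_derivative[OF bounded_linear_vec_nth that]
    by (simp add: has_real_derivative_iff_has_vector_derivative)
  let ?e = "\<lambda>t. co 1 1 (x t) * (v t $ 1 * w t $ 1) + co 1 2 (x t) * (v t $ 1 * w t $ 2 + v t $ 2 * w t $ 1)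
    + co 2 2 (x t) * (v t $ 2 * w t $ 2)"
  \<comment> \<open>the derivative of the metric in the same expansion as in \<open>expand\<close>, for comparison of coefficients\<close>
  have dg: "metric_deriv (x t) x' (v t) (w t) = metric_deriv (x t) x' (axis 1 1) (axis 1 1) * (v t $ 1 * w t $ 1)
      + metric_deriv (x t) x' (axis 1 1) (axis 2 1) * (v t $ 1 * w t $ 2 + v t $ 2 * w t $ 1)
      + metric_deriv (x t) x' (axis 2 1) (axis 2 1) * (v t $ 2 * w t $ 2)"
    using linear_vec2[OF metric_deriv_linear2[OF x(1), of x' "w t"], of "v t"]
      linear_vec2[OF metric_deriv_linear3[OF x(1), of x' "axis 1 1"], of "w t"]
      linear_vec2[OF metric_deriv_linear3[OF x(1), of x' "axis 2 1"], of "w t"]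
      metric_deriv_symmetric[OF x(1), of x' "axis 2 1" "axis 1 1"]
    by (simp add: algebra_simps)
  have "(?e has_real_derivative
      metric_deriv (x t) x' (v t) (w t) + G (x t) v' (w t) + G (x t) (v t) w') (at t)"
    unfolding dg expand[OF x(1), of v'] expand[OF x(1), of "v t" w']
    by (auto intro!: derivative_eq_intros c n[OF v] n[OF w] simp: algebra_simps)
  moreover have "\<forall>\<^sub>F s in nhds t. x s \<in> U"
    using has_vector_derivative_continuous[OF x(2)] x(1) open_U
    by (simp add: continuous_at_open eventually_nhds)
  then have "\<forall>\<^sub>F s in nhds t. ?e s = G (x s) (v s) (w s)"
    by (rule eventually_mono) (simp add: expand[symmetric])
  ultimately show ?thesis
    using DERIV_cong_ev[of t t ?e "\<lambda>t. G (x t) (v t) (w t)"] by auto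
qed

definition area :: "real^2 \<Rightarrow> real^2 \<Rightarrow> real^2 \<Rightarrow> real" where
  "area x v w = sqrt (gram x) * cross2 v w"

definition len :: "real^2 \<Rightarrow> real^2 \<Rightarrow> real" where
  "len x v = sqrt (G x v v)"

text \<open>Rotation by a positive right angle.\<close>

definition rot :: "real^2 \<Rightarrow> real^2 \<Rightarrow> real^2" where
  "rot x e = (\<chi> i. (if i = 1 then - (co 1 2 x * e $ 1 + co 2 2 x * e $ 2)
     else co 1 1 x * e $ 1 + co 1 2 x * e $ 2) / sqrt (gram x))"

lemma rot_nth:
  "rot x e $ 1 = - (co 1 2 x * e $ 1 + co 2 2 x * e $ 2) / sqrt (gram x)"
  "rot x e $ 2 = (co 1 1 x * e $ 1 + co 1 2 x * e $ 2) / sqrt (gram x)"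
  by (simp_all add: rot_def)

lemma rot_orthogonal: "x \<in> U \<Longrightarrow> G x (rot x e) e = 0"
  by (simp add: expand[of x "rot x e" e] rot_nth algebra_simps diff_divide_distrib add_divide_distrib)

text \<open>Since \<open>rot x e\<close> is orthogonal to \<open>e\<close> and, by \<open>rot_isometric\<close> below, of the same length, this expresses that
the rotation is by a positive right angle.\<close>

lemma area_rot:
  assumes "x \<in> U" 
  shows "area x e (rot x e) = G x e e"
proof -
  have "cross2 e (rot x e) = G x e e / sqrt (gram x)"
    by (simp add: cross2_def rot_nth expand[OF assms, of e e] algebra_simps diff_divide_distrib
        add_divide_distrib)
  then show ?thesis using gram_pos[OF assms] by (simp add: area_def)
qed

lemma smooth_on_rot_along:
  assumes "open S" "x ` S \<subseteq> U" "smooth_on S x" "smooth_on S e"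
  shows "smooth_on S (\<lambda>t. rot (x t) (e t))"
proof -
  note c = smooth_on_compose[OF assms(1) open_U assms(2) smooth assms(3)]
  have "smooth_on S (\<lambda>t. (if i = 1 then - (co 1 2 (x t) * e t $ 1 + co 2 2 (x t) * e t $ 2)
     else co 1 1 (x t) * e t $ 1 + co 1 2 (x t) * e t $ 2) / sqrt (gram (x t)))" for i :: 2
    using gram_pos assms(2)
    by (cases "i = 1"; simp; intro smooth_on_divide smooth_on_minus smooth_on_diff smooth_on_add
        smooth_on_mult smooth_on_vec_nth smooth_on_sqrt smooth_on_gram_along c assms; force)
  then show ?thesis unfolding rot_def by (intro smooth_on_vec_lambda assms)
qed

end

section \<open>Change of coordinates\<close>

lemma has_vector_derivative_along_line:
  fixes f :: "'a::euclidean_space \<Rightarrow> 'b::real_normed_vector"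
  assumes "smooth_on S f" "x \<in> S"
  shows "((\<lambda>s. f (x + s *\<^sub>R u)) has_vector_derivative dir_deriv f x u) (at 0)"
proof -
  have d: "(f has_derivative frechet_derivative f (at (x + 0 *\<^sub>R u))) (at (x + 0 *\<^sub>R u))"
    using smooth_on_has_derivative[OF assms] by simp
  have "((\<lambda>s. x + s *\<^sub>R u) has_vector_derivative u) (at 0)"
    by (auto intro!: derivative_eq_intros simp: has_vector_derivative_def)
  then show ?thesis
    using has_derivative_compose[of "\<lambda>s. x + s *\<^sub>R u" "\<lambda>h. h *\<^sub>R u" 0 UNIV f, OF _ d]
      linear_scale[OF has_derivative_linear[OF d]]
    by (simp add: has_vector_derivative_def)
qed

text \<open>Differentiating the invariance of the metric in the direction \<open>u\<close> gives the derivative of \<open>G\<close> as that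
of \<open>H\<close> plus two terms with the second derivative of \<open>\<phi>\<close>. In the combination \<^const>\<open>plane_metric.first_kind\<close>
all of these cancel by symmetry, except the one with the second derivative in the directions \<open>u, v\<close>.\<close>

lemma christoffel_change_of_coordinates:
  assumes "plane_metric U G" "plane_metric V H"
    and W: "open W" "W \<subseteq> U" "\<phi> ` W \<subseteq> V" "smooth_on W \<phi>" "x \<in> W"
    and iso: "\<And>x v w. x \<in> W \<Longrightarrow> G x v w = H (\<phi> x) (dir_deriv \<phi> x v) (dir_deriv \<phi> x w)"
    and surj: "surj (frechet_derivative \<phi> (at x))"
  shows "dir_deriv \<phi> x (plane_metric.second_kind G x u v)
    = plane_metric.second_kind H (\<phi> x) (dir_deriv \<phi> x u) (dir_deriv \<phi> x v) + dir_deriv (\<lambda>y. dir_deriv \<phi> y v) x u"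
proof -
  interpret G: plane_metric U G by fact
  interpret H: plane_metric V H by fact
  let ?D = "frechet_derivative \<phi> (at x)" and ?D2 = "\<lambda>u v. dir_deriv (\<lambda>y. dir_deriv \<phi> y v) x u"
  have xU: "x \<in> U" and yV: "\<phi> x \<in> V" using W by auto
  have sym2: "?D2 u v = ?D2 v u" for u v
    by (rule second_derivative_symmetric[OF W(1,4,5)])
  have metric_deriv: "G.metric_deriv x u v w = H.metric_deriv (\<phi> x) (?D u) (?D v) (?D w) + H (\<phi> x) (?D2 u v) (?D w)
      + H (\<phi> x) (?D v) (?D2 u w)" for u v w
  proof -
    have "((\<lambda>s. H (\<phi> (x + s *\<^sub>R u)) (dir_deriv \<phi> (x + s *\<^sub>R u) v) (dir_deriv \<phi> (x + s *\<^sub>R u) w)) has_real_derivative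
       H.metric_deriv (\<phi> (x + 0 *\<^sub>R u)) (?D u) (dir_deriv \<phi> (x + 0 *\<^sub>R u) v) (dir_deriv \<phi> (x + 0 *\<^sub>R u) w)
       + H (\<phi> (x + 0 *\<^sub>R u)) (?D2 u v) (dir_deriv \<phi> (x + 0 *\<^sub>R u) w)
       + H (\<phi> (x + 0 *\<^sub>R u)) (dir_deriv \<phi> (x + 0 *\<^sub>R u) v) (?D2 u w)) (at 0)"
      using yV by (intro H.has_derivative_along has_vector_derivative_along_line[OF _ W(5)]
          smooth_on_frechet_derivative W(4)) simp
    then have 1: "((\<lambda>s. H (\<phi> (x + s *\<^sub>R u)) (dir_deriv \<phi> (x + s *\<^sub>R u) v) (dir_deriv \<phi> (x + s *\<^sub>R u) w))
       has_vector_derivative H.metric_deriv (\<phi> x) (?D u) (?D v) (?D w) + H (\<phi> x) (?D2 u v) (?D w)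
       + H (\<phi> x) (?D v) (?D2 u w)) (at 0)"
      by (simp add: has_real_derivative_iff_has_vector_derivative)
    have "open ((\<lambda>s. x + s *\<^sub>R u) -` W)"
      by (intro open_vimage W(1) continuous_intros)
    from has_vector_derivative_transform_within_open[OF 1 this]
    have "((\<lambda>s. G (x + s *\<^sub>R u) v w) has_vector_derivative H.metric_deriv (\<phi> x) (?D u) (?D v) (?D w)
        + H (\<phi> x) (?D2 u v) (?D w) + H (\<phi> x) (?D v) (?D2 u w)) (at 0)"
      using W(5) by (simp add: iso)
    moreover have "((\<lambda>s. G (x + s *\<^sub>R u) v w) has_vector_derivative G.metric_deriv x u v w) (at 0)"
      unfolding G.metric_deriv_def by (rule has_vector_derivative_along_line[OF G.smooth xU])
    ultimately show ?thesis by (metis vector_derivative_unique_at)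
  qed
  show ?thesis
  proof (rule H.nondegenerate[OF yV])
    fix w'
    obtain w where w: "w' = ?D w" using surj by (metis surjD)
    have "H (\<phi> x) (?D (G.second_kind x u v)) w' = G.first_kind x u v w"
      unfolding w by (simp add: iso[OF W(5), symmetric] G.second_kind_lowered[OF xU])
    also have "\<dots> = H.first_kind (\<phi> x) (?D u) (?D v) w' + H (\<phi> x) (?D2 u v) w'"
      unfolding w G.first_kind_def H.first_kind_def metric_deriv
      by (simp add: sym2[of v u] sym2[of w u] sym2[of w v] H.symmetric[OF yV, of "?D u"]
          H.symmetric[OF yV, of "?D v"] field_simps)
    finally show "H (\<phi> x) (?D (G.second_kind x u v)) w'
        = H (\<phi> x) (H.second_kind (\<phi> x) (?D u) (?D v) + ?D2 u v) w'"
      by (simp add: linear_add[OF H.linear1[OF yV]] H.second_kind_lowered[OF yV])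
  qed
qed

section \<open>Cusps in a coordinate chart\<close>

lemma continuous_on_interval_pos:
  fixes q :: "real \<Rightarrow> real"
  assumes "continuous_on {-e<..<e} q" "e > 0" "q 0 > 0"
  obtains d where "0 < d" "d \<le> e" "\<And>t. t \<in> {-d<..<d} \<Longrightarrow> q t > 0"
proof -
  have "isCont q 0"
    using assms(1,2) by (simp add: continuous_on_eq_continuous_at)
  then have "(q \<longlongrightarrow> q 0) (at 0)" by (simp add: isCont_def)
  then have "\<forall>\<^sub>F t in at 0. q t > 0"
    using assms(3) by (rule order_tendstoD)
  then obtain d where d: "d > 0" "\<And>t. t \<noteq> 0 \<Longrightarrow> dist t 0 < d \<Longrightarrow> q t > 0"
    unfolding eventually_at by auto
  show ?thesis
  proof (rule that[of "min d e"])
    fix t assume "t \<in> {- min d e<..<min d e}"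
    then show "q t > 0" using d(2)[of t] assms(3) by (cases "t = 0") (auto simp: dist_real_def)
  qed (use d assms in auto)
qed

lemma smooth_on_cross2:
  "open S \<Longrightarrow> smooth_on S v \<Longrightarrow> smooth_on S w \<Longrightarrow> smooth_on S (\<lambda>t. cross2 (v t) (w t))"
  unfolding cross2_def by (intro smooth_on_diff smooth_on_mult smooth_on_vec_nth)

text \<open>If \<open>F\<close> is an antiderivative of the integrand, then \<open>s \<mapsto> F (t s)\<close> has derivative \<open>t \<bar>t\<bar> s q(t s)\<close> on the
unit interval. This substitution treats both signs of \<open>t\<close> at once and exhibits the factor \<open>t \<bar>t\<bar>\<close>.\<close>

lemma interval_integral_abs_mult:
  fixes q f :: "real \<Rightarrow> real"
  assumes "smooth_on {-e<..<e} q" "t \<in> {-e<..<e}"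
    and f: "\<And>u. u \<in> {-e<..<e} \<Longrightarrow> f u = \<bar>u\<bar> * q u"
  shows "(LBINT u=ereal 0..ereal t. f u) = t * \<bar>t\<bar> * integral (cbox 0 1) (\<lambda>s. s ^ 1 *\<^sub>R q (t * s))"
proof -
  let ?T = "{min 0 t..max 0 t}"
  have T: "?T \<subseteq> {-e<..<e}" using assms(2) by auto
  have "continuous_on ?T (\<lambda>u. \<bar>u\<bar> * q u)"
    using continuous_on_subset[OF smooth_on_continuous_on[OF assms(1)] T] by (intro continuous_intros)
  then have cont: "continuous_on ?T f"
    by (rule continuous_on_eq) (use f T in auto)
  obtain F where F: "\<And>u. u \<in> ?T \<Longrightarrow> (F has_vector_derivative f u) (at u within ?T)"
    using antiderivative_continuous[OF cont] by blast
  have "(LBINT u=ereal 0..ereal t. f u) = F t - F 0"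
    using F by (intro interval_integral_FTC_finite cont) auto
  moreover have "((\<lambda>s. t * \<bar>t\<bar> * (s * q (t * s))) has_integral F (t * 1) - F (t * 0)) {0..1}"
  proof (rule fundamental_theorem_of_calculus)
    fix s :: real assume s: "s \<in> {0..1}"
    have im: "(\<lambda>s. t * s) ` {0..1} \<subseteq> ?T"
    proof clarify
      fix s :: real assume "s \<in> {0..1}"
      then show "t * s \<in> ?T"
        by (cases "t \<ge> 0") (auto simp: min_def max_def mult_left_le mult_le_0_iff
          dest: mult_left_mono_neg[of s 1 t])
    qed
    have ts: "t * s \<in> ?T" using im s by blast
    \<comment> \<open>the derivatives are one-sided at the ends of the interval, so the chain rule is used within it\<close>
    have 1: "((F \<circ> (\<lambda>s. t * s)) has_vector_derivative t *\<^sub>R f (t * s)) (at s within {0..1})"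
      using has_vector_derivative_within_subset[OF F[OF ts] im]
      by (intro vector_diff_chain_within) (auto intro!: derivative_eq_intros
              simp flip: has_real_derivative_iff_has_vector_derivative)
    have 2: "t *\<^sub>R f (t * s) = t * \<bar>t\<bar> * (s * q (t * s))"
      using f[of "t * s"] ts T s by (auto simp: abs_mult)
    show "((\<lambda>s. F (t * s)) has_vector_derivative t * \<bar>t\<bar> * (s * q (t * s))) (at s within {0..1})"
      using 1 unfolding 2 o_def .
  qed simp
  from integral_unique[OF this] have "t * \<bar>t\<bar> * integral {0..1} (\<lambda>s. s * q (t * s)) = F t - F 0"
    by simp
  ultimately show ?thesis by simp
qed

lemma integral_id_01: "integral (cbox 0 1) (\<lambda>s. s ^ 1 *\<^sub>R (c::real)) = c / 2"
proof -
  have "((\<lambda>s. s * c) has_integral 1\<^sup>2 * c / 2 - 0\<^sup>2 * c / 2) {0..1}"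
    by (rule fundamental_theorem_of_calculus) (auto intro!: derivative_eq_intros
        simp flip: has_real_derivative_iff_has_vector_derivative)
  from integral_unique[OF this] show ?thesis by simp
qed

definition vel :: "(real \<Rightarrow> real^2) \<Rightarrow> real \<Rightarrow> real^2" where
  "vel x t = vector_derivative x (at t)"

lemma smooth_on_vel: "open S \<Longrightarrow> smooth_on S x \<Longrightarrow> smooth_on S (vel x)"
  unfolding vel_def[abs_def] by (rule smooth_on_vector_derivative)

context plane_metric
begin

text \<open>The Cauchy--Binet identity for a plane with a scalar product.\<close>

lemma area_times_area:
  assumes "x \<in> U"
  shows "area x v w * area x v' w' = G x v v' * G x w w' - G x v w' * G x w v'"
proof -
  have "area x v w * area x v' w' = gram x * (cross2 v w * cross2 v' w')"
    using gram_pos[OF assms] by (simp add: area_def)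
  then show ?thesis
    by (simp add: expand[OF assms, of v v'] expand[OF assms, of w w'] expand[OF assms, of v w']
        expand[OF assms, of w v'] gram_def cross2_def algebra_simps)
qed

lemma rot_isometric:
  assumes "x \<in> U" "e \<noteq> 0"
  shows "G x (rot x e) (rot x e) = G x e e"
  using area_times_area[OF assms(1), of e "rot x e" e "rot x e"] positive[OF assms]
  by (simp add: area_rot assms rot_orthogonal symmetric[OF assms(1), of e "rot x e"])

lemma area_bilinear:
  "area x (a *\<^sub>R v) w = a * area x v w" "area x v (a *\<^sub>R w) = a * area x v w"
  "area x v (w + w') = area x v w + area x v w'" "area x v v = 0"
  by (simp_all add: area_def cross2_def algebra_simps)

lemma len_scale: "x \<in> U \<Longrightarrow> len x (a *\<^sub>R v) = \<bar>a\<bar> * len x v"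
  by (simp add: len_def scale_both real_sqrt_mult power2_eq_square[symmetric])

definition cov_deriv :: "(real \<Rightarrow> real^2) \<Rightarrow> (real \<Rightarrow> real^2) \<Rightarrow> real \<Rightarrow> real^2" where
  "cov_deriv x X t = vector_derivative X (at t) + second_kind (x t) (vel x t) (X t)"

lemma smooth_on_cov_deriv:
  "open S \<Longrightarrow> x ` S \<subseteq> U \<Longrightarrow> smooth_on S x \<Longrightarrow> smooth_on S X \<Longrightarrow> smooth_on S (cov_deriv x X)"
  unfolding cov_deriv_def[abs_def]
  by (intro smooth_on_add smooth_on_vector_derivative smooth_on_second_kind_along smooth_on_vel)

text \<open>Both correction terms \<open>\<Gamma>(x', x')\<close> and \<open>\<Gamma>(x', x'')\<close> vanish at the cusp since \<open>x'\<close> does; so the third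
derivative at \<open>0\<close> is the derivative of \<open>c + t b\<close>, namely \<open>c'(0) + b(0)\<close>, and \<open>b(0) = c'(0)\<close>.\<close>

lemma cusp_factorization:
  assumes e: "e > 0" and x: "smooth_on {-e<..<e} x" "x ` {-e<..<e} \<subseteq> U" and v0: "vel x 0 = 0"
  obtains c b where "smooth_on {-e<..<e} c" "smooth_on {-e<..<e} b"
    "\<And>t. t \<in> {-e<..<e} \<Longrightarrow> vel x t = t *\<^sub>R c t"
    "\<And>t. t \<in> {-e<..<e} \<Longrightarrow> cov_deriv x (vel x) t = c t + t *\<^sub>R b t"
    "cov_deriv x (cov_deriv x (vel x)) 0 = 2 *\<^sub>R b 0"
proof -
  let ?I = "{-e<..<e}"
  have I: "open ?I" "0 \<in> ?I" using e by auto
  obtain c where c: "smooth_on ?I c" "\<And>t. t \<in> ?I \<Longrightarrow> vel x t = t *\<^sub>R c t"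
    using smooth_on_divide_variable[OF e smooth_on_vel[OF I(1) x(1)] v0] by blast
  define c' where "c' t = vector_derivative c (at t)" for t
  have c': "smooth_on ?I c'" unfolding c'_def using I(1) c(1) by (rule smooth_on_vector_derivative)
  have dc: "(c has_vector_derivative c' t) (at t)" if "t \<in> ?I" for t
    unfolding c'_def using smooth_on_has_vector_derivative[OF c(1) that] .
  define b where "b t = c' t + t *\<^sub>R second_kind (x t) (c t) (c t)" for t
  have b: "smooth_on ?I b"
    unfolding b_def by (intro smooth_on_add smooth_on_scaleR smooth_on_ident
        smooth_on_second_kind_along I x c c')
  have acc: "cov_deriv x (vel x) t = c t + t *\<^sub>R b t" if t: "t \<in> ?I" for t
  proof -
    have "((\<lambda>t. t *\<^sub>R c t) has_vector_derivative (t *\<^sub>R c' t + 1 *\<^sub>R c t)) (at t)"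
      by (intro has_vector_derivative_scaleR dc t) (auto intro!: derivative_eq_intros)
    then have "(vel x has_vector_derivative (t *\<^sub>R c' t + 1 *\<^sub>R c t)) (at t)"
      by (rule has_vector_derivative_transform_within_open[OF _ I(1) t]) (simp add: c)
    then have "vector_derivative (vel x) (at t) = t *\<^sub>R c' t + c t"
      by (simp add: vector_derivative_at)
    moreover have "x t \<in> U" using x(2) t by auto
    ultimately show ?thesis
      by (simp add: cov_deriv_def c(2)[OF t] b_def linear_scale[OF second_kind_linear(1)]
          linear_scale[OF second_kind_linear(2)] algebra_simps)
  qed
  have "((\<lambda>t. c t + t *\<^sub>R b t) has_vector_derivative
      (c' 0 + (0 *\<^sub>R vector_derivative b (at 0) + 1 *\<^sub>R b 0))) (at 0)"
    by (intro has_vector_derivative_add has_vector_derivative_scaleR dc I(2)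
        smooth_on_has_vector_derivative[OF b]) (auto intro!: derivative_eq_intros)
  then have "(cov_deriv x (vel x) has_vector_derivative
      (c' 0 + (0 *\<^sub>R vector_derivative b (at 0) + 1 *\<^sub>R b 0))) (at 0)"
    by (rule has_vector_derivative_transform_within_open[OF _ I]) (simp add: acc)
  then have d0: "vector_derivative (cov_deriv x (vel x)) (at 0) = c' 0 + b 0"
    by (simp add: vector_derivative_at)
  have "x 0 \<in> U" using x(2) I(2) by auto
  then have "cov_deriv x (cov_deriv x (vel x)) 0 = 2 *\<^sub>R b 0"
    by (subst cov_deriv_def) (simp add: d0 v0 linear_0[OF second_kind_linear(1)] b_def scaleR_2)
  then show ?thesis using that c b acc by blast
qed

text \<open>Here \<open>h = \<integral> s q(t s) ds\<close> over the unit interval and \<open>m = [c, b] / q\<^sup>3\<close>, with \<open>c\<close>, \<open>b\<close> from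
\<open>cusp_factorization\<close> and \<open>q\<close> the length of \<open>c\<close>. The passage to a smaller interval ensures that \<open>q\<close> and
\<open>h\<close> are positive there.\<close>

lemma cusp_local_form:
  assumes e: "e > 0" and x: "smooth_on {-e<..<e} x" "x ` {-e<..<e} \<subseteq> U" and v0: "vel x 0 = 0"
    and cusp: "area (x 0) (cov_deriv x (vel x) 0) (cov_deriv x (cov_deriv x (vel x)) 0) \<noteq> 0"
  obtains d h m where "0 < d" "d \<le> e" "smooth_on {-d<..<d} h" "smooth_on {-d<..<d} m"
    "\<And>t. t \<in> {-d<..<d} \<Longrightarrow> h t > 0"
    "\<And>t. t \<in> {-d<..<d} \<Longrightarrow> (LBINT u=ereal 0..ereal t. len (x u) (vel x u)) = t * \<bar>t\<bar> * h t"
    "\<And>t. t \<in> {-d<..<d} \<Longrightarrow> t \<noteq> 0 \<Longrightarrow>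
      area (x t) (vel x t) (cov_deriv x (vel x) t) / len (x t) (vel x t) ^ 3 = m t / \<bar>t\<bar>"
    "sqrt (h 0) * m 0 = area (x 0) (cov_deriv x (vel x) 0) (cov_deriv x (cov_deriv x (vel x)) 0)
      / len (x 0) (cov_deriv x (vel x) 0) powr (5/2) / (2 * sqrt 2)"
proof -
  let ?I = "{-e<..<e}"
  obtain c b where c: "smooth_on ?I c" and b: "smooth_on ?I b"
    and vel: "\<And>t. t \<in> ?I \<Longrightarrow> vel x t = t *\<^sub>R c t"
    and acc: "\<And>t. t \<in> ?I \<Longrightarrow> cov_deriv x (vel x) t = c t + t *\<^sub>R b t"
    and third: "cov_deriv x (cov_deriv x (vel x)) 0 = 2 *\<^sub>R b 0"
    using cusp_factorization[OF e x v0] by blast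
  have xU: "x t \<in> U" if "t \<in> ?I" for t using x(2) that by auto
  have acc0: "cov_deriv x (vel x) 0 = c 0" using acc[of 0] e by simp
  have area0: "area (x 0) (cov_deriv x (vel x) 0) (cov_deriv x (cov_deriv x (vel x)) 0) = 2 * area (x 0) (c 0) (b 0)"
    by (simp add: acc0 third area_bilinear)
  have c0: "c 0 \<noteq> 0"
    using cusp unfolding area0 by (auto simp: area_def cross2_def)
  have "smooth_on ?I (\<lambda>t. G (x t) (c t) (c t))"
    by (intro smooth_on_along x c open_greaterThanLessThan)
  moreover have "G (x 0) (c 0) (c 0) > 0" using c0 xU[of 0] e by (simp add: positive)
  ultimately obtain d1 where d1: "0 < d1" "d1 \<le> e" "\<And>t. t \<in> {-d1<..<d1} \<Longrightarrow> G (x t) (c t) (c t) > 0"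
    using continuous_on_interval_pos[OF smooth_on_continuous_on e] by blast
  let ?I1 = "{-d1<..<d1}"
  have sub1: "?I1 \<subseteq> ?I" using d1(2) by auto
  define q where "q t = len (x t) (c t)" for t
  have q: "smooth_on ?I1 q"
    unfolding q_def len_def using d1(3) sub1 x(2)
    by (intro smooth_on_sqrt smooth_on_along open_greaterThanLessThan
        smooth_on_subset[OF x(1)] smooth_on_subset[OF c]) auto
  have qpos: "q t > 0" if "t \<in> ?I1" for t using d1(3)[OF that] by (simp add: q_def len_def)
  have len: "len (x t) (vel x t) = \<bar>t\<bar> * q t" if "t \<in> ?I1" for t
    using that sub1 by (simp add: vel subset_iff q_def len_scale xU)
  define h where "h t = integral (cbox 0 1) (\<lambda>s. s ^ 1 *\<^sub>R q (t * s))" for t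
  have h: "smooth_on ?I1 h"
    unfolding h_def smooth_on_def using Ck_on_parameter_integral[OF q, of _ 1] by blast
  have h0: "h 0 = q 0 / 2" unfolding h_def using integral_id_01[of "q 0"] by simp
  have "h 0 > 0" using h0 qpos[of 0] d1(1) by simp
  then obtain d where d: "0 < d" "d \<le> d1" "\<And>t. t \<in> {-d<..<d} \<Longrightarrow> h t > 0"
    using continuous_on_interval_pos[OF smooth_on_continuous_on[OF h] d1(1)] by blast
  have sub: "{-d<..<d} \<subseteq> ?I1" using d(2) by auto
  define k where "k t = area (x t) (c t) (b t)" for t
  have k: "smooth_on ?I1 k"
    unfolding k_def area_def using sub1 gram_pos[OF xU] x(2)
    by (intro smooth_on_mult smooth_on_sqrt smooth_on_gram_along smooth_on_cross2
        open_greaterThanLessThan smooth_on_subset[OF x(1)] smooth_on_subset[OF c] smooth_on_subset[OF b])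
      auto
  define m where "m t = k t / q t ^ 3" for t
  have m: "smooth_on ?I1 m"
    unfolding m_def using qpos
    by (intro smooth_on_divide smooth_on_power k q open_greaterThanLessThan) force
  show ?thesis
  proof (rule that[OF d(1) _ smooth_on_subset[OF h sub] smooth_on_subset[OF m sub] d(3)])
    show "d \<le> e" using d d1 by simp
    show "(LBINT u=ereal 0..ereal t. len (x u) (vel x u)) = t * \<bar>t\<bar> * h t" if "t \<in> {-d<..<d}" for t
      unfolding h_def using that sub by (intro interval_integral_abs_mult[OF q] len) auto
    show "area (x t) (vel x t) (cov_deriv x (vel x) t) / len (x t) (vel x t) ^ 3 = m t / \<bar>t\<bar>"
      if "t \<in> {-d<..<d}" "t \<noteq> 0" for t
    proof -
      have t: "t \<in> ?I1" "t \<in> ?I" using that(1) sub sub1 by blast+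
      have a: "area (x t) (vel x t) (cov_deriv x (vel x) t) = \<bar>t\<bar>\<^sup>2 * k t"
        unfolding vel[OF t(2)] acc[OF t(2)] by (simp add: area_bilinear k_def power2_eq_square)
      show ?thesis
        unfolding a len[OF t(1)] m_def using that(2) qpos[OF t(1)]
        by (simp add: field_simps power_mult_distrib eval_nat_numeral)
    qed
    have q0: "q 0 > 0" using qpos d1(1) by simp
    then have p: "q 0 powr (5/2) = q 0 ^ 2 * sqrt (q 0)"
      using powr_add[of "q 0" 2 "1/2"] by (simp add: powr_half_sqrt powr_numeral)
    have s: "q 0 = sqrt (q 0) * sqrt (q 0)" using q0 by simp
    have "sqrt (h 0) * m 0 = sqrt (q 0) / sqrt 2 * (k 0 / q 0 ^ 3)"
      by (simp add: h0 m_def real_sqrt_divide)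
    also have "\<dots> = (2 * k 0) / (q 0 ^ 2 * sqrt (q 0)) / (2 * sqrt 2)"
      using q0 s by (simp add: field_simps eval_nat_numeral)
    finally show "sqrt (h 0) * m 0 = area (x 0) (cov_deriv x (vel x) 0) (cov_deriv x (cov_deriv x (vel x)) 0)
      / len (x 0) (cov_deriv x (vel x) 0) powr (5/2) / (2 * sqrt 2)"
      unfolding area0 by (simp add: acc0 p k_def flip: q_def)
  qed
qed

section \<open>Prescribing the curvature of a cusp\<close>

text \<open>The equations \<open>x' = 2 t e\<close> and \<open>\<nabla>e = 2 f J e\<close>, solved as an autonomous system with time as an additional
unknown. The squared length of \<open>e\<close> has derivative \<open>2 G(\<nabla>e, e)\<close>, which vanishes.\<close>

lemma prescribed_rotation_curve:
  assumes "\<epsilon> > 0" "smooth_on {-\<epsilon><..<\<epsilon>} f" "p \<in> U"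
  obtains d x e where "0 < d" "d \<le> \<epsilon>" "smooth_on {-d<..<d} x" "smooth_on {-d<..<d} e"
    "x ` {-d<..<d} \<subseteq> U"
    "\<And>t. t \<in> {-d<..<d} \<Longrightarrow> G (x t) (e t) (e t) = 1"
    "\<And>t. t \<in> {-d<..<d} \<Longrightarrow> (x has_vector_derivative (2 * t) *\<^sub>R e t) (at t)"
    "\<And>t. t \<in> {-d<..<d} \<Longrightarrow> (e has_vector_derivative
      ((2 * f t) *\<^sub>R rot (x t) (e t) - (2 * t) *\<^sub>R second_kind (x t) (e t) (e t))) (at t)"
proof -
  define W :: "(real \<times> (real^2) \<times> (real^2)) set" where "W = {-\<epsilon><..<\<epsilon>} \<times> U \<times> UNIV"
  \<comment> \<open>a point \<open>(t, x, e)\<close> moves with velocity \<open>(1, 2 t e, 2 f(t) J e - 2 t \<Gamma>(e, e))\<close>\<close>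
  define V :: "real \<times> (real^2) \<times> (real^2) \<Rightarrow> real \<times> (real^2) \<times> (real^2)" where
    "V z = (1, (2 * fst z) *\<^sub>R snd (snd z), (2 * f (fst z)) *\<^sub>R rot (fst (snd z)) (snd (snd z))
      - (2 * fst z) *\<^sub>R second_kind (fst (snd z)) (snd (snd z)) (snd (snd z)))" for z
  have W: "open W" unfolding W_def by (intro open_Times open_U) auto
  have V: "smooth_on W V"
    unfolding V_def
    by (intro smooth_on_pair smooth_on_diff smooth_on_scaleR smooth_on_mult smooth_on_rot_along
        smooth_on_second_kind_along smooth_on_const smooth_on_fst smooth_on_snd smooth_on_ident W
        smooth_on_compose[OF W _ _ assms(2)]) (auto simp: W_def)
  define e0 :: "real^2" where "e0 = (1 / sqrt (co 1 1 p)) *\<^sub>R axis 1 (1::real)"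
  have e0: "G p e0 e0 = 1"
    unfolding e0_def using co11_pos[OF assms(3)] by (simp add: scale_both assms)
  have "(0, p, e0) \<in> W" using assms by (simp add: W_def)
  then obtain d1 z where d1: "d1 > 0" and z0: "z 0 = (0, p, e0)" and z: "smooth_on {-d1<..<d1} z"
    and zW: "\<And>t. t \<in> {-d1<..<d1} \<Longrightarrow> z t \<in> W"
    and dz: "\<And>t. t \<in> {-d1<..<d1} \<Longrightarrow> (z has_vector_derivative V (z t)) (at t)"
    using integral_curve_exists[OF W V] by metis
  define d where "d = min d1 \<epsilon>"
  let ?I = "{-d<..<d}"
  have d: "0 < d" "d \<le> \<epsilon>" "?I \<subseteq> {-d1<..<d1}" using d1 assms(1) by (auto simp: d_def)
  have time: "fst (z t) = t" if t: "t \<in> ?I" for t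
  proof -
    have "norm ((fst (z t) - t) - (fst (z 0) - 0)) \<le> 0 * \<bar>t - 0\<bar>"
    proof (rule norm_diff_le_of_vector_derivative[of ?I])
      fix t assume "t \<in> ?I"
      then have "((\<lambda>t. fst (z t)) has_vector_derivative fst (V (z t))) (at t)"
        using d(3) by (intro bounded_linear.has_vector_derivative[OF bounded_linear_fst] dz) auto
      then have "((\<lambda>t. fst (z t) - t) has_vector_derivative (fst (V (z t)) - 1)) (at t)"
        by (auto intro!: derivative_eq_intros)
      then show "((\<lambda>t. fst (z t) - t) has_vector_derivative 0) (at t within ?I)"
        by (simp add: V_def has_vector_derivative_at_within)
    qed (use t d in auto)
    then show ?thesis by (simp add: z0)
  qed
  define x where "x t = fst (snd (z t))" for t
  define e where "e t = snd (snd (z t))" for t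
  have x: "smooth_on ?I x" and e: "smooth_on ?I e"
    unfolding x_def e_def using d(3)
    by (intro smooth_on_fst smooth_on_snd smooth_on_subset[OF z]; simp)+
  have xU: "x t \<in> U" if "t \<in> ?I" for t
  proof -
    have "z t \<in> W" using zW that d(3) by blast
    then show ?thesis by (auto simp: W_def x_def)
  qed
  have dx: "(x has_vector_derivative (2 * t) *\<^sub>R e t) (at t)" if t: "t \<in> ?I" for t
  proof -
    have "((\<lambda>t. fst (snd (z t))) has_vector_derivative fst (snd (V (z t)))) (at t)"
      using d(3) t by (intro bounded_linear.has_vector_derivative[OF bounded_linear_fst]
          bounded_linear.has_vector_derivative[OF bounded_linear_snd] dz) auto
    then show ?thesis by (simp add: V_def time[OF t] e_def x_def[abs_def])
  qed
  have de: "(e has_vector_derivative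
      ((2 * f t) *\<^sub>R rot (x t) (e t) - (2 * t) *\<^sub>R second_kind (x t) (e t) (e t))) (at t)"
    if t: "t \<in> ?I" for t
  proof -
    have "((\<lambda>t. snd (snd (z t))) has_vector_derivative snd (snd (V (z t)))) (at t)"
      using d(3) t by (intro bounded_linear.has_vector_derivative[OF bounded_linear_snd] dz) auto
    then show ?thesis by (simp add: V_def time[OF t] e_def[abs_def] x_def)
  qed
  have unit: "G (x t) (e t) (e t) = 1" if t: "t \<in> ?I" for t
  proof -
    have "norm (G (x t) (e t) (e t) - G (x 0) (e 0) (e 0)) \<le> 0 * \<bar>t - 0\<bar>"
    proof (rule norm_diff_le_of_vector_derivative[of ?I])
      fix t assume t: "t \<in> ?I"
      let ?e' = "(2 * f t) *\<^sub>R rot (x t) (e t) - (2 * t) *\<^sub>R second_kind (x t) (e t) (e t)"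
      note l = linear1[OF xU[OF t]] and r = rot_orthogonal[OF xU[OF t], of "e t"]
      have "((\<lambda>t. G (x t) (e t) (e t)) has_real_derivative
        metric_deriv (x t) ((2 * t) *\<^sub>R e t) (e t) (e t) + G (x t) ?e' (e t) + G (x t) (e t) ?e') (at t)"
        by (rule has_derivative_along[OF xU[OF t] dx[OF t] de[OF t] de[OF t]])
      moreover have "metric_deriv (x t) ((2 * t) *\<^sub>R e t) (e t) (e t) + G (x t) ?e' (e t) + G (x t) (e t) ?e' = 0"
        unfolding symmetric[OF xU[OF t], of "e t" ?e'] metric_compatible[OF xU[OF t]]
          symmetric[OF xU[OF t], of "e t" "second_kind (x t) ((2 * t) *\<^sub>R e t) (e t)"]
        by (simp add: linear_diff[OF l] linear_scale[OF l] r
            linear_scale[OF second_kind_linear(1)[OF xU[OF t]]])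
      ultimately show "((\<lambda>t. G (x t) (e t) (e t)) has_vector_derivative 0) (at t within ?I)"
        by (simp add: has_real_derivative_iff_has_vector_derivative has_vector_derivative_at_within)
    qed (use t d in auto)
    then show ?thesis using e0 by (simp add: x_def e_def z0)
  qed
  show ?thesis
    using that[OF d(1,2) x e _ unit dx de] xU by blast
qed

text \<open>Here the acceleration is \<open>\<nabla>(2 t e) = 2 e + 4 t f J e\<close>, and the third derivative at \<open>0\<close> is
\<open>4 f J e + 4 f J e\<close>.\<close>

lemma prescribed_cusp:
  assumes "\<epsilon> > 0" "smooth_on {-\<epsilon><..<\<epsilon>} f" "p \<in> U"
  obtains d x where "0 < d" "d \<le> \<epsilon>" "smooth_on {-d<..<d} x" "x ` {-d<..<d} \<subseteq> U" "vel x 0 = 0"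
    "area (x 0) (cov_deriv x (vel x) 0) (cov_deriv x (cov_deriv x (vel x)) 0) = 16 * f 0"
    "\<And>t. t \<in> {-d<..<d} \<Longrightarrow> len (x t) (vel x t) = 2 * \<bar>t\<bar>"
    "\<And>t. t \<in> {-d<..<d} \<Longrightarrow> area (x t) (vel x t) (cov_deriv x (vel x) t) = 8 * t\<^sup>2 * f t"
proof -
  obtain d x e where d: "0 < d" "d \<le> \<epsilon>" and x: "smooth_on {-d<..<d} x" and e: "smooth_on {-d<..<d} e"
    and xU: "x ` {-d<..<d} \<subseteq> U"
    and unit: "\<And>t. t \<in> {-d<..<d} \<Longrightarrow> G (x t) (e t) (e t) = 1"
    and dx: "\<And>t. t \<in> {-d<..<d} \<Longrightarrow> (x has_vector_derivative (2 * t) *\<^sub>R e t) (at t)"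
    and de: "\<And>t. t \<in> {-d<..<d} \<Longrightarrow> (e has_vector_derivative
      ((2 * f t) *\<^sub>R rot (x t) (e t) - (2 * t) *\<^sub>R second_kind (x t) (e t) (e t))) (at t)"
    using prescribed_rotation_curve[OF assms] by blast
  let ?I = "{-d<..<d}" and ?n = "\<lambda>t. rot (x t) (e t)"
  have I: "open ?I" "0 \<in> ?I" using d by auto
  have U: "x t \<in> U" if "t \<in> ?I" for t using xU that by auto
  have vel: "vel x t = (2 * t) *\<^sub>R e t" if "t \<in> ?I" for t
    unfolding vel_def by (rule vector_derivative_at[OF dx[OF that]])
  have acc: "cov_deriv x (vel x) t = 2 *\<^sub>R e t + (4 * t * f t) *\<^sub>R ?n t" if t: "t \<in> ?I" for t
  proof -
    let ?e' = "(2 * f t) *\<^sub>R ?n t - (2 * t) *\<^sub>R second_kind (x t) (e t) (e t)"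
    have "((\<lambda>t. (2 * t) *\<^sub>R e t) has_vector_derivative ((2 * t) *\<^sub>R ?e' + 2 *\<^sub>R e t)) (at t)"
      by (intro has_vector_derivative_scaleR de t) (auto intro!: derivative_eq_intros)
    then have "(vel x has_vector_derivative ((2 * t) *\<^sub>R ?e' + 2 *\<^sub>R e t)) (at t)"
      by (rule has_vector_derivative_transform_within_open[OF _ I(1) t]) (simp add: vel)
    then have "vector_derivative (vel x) (at t) = (2 * t) *\<^sub>R ?e' + 2 *\<^sub>R e t"
      by (rule vector_derivative_at)
    then show ?thesis
      using U[OF t] by (simp add: cov_deriv_def vel[OF t] linear_scale[OF second_kind_linear(1)]
          linear_scale[OF second_kind_linear(2)] algebra_simps)
  qed
  have fs: "smooth_on ?I f" using d(2) by (intro smooth_on_subset[OF assms(2)]) auto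
  \<comment> \<open>writing the second summand of the acceleration as \<open>4 t (f J e)\<close>, the derivative of \<open>f J e\<close> drops out at \<open>0\<close>\<close>
  have third: "cov_deriv x (cov_deriv x (vel x)) 0 = (8 * f 0) *\<^sub>R ?n 0"
  proof -
    define n' where "n' = vector_derivative (\<lambda>t. f t *\<^sub>R ?n t) (at 0)"
    have fn: "((\<lambda>t. f t *\<^sub>R ?n t) has_vector_derivative n') (at 0)"
      unfolding n'_def by (rule smooth_on_has_vector_derivative[OF _ I(2)])
        (intro smooth_on_scaleR fs smooth_on_rot_along I xU x e)
    have "((\<lambda>t. 2 *\<^sub>R e t + (4 * t) *\<^sub>R (f t *\<^sub>R ?n t)) has_vector_derivative
        2 *\<^sub>R ((2 * f 0) *\<^sub>R ?n 0 - (2 * 0) *\<^sub>R second_kind (x 0) (e 0) (e 0))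
        + ((4 * 0) *\<^sub>R n' + 4 *\<^sub>R (f 0 *\<^sub>R ?n 0))) (at 0)"
      by (intro has_vector_derivative_add has_vector_derivative_scaleR fn
          bounded_linear.has_vector_derivative[OF bounded_linear_scaleR_right] de I(2))
         (auto intro!: derivative_eq_intros)
    then have "(cov_deriv x (vel x) has_vector_derivative
        2 *\<^sub>R ((2 * f 0) *\<^sub>R ?n 0 - (2 * 0) *\<^sub>R second_kind (x 0) (e 0) (e 0))
        + ((4 * 0) *\<^sub>R n' + 4 *\<^sub>R (f 0 *\<^sub>R ?n 0))) (at 0)"
      by (rule has_vector_derivative_transform_within_open[OF _ I]) (simp add: acc)
    then have "vector_derivative (cov_deriv x (vel x)) (at 0) = (8 * f 0) *\<^sub>R ?n 0"
      by (simp add: vector_derivative_at flip: scaleR_add_left)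
    then show ?thesis
      by (subst cov_deriv_def) (simp add: vel[OF I(2)] linear_0[OF second_kind_linear(1)[OF U[OF I(2)]]])
  qed
  have en: "area (x t) (e t) (?n t) = 1" if "t \<in> ?I" for t
    using area_rot[OF U[OF that], of "e t"] unit[OF that] by simp
  show ?thesis
  proof (rule that[OF d x xU])
    show "vel x 0 = 0" by (simp add: vel[OF I(2)])
    have "area (x 0) (2 *\<^sub>R e 0) ((8 * f 0) *\<^sub>R ?n 0) = 16 * f 0"
      by (simp add: area_bilinear en[OF I(2)])
    then show "area (x 0) (cov_deriv x (vel x) 0) (cov_deriv x (cov_deriv x (vel x)) 0) = 16 * f 0"
      by (simp add: third acc[OF I(2)])
    show "len (x t) (vel x t) = 2 * \<bar>t\<bar>" if "t \<in> ?I" for t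
      using unit[OF that] by (simp add: vel[OF that] len_scale[OF U[OF that]] abs_mult len_def[of _ "e t"])
    show "area (x t) (vel x t) (cov_deriv x (vel x) t) = 8 * t\<^sup>2 * f t" if "t \<in> ?I" for t
      by (simp add: vel[OF that] acc[OF that] area_bilinear en[OF that] power2_eq_square)
  qed
qed

end

section \<open>Tangent vectors in charts\<close>

lemma vector_derivative_cong_open:
  assumes "open S" "t \<in> S" "\<And>s. s \<in> S \<Longrightarrow> f s = g s"
  shows "vector_derivative f (at t) = vector_derivative g (at t)"
proof -
  have "(f has_vector_derivative d) (at t) \<longleftrightarrow> (g has_vector_derivative d) (at t)" for d
  proof
    assume "(f has_vector_derivative d) (at t)"
    then show "(g has_vector_derivative d) (at t)"
      by (rule has_vector_derivative_transform_within_open[OF _ assms])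
  next
    assume "(g has_vector_derivative d) (at t)"
    then show "(f has_vector_derivative d) (at t)"
      by (rule has_vector_derivative_transform_within_open[OF _ assms(1,2)]) (rule assms(3)[symmetric])
  qed
  then show ?thesis by (simp add: vector_derivative_def)
qed

lemma cross2_linear_image:
  assumes "linear f"
  shows "cross2 (f u) (f v) = det (matrix f) * cross2 u v"
  using linear_vec2[OF assms, of u] linear_vec2[OF assms, of v]
  by (simp add: cross2_def det_2 matrix_def algebra_simps)

text \<open>The Jacobian matrix of \<open>\<phi>\<close> varies along the curve, which produces the term with second derivatives. For
a change of coordinates \<open>\<phi>\<close>, the transported field is the vector field in the new coordinates.\<close>

lemma has_vector_derivative_pushforward:
  fixes \<phi> :: "real^2 \<Rightarrow> 'b::real_normed_vector"
  assumes \<phi>: "open W" "smooth_on W \<phi>" "x t \<in> W"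
    and x: "(x has_vector_derivative x') (at t)" and X: "(X has_vector_derivative X') (at t)"
  shows "((\<lambda>s. dir_deriv \<phi> (x s) (X s)) has_vector_derivative
    (dir_deriv \<phi> (x t) X' + dir_deriv (\<lambda>y. dir_deriv \<phi> y (X t)) (x t) x')) (at t)"
proof -
  have lin: "linear (frechet_derivative \<phi> (at y))" if "y \<in> W" for y
    using smooth_on_has_derivative[OF \<phi>(2) that] by (rule has_derivative_linear)
  have e: "dir_deriv \<phi> y v = v $ 1 *\<^sub>R dir_deriv \<phi> y (axis 1 1) + v $ 2 *\<^sub>R dir_deriv \<phi> y (axis 2 1)" if "y \<in> W" for y v
    by (rule linear_vec2[OF lin[OF that]])
  have D: "((\<lambda>y. dir_deriv \<phi> y v) has_derivative (\<lambda>u. dir_deriv (\<lambda>y. dir_deriv \<phi> y v) (x t) u)) (at (x t))" for v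
    by (rule smooth_on_has_derivative[OF smooth_on_frechet_derivative[OF \<phi>(2)] \<phi>(3)])
  have d: "((\<lambda>s. dir_deriv \<phi> (x s) v) has_vector_derivative dir_deriv (\<lambda>y. dir_deriv \<phi> y v) (x t) x') (at t)" for v
    using has_derivative_compose[OF x[unfolded has_vector_derivative_def] D]
      linear_scale[OF has_derivative_linear[OF D]] by (simp add: has_vector_derivative_def)
  have n: "((\<lambda>s. X s $ i) has_field_derivative X' $ i) (at t)" for i
    using bounded_linear.has_vector_derivative[OF bounded_linear_vec_nth X]
    by (simp add: has_real_derivative_iff_has_vector_derivative)
  have e2: "dir_deriv (\<lambda>y. dir_deriv \<phi> y (X t)) (x t) x' = X t $ 1 *\<^sub>R dir_deriv (\<lambda>y. dir_deriv \<phi> y (axis 1 1)) (x t) x'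
      + X t $ 2 *\<^sub>R dir_deriv (\<lambda>y. dir_deriv \<phi> y (axis 2 1)) (x t) x'"
  proof -
    have "((\<lambda>y. X t $ 1 *\<^sub>R dir_deriv \<phi> y (axis 1 1) + X t $ 2 *\<^sub>R dir_deriv \<phi> y (axis 2 1)) has_derivative
      (\<lambda>u. X t $ 1 *\<^sub>R dir_deriv (\<lambda>y. dir_deriv \<phi> y (axis 1 1)) (x t) u
        + X t $ 2 *\<^sub>R dir_deriv (\<lambda>y. dir_deriv \<phi> y (axis 2 1)) (x t) u)) (at (x t))"
      by (intro has_derivative_add has_derivative_scaleR_right D)
    then have "((\<lambda>y. dir_deriv \<phi> y (X t)) has_derivative
      (\<lambda>u. X t $ 1 *\<^sub>R dir_deriv (\<lambda>y. dir_deriv \<phi> y (axis 1 1)) (x t) u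
        + X t $ 2 *\<^sub>R dir_deriv (\<lambda>y. dir_deriv \<phi> y (axis 2 1)) (x t) u)) (at (x t))"
      by (rule has_derivative_transform_within_open[OF _ \<phi>(1,3)]) (rule e[symmetric])
    from frechet_derivative_at[OF this] show ?thesis by (rule fun_cong[OF sym])
  qed
  have d: "((\<lambda>s. X s $ 1 *\<^sub>R dir_deriv \<phi> (x s) (axis 1 1) + X s $ 2 *\<^sub>R dir_deriv \<phi> (x s) (axis 2 1))
      has_vector_derivative
      ((X t $ 1 *\<^sub>R dir_deriv (\<lambda>y. dir_deriv \<phi> y (axis 1 1)) (x t) x' + X' $ 1 *\<^sub>R dir_deriv \<phi> (x t) (axis 1 1))
      + (X t $ 2 *\<^sub>R dir_deriv (\<lambda>y. dir_deriv \<phi> y (axis 2 1)) (x t) x' + X' $ 2 *\<^sub>R dir_deriv \<phi> (x t) (axis 2 1)))) (at t)"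
    by (intro has_vector_derivative_add has_vector_derivative_scaleR n d)
  have "isCont x t" using x by (rule has_vector_derivative_continuous)
  from this[unfolded continuous_at_open, rule_format, OF conjI[OF \<phi>(1,3)]]
  obtain S where S: "open S" "t \<in> S" "\<And>s. s \<in> S \<Longrightarrow> x s \<in> W" by blast
  have ee: "X s $ 1 *\<^sub>R dir_deriv \<phi> (x s) (axis 1 1) + X s $ 2 *\<^sub>R dir_deriv \<phi> (x s) (axis 2 1)
      = dir_deriv \<phi> (x s) (X s)" if "s \<in> S" for s
    using e[OF S(3)[OF that], of "X s"] by (rule sym)
  have "((\<lambda>s. dir_deriv \<phi> (x s) (X s)) has_vector_derivative
      ((X t $ 1 *\<^sub>R dir_deriv (\<lambda>y. dir_deriv \<phi> y (axis 1 1)) (x t) x' + X' $ 1 *\<^sub>R dir_deriv \<phi> (x t) (axis 1 1))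
      + (X t $ 2 *\<^sub>R dir_deriv (\<lambda>y. dir_deriv \<phi> y (axis 2 1)) (x t) x' + X' $ 2 *\<^sub>R dir_deriv \<phi> (x t) (axis 2 1)))) (at t)"
    by (rule has_vector_derivative_transform_within_open[OF d S(1,2)]) (rule ee)
  then show ?thesis unfolding e2 e[OF \<phi>(3), of X'] by (simp add: algebra_simps)
qed

locale riemannian_surface =
  fixes M :: "'p topology" and A :: "'p chart set" and g :: "'p metric"
  assumes oriented_riemannian: "oriented_riemannian_surface M A g"
begin

abbreviation region :: "'p chart \<Rightarrow> (real^2) set" where
  "region c \<equiv> coords c ` chart_dom c"

abbreviation overlap :: "'p chart \<Rightarrow> 'p chart \<Rightarrow> (real^2) set" where
  "overlap c d \<equiv> coords c ` (chart_dom c \<inter> chart_dom d)"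

text \<open>This is the metric in the chart \<open>c\<close> only for \<open>x\<close> in the image of the chart, where \<^const>\<open>chart_inv\<close>
inverts the coordinates.\<close>

definition chart_metric :: "'p chart \<Rightarrow> real^2 \<Rightarrow> real^2 \<Rightarrow> real^2 \<Rightarrow> real" where
  "chart_metric c x v w = g (chart_inv c x) (tvec_of A c (chart_inv c x) v) (tvec_of A c (chart_inv c x) w)"

lemma chart_facts:
  assumes "c \<in> A"
  shows "openin M (chart_dom c)" "open (region c)"
    "homeomorphic_map (subtopology M (chart_dom c)) (top_of_set (region c)) (coords c)"
    "topspace (subtopology M (chart_dom c)) = chart_dom c" "inj_on (coords c) (chart_dom c)"
proof -
  show *: "openin M (chart_dom c)" "open (region c)"
    "homeomorphic_map (subtopology M (chart_dom c)) (top_of_set (region c)) (coords c)"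
    using oriented_riemannian assms
    unfolding oriented_riemannian_surface_def oriented_surface_def by blast+
  show **: "topspace (subtopology M (chart_dom c)) = chart_dom c"
    using openin_subset[OF *(1)] by auto
  show "inj_on (coords c) (chart_dom c)"
    using homeomorphic_imp_injective_map[OF *(3)] ** by simp
qed

lemma chart_inv_coords: "c \<in> A \<Longrightarrow> p \<in> chart_dom c \<Longrightarrow> chart_inv c (coords c p) = p"
  unfolding chart_inv_def using chart_facts(5) by (rule inv_into_f_f)

lemma chart_inv_region:
  assumes "x \<in> region c"
  shows "chart_inv c x \<in> chart_dom c" "coords c (chart_inv c x) = x"
  using assms unfolding chart_inv_def by (rule inv_into_into, rule f_inv_into_f)

lemma transition_coords:
  "c \<in> A \<Longrightarrow> p \<in> chart_dom c \<Longrightarrow> transition c d (coords c p) = coords d p"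
  by (simp add: transition_def chart_inv_coords)

lemma open_overlap:
  assumes "c \<in> A" "d \<in> A"
  shows "open (overlap c d)"
proof -
  have "openin (subtopology M (chart_dom c)) (chart_dom c \<inter> chart_dom d)"
    using chart_facts(1)[OF assms(2)] by (auto simp: openin_subtopology)
  then have "openin (top_of_set (region c)) (overlap c d)"
    using homeomorphic_imp_open_map[OF chart_facts(3)[OF assms(1)]] by (simp add: open_map_def)
  then show ?thesis using openin_open_trans chart_facts(2)[OF assms(1)] by blast
qed

lemma smooth_transition: "c \<in> A \<Longrightarrow> d \<in> A \<Longrightarrow> smooth_on (overlap c d) (transition c d)"
  using oriented_riemannian unfolding oriented_riemannian_surface_def oriented_surface_def by blast

lemma det_transition_pos:
  "c \<in> A \<Longrightarrow> d \<in> A \<Longrightarrow> x \<in> overlap c d \<Longrightarrow> det (matrix (frechet_derivative (transition c d) (at x))) > 0"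
  using oriented_riemannian unfolding oriented_riemannian_surface_def oriented_surface_def by blast

lemma transition_has_derivative:
  assumes "c \<in> A" "d \<in> A" "p \<in> chart_dom c" "p \<in> chart_dom d"
  shows "(transition c d has_derivative frechet_derivative (transition c d) (at (coords c p))) (at (coords c p))"
  using smooth_on_has_derivative[OF smooth_transition[OF assms(1,2)]] assms(3,4) by blast

lemmas transition_linear = has_derivative_linear[OF transition_has_derivative]

lemma transition_self:
  assumes "c \<in> A" "p \<in> chart_dom c"
  shows "dir_deriv (transition c c) (coords c p) u = u"
proof -
  have p: "coords c p \<in> region c" using assms by blast
  have "(transition c c has_derivative (\<lambda>u. u)) (at (coords c p))"
    by (rule has_derivative_transform_within_open[OF has_derivative_ident chart_facts(2)[OF assms(1)] p])
       (auto simp: transition_coords assms)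
  from frechet_derivative_at[OF this] show ?thesis by (rule fun_cong[OF sym])
qed

lemma transition_chain:
  assumes "c \<in> A" "d \<in> A" "e \<in> A" "p \<in> chart_dom c" "p \<in> chart_dom d" "p \<in> chart_dom e"
  shows "dir_deriv (transition d e) (coords d p) (dir_deriv (transition c d) (coords c p) u)
    = dir_deriv (transition c e) (coords c p) u"
proof -
  have "(transition d e has_derivative frechet_derivative (transition d e) (at (coords d p)))
      (at (transition c d (coords c p)))"
    using transition_has_derivative[OF assms(2,3,5,6)] by (simp add: transition_coords assms)
  from has_derivative_compose[OF transition_has_derivative[OF assms(1,2,4,5)] this]
  have 1: "((\<lambda>x. transition d e (transition c d x)) has_derivative (\<lambda>u. dir_deriv (transition d e) (coords d p)
      (dir_deriv (transition c d) (coords c p) u))) (at (coords c p))" .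
  have "open (overlap c d)" "coords c p \<in> overlap c d"
    using open_overlap assms by blast+
  from 1 this have "(transition c e has_derivative (\<lambda>u. dir_deriv (transition d e) (coords d p)
      (dir_deriv (transition c d) (coords c p) u))) (at (coords c p))"
    by (rule has_derivative_transform_within_open) (auto simp: transition_coords assms)
  from frechet_derivative_at[OF this] show ?thesis by (rule fun_cong)
qed

lemma tangent_transition:
  assumes "v \<in> tangent_space A p" "c \<in> A" "d \<in> A" "p \<in> chart_dom c" "p \<in> chart_dom d"
  shows "v d = dir_deriv (transition c d) (coords c p) (v c)"
  using assms unfolding tangent_space_def by blast

text \<open>This is the cocycle condition of the Jacobian matrices of the transition maps.\<close>

lemma tvec_of_tangent:
  assumes "c \<in> A" "p \<in> chart_dom c"
  shows "tvec_of A c p u \<in> tangent_space A p"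
  unfolding tangent_space_def
proof (intro CollectI conjI ballI allI impI)
  fix d e assume d: "d \<in> A" and e: "e \<in> A" and p: "p \<in> chart_dom d \<inter> chart_dom e"
  then show "tvec_of A c p u e = dir_deriv (transition d e) (coords d p) (tvec_of A c p u d)"
    using transition_chain[OF assms(1) d e assms(2), of u] by (simp add: tvec_of_def)
next
  fix d assume "\<not> (d \<in> A \<and> p \<in> chart_dom d)"
  then show "tvec_of A c p u d = 0" unfolding tvec_of_def by (rule if_not_P)
qed

lemma tvec_of_self: "c \<in> A \<Longrightarrow> p \<in> chart_dom c \<Longrightarrow> tvec_of A c p u c = u"
  by (simp add: tvec_of_def transition_self)

text \<open>A tangent vector is determined by its components in one chart, so that statements about tangent
vectors may be checked in any chart.\<close>

lemma tangent_eq_tvec_of: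
  assumes "c \<in> A" "p \<in> chart_dom c" "v \<in> tangent_space A p"
  shows "v = tvec_of A c p (v c)"
proof
  fix d
  show "v d = tvec_of A c p (v c) d"
  proof (cases "d \<in> A \<and> p \<in> chart_dom d")
    case True
    then show ?thesis using tangent_transition[OF assms(3,1) _ assms(2)] by (simp add: tvec_of_def)
  next
    case False
    then have "v d = 0" using assms(3) unfolding tangent_space_def by blast
    then show ?thesis unfolding tvec_of_def if_not_P[OF False] .
  qed
qed

lemma tvec_of_change:
  assumes "c \<in> A" "d \<in> A" "p \<in> chart_dom c" "p \<in> chart_dom d"
  shows "tvec_of A d p (dir_deriv (transition c d) (coords c p) u) = tvec_of A c p u"
  using tangent_eq_tvec_of[OF assms(2,4) tvec_of_tangent[OF assms(1,3)], of u] assms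
  by (simp add: tvec_of_def)

lemma tvec_of_combine:
  assumes "c \<in> A" "p \<in> chart_dom c"
  shows "tvec_of A c p (a *\<^sub>R u + b *\<^sub>R v) = (\<lambda>d. a *\<^sub>R tvec_of A c p u d + b *\<^sub>R tvec_of A c p v d)"
  using linear_add[OF transition_linear[OF assms(1) _ assms(2)]]
    linear_scale[OF transition_linear[OF assms(1) _ assms(2)]]
  by (auto simp: tvec_of_def fun_eq_iff)

lemma metric_facts:
  assumes "p \<in> topspace M" "u \<in> tangent_space A p" "v \<in> tangent_space A p" "w \<in> tangent_space A p"
  shows "g p u v = g p v u" "g p (\<lambda>c. a *\<^sub>R u c + b *\<^sub>R v c) w = a * g p u w + b * g p v w"
    "v \<noteq> (\<lambda>c. 0) \<Longrightarrow> g p v v > 0"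
  using oriented_riemannian assms
  unfolding oriented_riemannian_surface_def riemannian_metric_def by blast+

lemma chart_dom_topspace: "c \<in> A \<Longrightarrow> p \<in> chart_dom c \<Longrightarrow> p \<in> topspace M"
  using openin_subset[OF chart_facts(1)] by blast

lemma metric_matrix_nth: "metric_matrix A g c x $ i $ j = chart_metric c x (axis i 1) (axis j 1)"
  by (simp add: metric_matrix_def chart_metric_def Let_def)

lemma plane_metric_chart:
  assumes c: "c \<in> A"
  shows "plane_metric (region c) (chart_metric c)"
proof -
  have comb: "chart_metric c x (a *\<^sub>R u + b *\<^sub>R v) w = a * chart_metric c x u w + b * chart_metric c x v w"
    and sym: "chart_metric c x v w = chart_metric c x w v"
    and pos: "v \<noteq> 0 \<Longrightarrow> chart_metric c x v v > 0"
    if x: "x \<in> region c" for x a b u v w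
  proof -
    note p = chart_inv_region(1)[OF x]
    note t = chart_dom_topspace[OF c p] and v = tvec_of_tangent[OF c p]
    show "chart_metric c x (a *\<^sub>R u + b *\<^sub>R v) w = a * chart_metric c x u w + b * chart_metric c x v w"
      unfolding chart_metric_def tvec_of_combine[OF c p] by (rule metric_facts[OF t v v v])
    show "chart_metric c x v w = chart_metric c x w v"
      unfolding chart_metric_def by (rule metric_facts(1)[OF t v v v])
    show "chart_metric c x v v > 0" if "v \<noteq> 0"
    proof -
      have "tvec_of A c (chart_inv c x) v \<noteq> (\<lambda>c. 0)"
        using tvec_of_self[OF c p, of v] that by metis
      then show ?thesis unfolding chart_metric_def by (rule metric_facts(3)[OF t v v v])
    qed
  qed
  have lin: "linear (\<lambda>v. chart_metric c x v w)" if "x \<in> region c" for x w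
    using comb[OF that, of 1 _ 1] comb[OF that, of _ _ 0] by (intro linearI) simp_all
  have bil: "chart_metric c x v w = v $ 1 * w $ 1 * metric_matrix A g c x $ 1 $ 1
      + v $ 1 * w $ 2 * metric_matrix A g c x $ 1 $ 2 + v $ 2 * w $ 1 * metric_matrix A g c x $ 2 $ 1
      + v $ 2 * w $ 2 * metric_matrix A g c x $ 2 $ 2" if x: "x \<in> region c" for x v w
    using linear_vec2[OF lin[OF x, of w], of v] linear_vec2[OF lin[OF x, of "axis 1 1"], of w]
      linear_vec2[OF lin[OF x, of "axis 2 1"], of w] sym[OF x, of "axis 1 1" w] sym[OF x, of "axis 2 1" w]
      sym[OF x, of "axis 2 1" "axis 1 1"]
    by (simp add: metric_matrix_nth algebra_simps)
  have "smooth_on (region c) (\<lambda>x. metric_matrix A g c x $ i $ j)" for i j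
    using oriented_riemannian c unfolding oriented_riemannian_surface_def riemannian_metric_def by blast
  then have "smooth_on (region c) (\<lambda>x. v $ 1 * w $ 1 * metric_matrix A g c x $ 1 $ 1
      + v $ 1 * w $ 2 * metric_matrix A g c x $ 1 $ 2 + v $ 2 * w $ 1 * metric_matrix A g c x $ 2 $ 1
      + v $ 2 * w $ 2 * metric_matrix A g c x $ 2 $ 2)" for v w
    by (intro smooth_on_add smooth_on_mult smooth_on_const chart_facts(2) c)
  then have sm: "smooth_on (region c) (\<lambda>x. chart_metric c x v w)" for v w
    by (rule smooth_on_cong[OF chart_facts(2)[OF c], rotated]) (simp add: bil)
  show ?thesis
    by (rule plane_metric.intro[OF chart_facts(2)[OF c] lin sym pos sm])
qed

lemma metric_in_chart:
  assumes "c \<in> A" "p \<in> chart_dom c" "v \<in> tangent_space A p" "w \<in> tangent_space A p"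
  shows "g p v w = chart_metric c (coords c p) (v c) (w c)"
  using tangent_eq_tvec_of[OF assms(1-3)] tangent_eq_tvec_of[OF assms(1,2,4)]
  by (simp add: chart_metric_def chart_inv_coords assms)

lemma chart_metric_change:
  assumes "c \<in> A" "d \<in> A" "x \<in> overlap c d"
  shows "chart_metric c x v w
    = chart_metric d (transition c d x) (dir_deriv (transition c d) x v) (dir_deriv (transition c d) x w)"
proof -
  obtain p where p: "p \<in> chart_dom c" "p \<in> chart_dom d" "x = coords c p" using assms(3) by blast
  then show ?thesis
    by (simp add: chart_metric_def transition_coords chart_inv_coords assms tvec_of_change)
qed

text \<open>Multiplication by the matrix of the metric cancels the inverse matrix in the Christoffel symbols, and
\<open>second_kind_unique\<close> applies.\<close>

lemma christoffel_second_kind: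
  assumes c: "c \<in> A" and x: "x \<in> region c"
  shows "(\<chi> k. \<Sum>i\<in>UNIV. \<Sum>j\<in>UNIV. christoffel A g c x k i j * u $ i * v $ j)
    = plane_metric.second_kind (chart_metric c) x u v"
proof -
  interpret C: plane_metric "region c" "chart_metric c" by (rule plane_metric_chart[OF c])
  let ?m = "metric_matrix A g c x"
  define N where "N = matrix_inv ?m"
  have m: "?m $ i $ j = C.co i j x" for i j by (rule metric_matrix_nth)
  have sym: "C.co 2 1 x = C.co 1 2 x" by (rule C.symmetric[OF x])
  have "det ?m \<noteq> 0" using C.gram_pos[OF x] by (simp add: det_2 m sym C.gram_def)
  then have "invertible ?m" by (simp add: invertible_det_nz)
  then have "?m ** N = mat 1"
    unfolding N_def matrix_inv_def invertible_def by (rule someI2_ex) simp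
  then have N: "C.co i 1 x * N $ 1 $ l + C.co i 2 x * N $ 2 $ l = (if i = l then 1 else 0)" for i l
    by (simp add: vec_eq_iff matrix_matrix_mult_def mat_def sum_2 m)
  define P where "P l = C.first_kind x u v (axis l 1)" for l
  have fk: "P l = (\<Sum>i\<in>UNIV. \<Sum>j\<in>UNIV. C.first_kind x (axis i 1) (axis j 1) (axis l 1) * u $ i * v $ j)" for l
    unfolding P_def sum_2
    using linear_vec2[OF C.first_kind_linear(1)[OF x, of v "axis l 1"], of u]
      linear_vec2[OF C.first_kind_linear(2)[OF x, of "axis 1 1" "axis l 1"], of v]
      linear_vec2[OF C.first_kind_linear(2)[OF x, of "axis 2 1" "axis l 1"], of v]
    by (simp add: algebra_simps)
  have ch: "christoffel A g c x k i j = (\<Sum>l\<in>UNIV. N $ k $ l * C.first_kind x (axis i 1) (axis j 1) (axis l 1))"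
    for k i j
    unfolding christoffel_def N_def[symmetric] partial_deriv_def metric_matrix_nth sum_2
      C.first_kind_def C.metric_deriv_def by (simp add: field_simps)
  let ?z = "\<chi> k. \<Sum>i\<in>UNIV. \<Sum>j\<in>UNIV. christoffel A g c x k i j * u $ i * v $ j"
  have z: "?z $ k = N $ k $ 1 * P 1 + N $ k $ 2 * P 2" for k
    by (simp add: ch fk sum_2 algebra_simps)
  have Gz: "C.co i 1 x * ?z $ 1 + C.co i 2 x * ?z $ 2 = P i" for i
  proof -
    have "C.co i 1 x * ?z $ 1 + C.co i 2 x * ?z $ 2
      = (C.co i 1 x * N $ 1 $ 1 + C.co i 2 x * N $ 2 $ 1) * P 1
      + (C.co i 1 x * N $ 1 $ 2 + C.co i 2 x * N $ 2 $ 2) * P 2"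
      unfolding z by (simp add: algebra_simps)
    also have "\<dots> = P i" unfolding N using exhaust_2[of i] by auto
    finally show ?thesis .
  qed
  show ?thesis
  proof (rule C.second_kind_unique[OF x])
    fix w
    have "chart_metric c x ?z w = w $ 1 * P 1 + w $ 2 * P 2"
      unfolding C.expand[OF x, of ?z w] Gz[symmetric] sym by (simp add: algebra_simps)
    also have "\<dots> = C.first_kind x u v w"
      unfolding P_def using linear_vec2[OF C.first_kind_linear(3)[OF x], of u v w] by simp
    finally show "chart_metric c x ?z w = C.first_kind x u v w" .
  qed
qed

text \<open>Normalize a coordinate vector and rotate it by a positive right angle. The frame is positive in the
other charts because the Jacobian determinants of the transition maps are positive.\<close>

lemma positive_frame_exists:
  assumes c: "c \<in> A" and p: "p \<in> chart_dom c"
  shows "\<exists>e. positive_orthonormal_frame A g p e"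
proof -
  interpret C: plane_metric "region c" "chart_metric c" by (rule plane_metric_chart[OF c])
  let ?x = "coords c p"
  have x: "?x \<in> region c" using p by blast
  define u :: "real^2" where "u = (1 / sqrt (C.co 1 1 ?x)) *\<^sub>R axis 1 (1::real)"
  define v where "v = C.rot ?x u"
  have u1: "chart_metric c ?x u u = 1"
    unfolding u_def using C.co11_pos[OF x] by (simp add: C.scale_both[OF x])
  have "u \<noteq> 0" using u1 C.positive_iff[OF x, of u] by simp
  then have v1: "chart_metric c ?x v v = 1" by (simp add: v_def C.rot_isometric[OF x] u1)
  have uv: "chart_metric c ?x u v = 0"
    by (simp add: v_def C.symmetric[OF x, of u] C.rot_orthogonal[OF x])
  have "C.area ?x u v = 1" by (simp add: v_def C.area_rot[OF x] u1)
  then have cr: "cross2 u v > 0"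
    using C.gram_pos[OF x] by (simp add: C.area_def) (metis zero_less_mult_pos zero_less_one
        real_sqrt_gt_zero)
  let ?u = "tvec_of A c p u" and ?v = "tvec_of A c p v"
  have t: "?u \<in> tangent_space A p" "?v \<in> tangent_space A p" by (rule tvec_of_tangent[OF c p])+
  have "?u d $ 1 * ?v d $ 2 - ?u d $ 2 * ?v d $ 1 > 0" if d: "d \<in> A" "p \<in> chart_dom d" for d
  proof -
    have "cross2 (?u d) (?v d) = det (matrix (frechet_derivative (transition c d) (at ?x))) * cross2 u v"
      using d cross2_linear_image[OF transition_linear[OF c d(1) p d(2)], of u v]
      by (simp add: tvec_of_def)
    also have "\<dots> > 0"
      using det_transition_pos[OF c d(1), of ?x] p d(2) cr by auto
    finally show ?thesis by (simp add: cross2_def)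
  qed
  then have "positive_orthonormal_frame A g p (?u, ?v)"
    unfolding positive_orthonormal_frame_def using t
    by (simp add: metric_in_chart[OF c p] tvec_of_self[OF c p] u1 v1 uv)
  then show ?thesis by blast
qed

text \<open>The definition chooses an unspecified frame. By \<open>area_times_area\<close> its formula is the area in the chart
times the area of the frame, and the same identity shows that the latter is \<open>1\<close>.\<close>

lemma area_element_in_chart:
  assumes c: "c \<in> A" and p: "p \<in> chart_dom c" and v: "v \<in> tangent_space A p" and w: "w \<in> tangent_space A p"
  shows "area_element A g p v w = plane_metric.area (chart_metric c) (coords c p) (v c) (w c)"
proof -
  interpret C: plane_metric "region c" "chart_metric c" by (rule plane_metric_chart[OF c])
  let ?x = "coords c p"
  have x: "?x \<in> region c" using p by blast
  obtain e1 e2 where e: "(SOME e. positive_orthonormal_frame A g p e) = (e1, e2)" by fastforce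
  then have "positive_orthonormal_frame A g p (e1, e2)"
    using someI_ex[OF positive_frame_exists[OF c p]] by simp
  then have t: "e1 \<in> tangent_space A p" "e2 \<in> tangent_space A p"
    and on: "g p e1 e1 = 1" "g p e2 e2 = 1" "g p e1 e2 = 0" and cr: "cross2 (e1 c) (e2 c) > 0"
    using c p by (auto simp: positive_orthonormal_frame_def cross2_def)
  note m = metric_in_chart[OF c p]
  have "C.area ?x (e1 c) (e2 c) * C.area ?x (e1 c) (e2 c) = 1"
    unfolding C.area_times_area[OF x] using on t
    by (simp add: m C.symmetric[OF x, of "e2 c" "e1 c"])
  moreover have "C.area ?x (e1 c) (e2 c) > 0"
    using cr C.gram_pos[OF x] by (simp add: C.area_def)
  ultimately have 1: "C.area ?x (e1 c) (e2 c) = 1"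
    by (metis abs_of_pos abs_square_eq_1 power2_eq_square)
  show ?thesis
    using C.area_times_area[OF x, of "v c" "w c" "e1 c" "e2 c"] t v w
    by (simp add: area_element_def e 1 m)
qed

lemma tnorm_in_chart:
  assumes "c \<in> A" "p \<in> chart_dom c" "v \<in> tangent_space A p"
  shows "tnorm g p v = plane_metric.len (chart_metric c) (coords c p) (v c)"
  using metric_in_chart[OF assms(1,2,3,3)] plane_metric.len_def[OF plane_metric_chart[OF assms(1)]]
  by (simp add: tnorm_def)

section \<open>Covariant derivatives along a curve\<close>

definition smooth_field :: "real set \<Rightarrow> (real \<Rightarrow> 'p) \<Rightarrow> (real \<Rightarrow> 'p tvec) \<Rightarrow> bool" where
  "smooth_field I \<gamma> X \<longleftrightarrow> (\<forall>t\<in>I. X t \<in> tangent_space A (\<gamma> t)) \<and>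
     (\<forall>c\<in>A. smooth_on {t\<in>I. \<gamma> t \<in> chart_dom c} (\<lambda>t. X t c))"

lemma open_chart_time:
  assumes "continuous_map (top_of_set I) M \<gamma>" "open I" "c \<in> A"
  shows "open {t\<in>I. \<gamma> t \<in> chart_dom c}"
proof -
  have "openin (top_of_set I) {t \<in> topspace (top_of_set I). \<gamma> t \<in> chart_dom c}"
    using assms(1) chart_facts(1)[OF assms(3)] by (rule openin_continuous_map_preimage)
  then show ?thesis using assms(2) by (auto intro: openin_open_trans)
qed

context
  fixes I :: "real set" and \<gamma> :: "real \<Rightarrow> 'p"
  assumes curve: "smooth_curve M A I \<gamma>" and open_I: "open I"
begin

lemma open_time: "c \<in> A \<Longrightarrow> open {t\<in>I. \<gamma> t \<in> chart_dom c}"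
  using curve open_I open_chart_time unfolding smooth_curve_def by blast

lemma smooth_coords: "c \<in> A \<Longrightarrow> smooth_on {t\<in>I. \<gamma> t \<in> chart_dom c} (coords c \<circ> \<gamma>)"
  using curve unfolding smooth_curve_def by blast

lemma coords_has_derivative:
  assumes "c \<in> A" "t \<in> I" "\<gamma> t \<in> chart_dom c"
  shows "(coords c \<circ> \<gamma> has_vector_derivative velocity A \<gamma> t c) (at t)"
  using smooth_on_has_vector_derivative[OF smooth_coords[OF assms(1)], of t] assms
  by (simp add: velocity_def)

lemma both_charts:
  assumes "c \<in> A" "d \<in> A" "t \<in> I" "\<gamma> t \<in> chart_dom c" "\<gamma> t \<in> chart_dom d"
  shows "open {t\<in>I. \<gamma> t \<in> chart_dom c \<inter> chart_dom d}" "t \<in> {t\<in>I. \<gamma> t \<in> chart_dom c \<inter> chart_dom d}"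
proof -
  have e: "{t\<in>I. \<gamma> t \<in> chart_dom c \<inter> chart_dom d} = {t\<in>I. \<gamma> t \<in> chart_dom c} \<inter> {t\<in>I. \<gamma> t \<in> chart_dom d}"
    by blast
  show "open {t\<in>I. \<gamma> t \<in> chart_dom c \<inter> chart_dom d}"
    unfolding e by (rule open_Int[OF open_time[OF assms(1)] open_time[OF assms(2)]])
qed (use assms in simp)

lemma smooth_field_velocity: "smooth_field I \<gamma> (velocity A \<gamma>)"
  unfolding smooth_field_def
proof (intro conjI ballI)
  fix c assume c: "c \<in> A"
  show "smooth_on {t\<in>I. \<gamma> t \<in> chart_dom c} (\<lambda>t. velocity A \<gamma> t c)"
    by (rule smooth_on_cong[OF open_time[OF c] _
        smooth_on_vector_derivative[OF open_time[OF c] smooth_coords[OF c]]])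
       (simp add: velocity_def c)
next
  fix t assume t: "t \<in> I"
  show "velocity A \<gamma> t \<in> tangent_space A (\<gamma> t)"
    unfolding tangent_space_def
  proof (intro CollectI conjI ballI allI impI)
    fix c d assume cd: "c \<in> A" "d \<in> A" "\<gamma> t \<in> chart_dom c \<inter> chart_dom d"
    then have p: "\<gamma> t \<in> chart_dom c" "\<gamma> t \<in> chart_dom d" by auto
    have D: "(transition c d has_derivative frechet_derivative (transition c d) (at (coords c (\<gamma> t))))
        (at ((coords c \<circ> \<gamma>) t))"
      using transition_has_derivative[OF cd(1,2) p] by simp
    have "((\<lambda>s. transition c d ((coords c \<circ> \<gamma>) s)) has_vector_derivative
        dir_deriv (transition c d) (coords c (\<gamma> t)) (velocity A \<gamma> t c)) (at t)"
      using has_derivative_compose[OF coords_has_derivative[OF cd(1) t p(1), unfolded has_vector_derivative_def] D]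
        linear_scale[OF has_derivative_linear[OF D]] by (simp add: has_vector_derivative_def)
    then have "(coords d \<circ> \<gamma> has_vector_derivative
        dir_deriv (transition c d) (coords c (\<gamma> t)) (velocity A \<gamma> t c)) (at t)"
      by (rule has_vector_derivative_transform_within_open[OF _ both_charts[OF cd(1,2) t p]])
         (simp add: transition_coords cd)
    then show "velocity A \<gamma> t d = dir_deriv (transition c d) (coords c (\<gamma> t)) (velocity A \<gamma> t c)"
      using coords_has_derivative[OF cd(2) t p(2)] by (metis vector_derivative_unique_at)
  qed (unfold velocity_def, rule if_not_P)
qed

lemma covariant_deriv_in_chart:
  assumes "c \<in> A" "t \<in> I" "\<gamma> t \<in> chart_dom c"
  shows "covariant_deriv A g \<gamma> X t c = plane_metric.cov_deriv (chart_metric c) (coords c \<circ> \<gamma>) (\<lambda>s. X s c) t"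
  using assms christoffel_second_kind[OF assms(1), of "coords c (\<gamma> t)"]
  by (simp add: covariant_deriv_def plane_metric.cov_deriv_def[OF plane_metric_chart[OF assms(1)]]
      vel_def velocity_def o_def)

text \<open>The second derivatives of the transition map enter twice: when its Jacobian matrix is differentiated
along the curve, and through the Christoffel symbols (\<open>christoffel_change_of_coordinates\<close>). The two
contributions cancel.\<close>

lemma smooth_field_covariant_deriv:
  assumes X: "smooth_field I \<gamma> X"
  shows "smooth_field I \<gamma> (covariant_deriv A g \<gamma> X)"
  unfolding smooth_field_def
proof (intro conjI ballI)
  have Xs: "smooth_on {t\<in>I. \<gamma> t \<in> chart_dom c} (\<lambda>t. X t c)" if "c \<in> A" for c
    using X that by (simp add: smooth_field_def)
  have Xt: "X t \<in> tangent_space A (\<gamma> t)" if "t \<in> I" for t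
    using X that by (simp add: smooth_field_def)
  {
    fix c assume c: "c \<in> A"
    interpret C: plane_metric "region c" "chart_metric c" by (rule plane_metric_chart[OF c])
    have "smooth_on {t\<in>I. \<gamma> t \<in> chart_dom c} (C.cov_deriv (coords c \<circ> \<gamma>) (\<lambda>s. X s c))"
      by (rule C.smooth_on_cov_deriv[OF open_time[OF c] _ smooth_coords[OF c] Xs[OF c]]) auto
    then show "smooth_on {t\<in>I. \<gamma> t \<in> chart_dom c} (\<lambda>t. covariant_deriv A g \<gamma> X t c)"
      by (rule smooth_on_cong[OF open_time[OF c], rotated]) (simp add: covariant_deriv_in_chart c)
  }
  fix t assume t: "t \<in> I"
  show "covariant_deriv A g \<gamma> X t \<in> tangent_space A (\<gamma> t)"
    unfolding tangent_space_def
  proof (intro CollectI conjI ballI allI impI)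
    fix c d assume cd: "c \<in> A" "d \<in> A" "\<gamma> t \<in> chart_dom c \<inter> chart_dom d"
    then have p: "\<gamma> t \<in> chart_dom c" "\<gamma> t \<in> chart_dom d" by auto
    interpret C: plane_metric "region c" "chart_metric c" by (rule plane_metric_chart[OF cd(1)])
    interpret D: plane_metric "region d" "chart_metric d" by (rule plane_metric_chart[OF cd(2)])
    let ?\<phi> = "transition c d" and ?x = "coords c \<circ> \<gamma>" and ?W = "overlap c d"
    let ?T = "frechet_derivative ?\<phi> (at (?x t))"
    let ?x' = "velocity A \<gamma> t c" and ?X' = "vector_derivative (\<lambda>s. X s c) (at t)"
    have W: "open ?W" "?W \<subseteq> region c" "?\<phi> ` ?W \<subseteq> region d" "smooth_on ?W ?\<phi>" "?x t \<in> ?W"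
      using open_overlap[OF cd(1,2)] smooth_transition[OF cd(1,2)] p
      by (auto simp: transition_coords cd)
    have lin: "linear ?T" using transition_linear[OF cd(1,2) p] by simp
    have vd: "velocity A \<gamma> t d = ?T ?x'" and Xd: "X t d = ?T (X t c)"
      using tangent_transition[OF _ cd(1,2) p] smooth_field_velocity Xt t
      by (simp_all add: smooth_field_def)
    have "((\<lambda>s. dir_deriv ?\<phi> (?x s) (X s c)) has_vector_derivative
        ?T ?X' + dir_deriv (\<lambda>y. dir_deriv ?\<phi> y (X t c)) (?x t) ?x') (at t)"
      by (rule has_vector_derivative_pushforward[OF W(1,4,5) coords_has_derivative[OF cd(1) t p(1)]
          smooth_on_has_vector_derivative[OF Xs[OF cd(1)]]]) (use t p in simp)
    then have "((\<lambda>s. X s d) has_vector_derivative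
        ?T ?X' + dir_deriv (\<lambda>y. dir_deriv ?\<phi> y (X t c)) (?x t) ?x') (at t)"
      by (rule has_vector_derivative_transform_within_open[OF _ both_charts[OF cd(1,2) t p]])
         (use tangent_transition[OF Xt cd(1,2)] in auto)
    then have Xd': "vector_derivative (\<lambda>s. X s d) (at t) = ?T ?X' + dir_deriv (\<lambda>y. dir_deriv ?\<phi> y (X t c)) (?x t) ?x'"
      by (rule vector_derivative_at)
    have "surj ?T"
    proof (rule surjI)
      show "?T (dir_deriv (transition d c) (coords d (\<gamma> t)) u) = u" for u
        using transition_chain[OF cd(2,1,2) p(2,1,2), of u] transition_self[OF cd(2) p(2)] by simp
    qed
    from christoffel_change_of_coordinates[OF C.plane_metric_axioms D.plane_metric_axioms W
        chart_metric_change[OF cd(1,2)] this, of ?x' "X t c"]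
    have "?T (C.second_kind (?x t) ?x' (X t c))
      = D.second_kind (coords d (\<gamma> t)) (?T ?x') (?T (X t c)) + dir_deriv (\<lambda>y. dir_deriv ?\<phi> y (X t c)) (?x t) ?x'"
      by (simp add: transition_coords cd p)
    then show "covariant_deriv A g \<gamma> X t d = dir_deriv ?\<phi> (coords c (\<gamma> t)) (covariant_deriv A g \<gamma> X t c)"
      using cd(1,2) p
      by (simp add: covariant_deriv_def christoffel_second_kind Xd' linear_add[OF lin, simplified] vd Xd)
  qed (unfold covariant_deriv_def, rule if_not_P)
qed

lemma smooth_field_tangent: "smooth_field I \<gamma> X \<Longrightarrow> t \<in> I \<Longrightarrow> X t \<in> tangent_space A (\<gamma> t)"
  by (simp add: smooth_field_def)

lemma smooth_field_acceleration: "smooth_field I \<gamma> (acceleration A g \<gamma>)"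
  unfolding acceleration_def by (rule smooth_field_covariant_deriv[OF smooth_field_velocity])

lemma smooth_field_third_deriv: "smooth_field I \<gamma> (third_deriv A g \<gamma>)"
  unfolding third_deriv_def by (rule smooth_field_covariant_deriv[OF smooth_field_acceleration])

text \<open>The coordinate expressions depend on the curve only near the given time; so \<open>x\<close> is any function that
represents the curve on an open set of times.\<close>

lemma curve_in_chart:
  assumes c: "c \<in> A" and J: "open J" "J \<subseteq> I" "\<And>t. t \<in> J \<Longrightarrow> \<gamma> t \<in> chart_dom c"
    and x: "\<And>t. t \<in> J \<Longrightarrow> coords c (\<gamma> t) = x t" and t: "t \<in> J"
  shows "velocity A \<gamma> t c = vel x t"
    "acceleration A g \<gamma> t c = plane_metric.cov_deriv (chart_metric c) x (vel x) t"
    "third_deriv A g \<gamma> t c = plane_metric.cov_deriv (chart_metric c) x (plane_metric.cov_deriv (chart_metric c) x (vel x)) t"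
proof -
  interpret C: plane_metric "region c" "chart_metric c" by (rule plane_metric_chart[OF c])
  have v: "vel (coords c \<circ> \<gamma>) s = vel x s" if "s \<in> J" for s
    unfolding vel_def by (rule vector_derivative_cong_open[OF J(1) that]) (simp add: x)
  have cov_deriv: "C.cov_deriv (coords c \<circ> \<gamma>) X s = C.cov_deriv x Y s" if "s \<in> J" "\<And>s. s \<in> J \<Longrightarrow> X s = Y s" for X Y s
    using vector_derivative_cong_open[OF J(1) that] that by (simp add: C.cov_deriv_def v x)
  have 1: "velocity A \<gamma> s c = vel x s" if "s \<in> J" for s
    using v[OF that] c J(3)[OF that] by (simp add: velocity_def vel_def)
  have 2: "acceleration A g \<gamma> s c = C.cov_deriv x (vel x) s" if "s \<in> J" for s
    using J that cov_deriv[OF that 1] by (simp add: acceleration_def covariant_deriv_in_chart[OF c] subset_iff)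
  show "velocity A \<gamma> t c = vel x t" "acceleration A g \<gamma> t c = C.cov_deriv x (vel x) t" using 1 2 t by auto
  show "third_deriv A g \<gamma> t c = C.cov_deriv x (C.cov_deriv x (vel x)) t"
    using J t cov_deriv[OF t 2] by (simp add: third_deriv_def covariant_deriv_in_chart[OF c] subset_iff)
qed

end

end

section \<open>The half-arclength parameter\<close>

text \<open>A smooth function with positive derivative at \<open>0\<close> is a coordinate there. It suffices that \<open>h\<close> agrees
with such a function near \<open>0\<close>, since the image, the inverse and smoothness only depend on the values there.\<close>

lemma smooth_coordinate_neighbourhood:
  fixes h \<eta> :: "real \<Rightarrow> real"
  assumes "d > 0" and \<eta>: "smooth_on {-d<..<d} \<eta>" "vector_derivative \<eta> (at 0) > 0"
    and h: "\<And>t. t \<in> {-d<..<d} \<Longrightarrow> h t = \<eta> t"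
  obtains \<epsilon> where "0 < \<epsilon>" "\<epsilon> \<le> d" "inj_on h {-\<epsilon><..<\<epsilon>}" "open (h ` {-\<epsilon><..<\<epsilon>})"
    "smooth_on {-\<epsilon><..<\<epsilon>} h" "smooth_on (h ` {-\<epsilon><..<\<epsilon>}) (inv_into {-\<epsilon><..<\<epsilon>} h)"
proof -
  have cont: "continuous_on {-d<..<d} (\<lambda>t. vector_derivative \<eta> (at t))"
    by (intro smooth_on_continuous_on smooth_on_vector_derivative \<eta>(1) open_greaterThanLessThan)
  obtain \<epsilon> where \<epsilon>: "0 < \<epsilon>" "\<epsilon> \<le> d" "\<And>t. t \<in> {-\<epsilon><..<\<epsilon>} \<Longrightarrow> vector_derivative \<eta> (at t) > 0"
    by (rule continuous_on_interval_pos[OF cont assms(1) \<eta>(2)]) blast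
  let ?I = "{-\<epsilon><..<\<epsilon>}"
  have h': "\<eta> t = h t" if "t \<in> ?I" for t using h[of t] that \<epsilon>(2) by simp
  have \<eta>I: "smooth_on ?I \<eta>" using \<epsilon>(2) by (intro smooth_on_subset[OF \<eta>(1)]) auto
  note inv = smooth_inverse_real[OF \<eta>I \<epsilon>(3)]
  have im: "h ` ?I = \<eta> ` ?I" by (rule image_cong) (simp_all add: h')
  have "inv_into ?I h = inv_into ?I \<eta>"
    unfolding inv_into_def by (intro ext arg_cong[where f=Eps]) (use h' in auto)
  moreover have "inj_on h ?I" using inj_on_cong[of ?I \<eta> h] h' inv(1) by blast
  moreover have "smooth_on ?I h" by (rule smooth_on_cong[OF _ h' \<eta>I]) simp
  ultimately show ?thesis using that[OF \<epsilon>(1,2)] inv(2,3) im by simp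
qed

text \<open>In the coordinate \<open>h\<close> the function \<open>\<psi>\<close> becomes \<open>\<psi> \<circ> h\<^sup>-\<^sup>1\<close>, which is smooth on a neighbourhood of \<open>h 0 = 0\<close>.\<close>

lemma smooth_function_of_coordinate:
  fixes h k \<psi> :: "real \<Rightarrow> real"
  assumes "d > 0" and \<psi>: "smooth_on {-d<..<d} \<psi>" and k: "\<And>t. t \<in> {-d<..<d} \<Longrightarrow> t \<noteq> 0 \<Longrightarrow> k t = \<psi> t"
    and \<epsilon>: "0 < \<epsilon>" "\<epsilon> \<le> d" "inj_on h {-\<epsilon><..<\<epsilon>}" "open (h ` {-\<epsilon><..<\<epsilon>})"
      "smooth_on (h ` {-\<epsilon><..<\<epsilon>}) (inv_into {-\<epsilon><..<\<epsilon>} h)"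
    and h0: "h 0 = 0"
  shows "smooth_function_at_0_of h k"
proof -
  let ?I = "{-\<epsilon><..<\<epsilon>}"
  let ?g = "inv_into ?I h"
  have "0 \<in> h ` ?I" using \<epsilon>(1) h0 by (intro image_eqI[of _ _ 0]) auto
  then obtain r where r: "r > 0" "ball 0 r \<subseteq> h ` ?I" using \<epsilon>(4) openE by blast
  have sub: "{-r<..<r} \<subseteq> h ` ?I" using r(2) by (auto simp: ball_eq_greaterThanLessThan)
  have "smooth_on (h ` ?I) (\<lambda>y. \<psi> (?g y))"
  proof (rule smooth_on_compose[OF \<epsilon>(4) _ _ \<psi> \<epsilon>(5)])
    show "?g ` h ` ?I \<subseteq> {-d<..<d}"
      using \<epsilon>(2) inv_into_into[of _ h ?I] by fastforce
  qed simp
  then have F: "smooth_on {-r<..<r} (\<lambda>y. \<psi> (?g y))" using sub by (rule smooth_on_subset)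
  have "\<forall>\<^sub>F t in at 0. t \<in> ?I" using \<epsilon>(1) by (intro eventually_at_in_open') auto
  moreover have "\<forall>\<^sub>F t in at (0::real). t \<noteq> 0" by (rule eventually_neq_at_within)
  ultimately have "\<forall>\<^sub>F t in at 0. k t = \<psi> (?g (h t))"
    by eventually_elim (use k \<epsilon>(2) in \<open>simp add: inv_into_f_f[OF \<epsilon>(3)]\<close>)
  then show ?thesis unfolding smooth_function_at_0_of_def using r(1) F by blast
qed

context riemannian_surface
begin

lemma arclength_in_chart:
  assumes "smooth_curve M A I \<gamma>" "open I" "c \<in> A" and J: "{-d<..<d} \<subseteq> I"
    and \<gamma>: "\<And>t. t \<in> {-d<..<d} \<Longrightarrow> \<gamma> t \<in> chart_dom c" "\<And>t. t \<in> {-d<..<d} \<Longrightarrow> coords c (\<gamma> t) = x t"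
    and t: "t \<in> {-d<..<d}"
  shows "arclength A g \<gamma> t = (LBINT u=ereal 0..ereal t. plane_metric.len (chart_metric c) (x u) (vel x u))"
  unfolding arclength_def
proof (rule interval_integral_cong)
  fix u assume "u \<in> einterval (min (ereal 0) (ereal t)) (max (ereal 0) (ereal t))"
  then have u: "u \<in> {-d<..<d}"
    using t by (auto simp: einterval_def min_def max_def split: if_splits)
  show "tnorm g (\<gamma> u) (velocity A \<gamma> u) = plane_metric.len (chart_metric c) (x u) (vel x u)"
    using tnorm_in_chart[OF assms(3) \<gamma>(1)[OF u]
        smooth_field_tangent[OF assms(1,2) smooth_field_velocity[OF assms(1,2)]]]
      curve_in_chart(1)[OF assms(1-3) _ J \<gamma> u] \<gamma>(2)[OF u] u J
    by (simp add: subset_iff)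
qed

text \<open>The local form of a cusp in a chart around \<open>\<gamma> 0\<close>, translated back to the surface.\<close>

lemma cusp_normal_form:
  assumes "0 < \<delta>" "smooth_curve M A {-\<delta><..<\<delta>} \<gamma>" "cusp_at_0 A g \<gamma>"
  obtains d h m where "0 < d" "smooth_on {-d<..<d} h" "smooth_on {-d<..<d} m"
    "\<And>t. t \<in> {-d<..<d} \<Longrightarrow> h t > 0"
    "\<And>t. t \<in> {-d<..<d} \<Longrightarrow> arclength A g \<gamma> t = t * \<bar>t\<bar> * h t"
    "\<And>t. t \<in> {-d<..<d} \<Longrightarrow> t \<noteq> 0 \<Longrightarrow> geodesic_curvature A g \<gamma> t = m t / \<bar>t\<bar>"
    "sqrt (h 0) * m 0 = cuspidal_curvature A g \<gamma> / (2 * sqrt 2)"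
proof -
  let ?J = "{-\<delta><..<\<delta>}"
  have J: "open ?J" "0 \<in> ?J" using assms(1) by auto
  note curve = assms(2) J(1)
  have "\<gamma> 0 \<in> topspace M"
    using assms(2) J(2) unfolding smooth_curve_def by (auto simp: continuous_map_def)
  then obtain c where c: "c \<in> A" "\<gamma> 0 \<in> chart_dom c"
    using oriented_riemannian unfolding oriented_riemannian_surface_def oriented_surface_def by blast
  interpret C: plane_metric "region c" "chart_metric c" by (rule plane_metric_chart[OF c(1)])
  define x where "x = coords c \<circ> \<gamma>"
  have "open {t\<in>?J. \<gamma> t \<in> chart_dom c}" by (rule open_time[OF curve c(1)])
  then obtain e where e: "e > 0" "ball 0 e \<subseteq> {t\<in>?J. \<gamma> t \<in> chart_dom c}"
    using c(2) J(2) openE by blast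
  let ?I = "{-e<..<e}"
  have I: "?I \<subseteq> {t\<in>?J. \<gamma> t \<in> chart_dom c}"
    using e(2) by (simp add: ball_eq_greaterThanLessThan)
  have IJ: "?I \<subseteq> ?J" and dom: "\<And>t. t \<in> ?I \<Longrightarrow> \<gamma> t \<in> chart_dom c" using I by blast+
  have x: "smooth_on ?I x" unfolding x_def by (rule smooth_on_subset[OF smooth_coords[OF curve c(1)] I])
  have xU: "x ` ?I \<subseteq> region c" unfolding x_def using dom by auto
  have I0: "0 \<in> ?I" using e by simp
  have vel: "velocity A \<gamma> t c = vel x t" and acc: "acceleration A g \<gamma> t c = C.cov_deriv x (vel x) t"
    and third: "third_deriv A g \<gamma> t c = C.cov_deriv x (C.cov_deriv x (vel x)) t" if "t \<in> ?I" for t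
    by (rule curve_in_chart[OF curve c(1) open_greaterThanLessThan IJ dom _ that]; simp add: x_def)+
  note tan = smooth_field_tangent[OF curve smooth_field_velocity[OF curve]]
    smooth_field_tangent[OF curve smooth_field_acceleration[OF curve]]
    smooth_field_tangent[OF curve smooth_field_third_deriv[OF curve]]
  have v0: "vel x 0 = 0" using vel[OF I0] assms(3) by (simp add: cusp_at_0_def)
  have area0: "area_element A g (\<gamma> 0) (acceleration A g \<gamma> 0) (third_deriv A g \<gamma> 0)
      = C.area (x 0) (C.cov_deriv x (vel x) 0) (C.cov_deriv x (C.cov_deriv x (vel x)) 0)"
    using area_element_in_chart[OF c tan(2,3)[OF J(2)]] acc[OF I0] third[OF I0] by (simp add: x_def)
  have len0: "tnorm g (\<gamma> 0) (acceleration A g \<gamma> 0) = C.len (x 0) (C.cov_deriv x (vel x) 0)"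
    using tnorm_in_chart[OF c tan(2)[OF J(2)]] acc[OF I0] by (simp add: x_def)
  have "C.area (x 0) (C.cov_deriv x (vel x) 0) (C.cov_deriv x (C.cov_deriv x (vel x)) 0) \<noteq> 0"
    using assms(3) area0 by (simp add: cusp_at_0_def)
  then obtain d h m where d: "0 < d" "d \<le> e" "smooth_on {-d<..<d} h" "smooth_on {-d<..<d} m"
    and h: "\<And>t. t \<in> {-d<..<d} \<Longrightarrow> h t > 0"
    and s: "\<And>t. t \<in> {-d<..<d} \<Longrightarrow> (LBINT u=ereal 0..ereal t. C.len (x u) (vel x u)) = t * \<bar>t\<bar> * h t"
    and \<kappa>: "\<And>t. t \<in> {-d<..<d} \<Longrightarrow> t \<noteq> 0 \<Longrightarrow>
      C.area (x t) (vel x t) (C.cov_deriv x (vel x) t) / C.len (x t) (vel x t) ^ 3 = m t / \<bar>t\<bar>"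
    and \<mu>: "sqrt (h 0) * m 0 = C.area (x 0) (C.cov_deriv x (vel x) 0) (C.cov_deriv x (C.cov_deriv x (vel x)) 0)
      / C.len (x 0) (C.cov_deriv x (vel x) 0) powr (5/2) / (2 * sqrt 2)"
    using C.cusp_local_form[OF e(1) x xU v0] by blast
  show ?thesis
  proof (rule that[OF d(1,3,4) h])
    fix t assume t: "t \<in> {-d<..<d}"
    then have tI: "t \<in> ?I" using d(2) by auto
    with IJ have tJ: "t \<in> ?J" by blast
    show "arclength A g \<gamma> t = t * \<bar>t\<bar> * h t"
      using arclength_in_chart[OF curve c(1) IJ dom _ tI, of x] s[OF t] by (simp add: x_def)
    show "geodesic_curvature A g \<gamma> t = m t / \<bar>t\<bar>" if "t \<noteq> 0"
      using \<kappa>[OF t that] area_element_in_chart[OF c(1) dom[OF tI] tan(1,2)[OF tJ]]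
        tnorm_in_chart[OF c(1) dom[OF tI] tan(1)[OF tJ]] vel[OF tI] acc[OF tI]
      by (simp add: geodesic_curvature_def x_def)
  qed (simp_all add: \<mu> cuspidal_curvature_def area0 len0)
qed

lemma sqrt_abs_mult_abs: "h > 0 \<Longrightarrow> sqrt \<bar>t * \<bar>t\<bar> * h\<bar> = \<bar>t\<bar> * sqrt h" for h t :: real
  by (simp add: abs_mult real_sqrt_mult)

text \<open>With \<open>s = t \<bar>t\<bar> h\<close> and \<open>\<kappa> = m / \<bar>t\<bar>\<close>, the half-arclength is the smooth function \<open>\<eta> = t sqrt h\<close> with
derivative \<open>sqrt (h 0)\<close> at \<open>0\<close>, and \<open>sqrt \<bar>s\<bar> \<kappa>\<close> extends to the smooth function \<open>\<psi> = sqrt h m\<close>.\<close>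

lemma curvature_at_cusp:
  assumes "0 < \<delta>" "smooth_curve M A {-\<delta><..<\<delta>} \<gamma>" "cusp_at_0 A g \<gamma>"
  defines "k \<equiv> \<lambda>t. sqrt \<bar>arclength A g \<gamma> t\<bar> * geodesic_curvature A g \<gamma> t"
  shows "smooth_coordinate_at_0 (half_arclength A g \<gamma>)" "smooth_function_at_0_of (\<lambda>t. t) k"
    "smooth_function_at_0_of (half_arclength A g \<gamma>) k"
    "(k \<longlongrightarrow> cuspidal_curvature A g \<gamma> / (2 * sqrt 2)) (at 0)"
proof -
  obtain d h m where d: "0 < d" and h: "smooth_on {-d<..<d} h" and m: "smooth_on {-d<..<d} m"
    and hpos: "\<And>t. t \<in> {-d<..<d} \<Longrightarrow> h t > 0"
    and s: "\<And>t. t \<in> {-d<..<d} \<Longrightarrow> arclength A g \<gamma> t = t * \<bar>t\<bar> * h t"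
    and \<kappa>: "\<And>t. t \<in> {-d<..<d} \<Longrightarrow> t \<noteq> 0 \<Longrightarrow> geodesic_curvature A g \<gamma> t = m t / \<bar>t\<bar>"
    and \<mu>: "sqrt (h 0) * m 0 = cuspidal_curvature A g \<gamma> / (2 * sqrt 2)"
    using cusp_normal_form[OF assms(1-3)] by blast
  let ?I = "{-d<..<d}" and ?half = "half_arclength A g \<gamma>"
  have I0: "0 \<in> ?I" using d by simp
  have sq: "smooth_on ?I (\<lambda>t. sqrt (h t))"
    by (intro smooth_on_sqrt h hpos open_greaterThanLessThan)
  define \<eta> where "\<eta> t = t * sqrt (h t)" for t
  define \<psi> where "\<psi> t = sqrt (h t) * m t" for t
  have \<eta>: "smooth_on ?I \<eta>" and \<psi>: "smooth_on ?I \<psi>"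
    unfolding \<eta>_def \<psi>_def by (intro smooth_on_mult smooth_on_ident sq m open_greaterThanLessThan)+
  have half: "?half t = \<eta> t" if "t \<in> ?I" for t
    by (simp add: half_arclength_def s[OF that] sqrt_abs_mult_abs[OF hpos[OF that]] \<eta>_def mult.assoc[symmetric] sgn_mult_abs
        flip: abs_mult)
  have k: "k t = \<psi> t" if "t \<in> ?I" "t \<noteq> 0" for t
    using that by (simp add: k_def s[OF that(1)] sqrt_abs_mult_abs[OF hpos[OF that(1)]] \<kappa> \<psi>_def)
  have "(\<eta> has_vector_derivative (0 *\<^sub>R vector_derivative (\<lambda>t. sqrt (h t)) (at 0) + 1 *\<^sub>R sqrt (h 0))) (at 0)"
    unfolding \<eta>_def[abs_def] real_scaleR_def[symmetric]
    by (intro has_vector_derivative_scaleR smooth_on_has_vector_derivative[OF sq I0])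
       (auto intro!: derivative_eq_intros)
  then have d\<eta>: "vector_derivative \<eta> (at 0) > 0"
    using hpos[OF I0] by (simp add: vector_derivative_at)
  obtain \<epsilon> where \<epsilon>: "0 < \<epsilon>" "\<epsilon> \<le> d" "inj_on ?half {-\<epsilon><..<\<epsilon>}" "open (?half ` {-\<epsilon><..<\<epsilon>})"
    "smooth_on {-\<epsilon><..<\<epsilon>} ?half" "smooth_on (?half ` {-\<epsilon><..<\<epsilon>}) (inv_into {-\<epsilon><..<\<epsilon>} ?half)"
    using smooth_coordinate_neighbourhood[OF d \<eta> d\<eta> half] by blast
  show "smooth_coordinate_at_0 ?half"
    unfolding smooth_coordinate_at_0_def Let_def using \<epsilon> by blast
  show "smooth_function_at_0_of ?half k"
    using smooth_function_of_coordinate[OF d \<psi> k \<epsilon>(1-4,6)] half[OF I0] by (simp add: \<eta>_def)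
  have "\<forall>\<^sub>F t in at 0. t \<in> ?I" using d by (intro eventually_at_in_open') auto
  moreover have "\<forall>\<^sub>F t in at (0::real). t \<noteq> 0" by (rule eventually_neq_at_within)
  ultimately have ev: "\<forall>\<^sub>F t in at 0. k t = \<psi> t"
    by eventually_elim (rule k)
  then show "smooth_function_at_0_of (\<lambda>t. t) k"
    unfolding smooth_function_at_0_of_def using d \<psi> by blast
  have "isCont \<psi> 0"
    using smooth_on_continuous_on[OF \<psi>] I0 by (simp add: continuous_on_eq_continuous_at)
  then have "(\<psi> \<longlongrightarrow> \<psi> 0) (at 0)" by (simp add: isCont_def)
  then have "(k \<longlongrightarrow> \<psi> 0) (at 0)" using tendsto_cong[OF ev] by blast
  then show "(k \<longlongrightarrow> cuspidal_curvature A g \<gamma> / (2 * sqrt 2)) (at 0)"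
    by (simp add: \<psi>_def \<mu>)
qed

section \<open>Existence of a cusp with given curvature\<close>

lemma continuous_map_chart_inv:
  assumes "c \<in> A"
  shows "continuous_map (top_of_set (region c)) M (chart_inv c)"
proof -
  obtain f where f: "homeomorphic_maps (subtopology M (chart_dom c)) (top_of_set (region c)) (coords c) f"
    using chart_facts(3)[OF assms] homeomorphic_map_maps by blast
  then have cont: "continuous_map (top_of_set (region c)) (subtopology M (chart_dom c)) f"
    and inv: "\<And>p. p \<in> chart_dom c \<Longrightarrow> f (coords c p) = p"
    unfolding homeomorphic_maps_def chart_facts(4)[OF assms] by blast+
  have "continuous_map (top_of_set (region c)) M f"
    using cont by (rule continuous_map_into_fulltopology)
  then show ?thesis
    by (rule continuous_map_eq) (auto simp: inv chart_inv_coords assms)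
qed

lemma smooth_curve_of_chart:
  assumes c: "c \<in> A" and I: "open I" and x: "smooth_on I x" "x ` I \<subseteq> region c"
  shows "smooth_curve M A I (chart_inv c \<circ> x)"
proof -
  have "continuous_map (top_of_set I) (top_of_set (region c)) x"
    using smooth_on_continuous_on[OF x(1)] x(2) by auto
  then have cont: "continuous_map (top_of_set I) M (chart_inv c \<circ> x)"
    using continuous_map_chart_inv[OF c] by (rule continuous_map_compose)
  moreover have "smooth_on {t\<in>I. (chart_inv c \<circ> x) t \<in> chart_dom d} (coords d \<circ> (chart_inv c \<circ> x))"
    if d: "d \<in> A" for d
  proof -
    let ?S = "{t\<in>I. (chart_inv c \<circ> x) t \<in> chart_dom d}"
    have S: "open ?S" by (rule open_chart_time[OF cont I d])
    have "x ` ?S \<subseteq> overlap c d"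
    proof clarify
      fix t assume t: "t \<in> I" "(chart_inv c \<circ> x) t \<in> chart_dom d"
      then have "x t \<in> region c" using x(2) by blast
      then show "x t \<in> overlap c d"
        using chart_inv_region[of "x t" c] t(2) by (intro image_eqI[of _ _ "chart_inv c (x t)"]) auto
    qed
    then have "smooth_on ?S (\<lambda>t. transition c d (x t))"
      using smooth_on_subset[OF x(1), of ?S]
      by (intro smooth_on_compose[OF S open_overlap[OF c d] _ smooth_transition[OF c d]]) auto
    then show ?thesis by (simp add: transition_def o_def)
  qed
  ultimately show ?thesis unfolding smooth_curve_def by blast
qed

text \<open>The curve of \<open>prescribed_cusp\<close>, in some chart of the surface. Its speed \<open>2 \<bar>t\<bar>\<close> integrates to the
arclength \<open>t \<bar>t\<bar>\<close>, and its geodesic curvature is \<open>8 t\<^sup>2 f / (2 \<bar>t\<bar>)\<^sup>3 = f / \<bar>t\<bar>\<close>.\<close>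

lemma cusp_with_given_curvature:
  assumes "\<epsilon> > 0" "smooth_on {-\<epsilon><..<\<epsilon>} f" "f 0 \<noteq> 0"
  shows "\<exists>\<delta>>0. \<exists>\<gamma>. smooth_curve M A {-\<delta><..<\<delta>} \<gamma> \<and> cusp_at_0 A g \<gamma> \<and>
     (\<forall>\<tau>\<in>{-\<delta><..<\<delta>} - {0}. sqrt \<bar>arclength A g \<gamma> \<tau>\<bar> * geodesic_curvature A g \<gamma> \<tau> = f \<tau>) \<and>
     (\<forall>\<tau>\<in>{-\<delta><..<\<delta>}. half_arclength A g \<gamma> \<tau> = \<tau>)"
proof -
  obtain p where "p \<in> topspace M"
    using oriented_riemannian unfolding oriented_riemannian_surface_def oriented_surface_def by blast
  then obtain c where c: "c \<in> A" "p \<in> chart_dom c"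
    using oriented_riemannian unfolding oriented_riemannian_surface_def oriented_surface_def by blast
  interpret C: plane_metric "region c" "chart_metric c" by (rule plane_metric_chart[OF c(1)])
  have "coords c p \<in> region c" using c by blast
  then obtain d x where d: "0 < d" and x: "smooth_on {-d<..<d} x" "x ` {-d<..<d} \<subseteq> region c"
    and v0: "vel x 0 = 0"
    and cusp: "C.area (x 0) (C.cov_deriv x (vel x) 0) (C.cov_deriv x (C.cov_deriv x (vel x)) 0) = 16 * f 0"
    and len: "\<And>t. t \<in> {-d<..<d} \<Longrightarrow> C.len (x t) (vel x t) = 2 * \<bar>t\<bar>"
    and area: "\<And>t. t \<in> {-d<..<d} \<Longrightarrow> C.area (x t) (vel x t) (C.cov_deriv x (vel x) t) = 8 * t\<^sup>2 * f t"
    using C.prescribed_cusp[OF assms(1,2)] by metis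
  let ?I = "{-d<..<d}"
  define \<gamma> where "\<gamma> = chart_inv c \<circ> x"
  have I: "open ?I" "0 \<in> ?I" using d by auto
  have sc: "smooth_curve M A ?I \<gamma>" unfolding \<gamma>_def by (rule smooth_curve_of_chart[OF c(1) I(1) x])
  note curve = sc I(1)
  have dom: "\<gamma> t \<in> chart_dom c" and co: "coords c (\<gamma> t) = x t" if "t \<in> ?I" for t
  proof -
    have "x t \<in> region c" using x(2) that by blast
    then show "\<gamma> t \<in> chart_dom c" "coords c (\<gamma> t) = x t"
      unfolding \<gamma>_def o_apply by (rule chart_inv_region)+
  qed
  have chart: "velocity A \<gamma> t c = vel x t" "acceleration A g \<gamma> t c = C.cov_deriv x (vel x) t"
    "third_deriv A g \<gamma> t c = C.cov_deriv x (C.cov_deriv x (vel x)) t" if "t \<in> ?I" for t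
    by (rule curve_in_chart[OF curve c(1) I(1) order_refl dom co that]; assumption)+
  note tan = smooth_field_tangent[OF curve smooth_field_velocity[OF curve]]
    smooth_field_tangent[OF curve smooth_field_acceleration[OF curve]]
    smooth_field_tangent[OF curve smooth_field_third_deriv[OF curve]]
  have "velocity A \<gamma> 0 = tvec_of A c (\<gamma> 0) 0"
    using tangent_eq_tvec_of[OF c(1) dom[OF I(2)] tan(1)[OF I(2)]] chart(1)[OF I(2)] v0 by simp
  also have "\<dots> = (\<lambda>c. 0)"
    using tvec_of_combine[OF c(1) dom[OF I(2)], of 0 0 0 0] by simp
  finally have vel0: "velocity A \<gamma> 0 = (\<lambda>c. 0)" .
  have "area_element A g (\<gamma> 0) (acceleration A g \<gamma> 0) (third_deriv A g \<gamma> 0) = 16 * f 0"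
    using area_element_in_chart[OF c(1) dom[OF I(2)] tan(2,3)[OF I(2)]] chart(2,3)[OF I(2)] cusp co[OF I(2)]
    by simp
  then have "cusp_at_0 A g \<gamma>" using vel0 assms(3) by (simp add: cusp_at_0_def)
  moreover have s: "arclength A g \<gamma> t = t * \<bar>t\<bar>" if t: "t \<in> ?I" for t
  proof -
    have "arclength A g \<gamma> t = t * \<bar>t\<bar> * integral (cbox 0 1) (\<lambda>s. s ^ 1 *\<^sub>R 2)"
      using arclength_in_chart[OF curve c(1) order_refl dom co t]
        interval_integral_abs_mult[OF smooth_on_const[of ?I 2] t, of "\<lambda>u. C.len (x u) (vel x u)"] len
      by simp
    then show ?thesis using integral_id_01[of 2] by simp
  qed
  moreover have "sqrt \<bar>arclength A g \<gamma> t\<bar> * geodesic_curvature A g \<gamma> t = f t" if t: "t \<in> ?I" "t \<noteq> 0" for t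
  proof -
    have "geodesic_curvature A g \<gamma> t = 8 * t\<^sup>2 * f t / (2 * \<bar>t\<bar>) ^ 3"
      using area_element_in_chart[OF c(1) dom[OF t(1)] tan(1,2)[OF t(1)]]
        tnorm_in_chart[OF c(1) dom[OF t(1)] tan(1)[OF t(1)]] chart(1,2)[OF t(1)] co[OF t(1)] len[OF t(1)] area[OF t(1)]
      by (simp add: geodesic_curvature_def)
    also have "(2 * \<bar>t\<bar>) ^ 3 = 8 * t\<^sup>2 * \<bar>t\<bar>"
      by (simp add: power_mult_distrib power3_eq_cube power2_eq_square)
    also have "8 * t\<^sup>2 * f t / (8 * t\<^sup>2 * \<bar>t\<bar>) = f t / \<bar>t\<bar>"
      using t(2) by simp
    finally show ?thesis
      using t(2) sqrt_abs_mult_abs[of 1 t] by (simp add: s[OF t(1)])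
  qed
  moreover have "half_arclength A g \<gamma> t = t" if "t \<in> ?I" for t
    using sqrt_abs_mult_abs[of 1 t] by (simp add: half_arclength_def s[OF that] sgn_mult_abs)
  ultimately show ?thesis using d sc by blast
qed

end

theorem theorem2p6:
  fixes M :: "'p topology" and A :: "'p chart set" and g :: "'p metric"
  assumes "oriented_riemannian_surface M A g"
  shows "(\<forall>\<delta> \<gamma>. 0 < \<delta> \<and> smooth_curve M A {-\<delta><..<\<delta>} \<gamma> \<and> cusp_at_0 A g \<gamma> \<longrightarrow>
            smooth_coordinate_at_0 (half_arclength A g \<gamma>) \<and>
            smooth_function_at_0_of (\<lambda>t. t)
              (\<lambda>t. sqrt \<bar>arclength A g \<gamma> t\<bar> * geodesic_curvature A g \<gamma> t) \<and>
            smooth_function_at_0_of (half_arclength A g \<gamma>)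
              (\<lambda>t. sqrt \<bar>arclength A g \<gamma> t\<bar> * geodesic_curvature A g \<gamma> t) \<and>
            ((\<lambda>t. sqrt \<bar>arclength A g \<gamma> t\<bar> * geodesic_curvature A g \<gamma> t)
               \<longlongrightarrow> cuspidal_curvature A g \<gamma> / (2 * sqrt 2)) (at 0))
       \<and> (\<forall>f :: real \<Rightarrow> real. (\<exists>\<epsilon>>0. smooth_on {-\<epsilon><..<\<epsilon>} f) \<and> f 0 \<noteq> 0 \<longrightarrow>
            (\<exists>\<delta>>0. \<exists>\<gamma>. smooth_curve M A {-\<delta><..<\<delta>} \<gamma> \<and> cusp_at_0 A g \<gamma> \<and>
               (\<forall>\<tau>\<in>{-\<delta><..<\<delta>} - {0}.
                  sqrt \<bar>arclength A g \<gamma> \<tau>\<bar> * geodesic_curvature A g \<gamma> \<tau> = f \<tau>) \<and>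
               (\<forall>\<tau>\<in>{-\<delta><..<\<delta>}. half_arclength A g \<gamma> \<tau> = \<tau>)))"
proof -
  interpret riemannian_surface M A g by (rule riemannian_surface.intro[OF assms])
  show ?thesis
    using curvature_at_cusp cusp_with_given_curvature by blast
qed

end
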